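(* Let $R$ be a discrete valuation domain of characteristic $0$ with maximal ideal $pR$ for some prime number $p$, let $G$ be a finite cyclic $p$-group, and let $N$ be a normal subgroup of $G$. Suppose that the $R[G]$-lattice $M$ satisfies the following two hypotheses: (i) $\mathrm{res}^G_N(M)$ is an $R[N]$-permutation module; and (ii) $M^N$ is an $R[G/N]$-permutation module. Then $M$ is an $R[G]$-permutation module.
   Context: An $R[G]$-lattice is a finitely generated left $R[G]$-module which is projective as an $R$-module. For a finite group $H$, an $R[H]$-permutation module is an $R[H]$-module isomorphic to $R[\Omega]$ for some finite left $H$-set $\Omega$. $\mathrm{res}^G_N(M)$ is the restriction of $M$ to $R[N]$, and $M^N$ is the $R[G/N]$-module of $N$-invariants of $M$. *)

theory Defs
  imports "HOL-Algebra.Algebra" "HOL-Computational_Algebra.Primes"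
begin

locale discrete_valuation_domain = principal_domain +
  assumes unique_maximalideal: "\<exists>!J. maximalideal J R"
    and not_field: "\<not> field R"

text \<open>The library locale \<^locale>\<open>module\<close> requires a commutative ring of scalars, whereas group
  rings are in general not commutative. The fields \<open>mult\<close> and \<open>one\<close> that a module record inherits
  from rings play no role.\<close>

locale left_module = R?: ring R + M?: abelian_group M
  for R :: "('r, 'a) ring_scheme" (structure) and M :: "('r, 'm, 'b) module_scheme" (structure) +
  assumes smult_closed:
      "\<lbrakk>a \<in> carrier R; x \<in> carrier M\<rbrakk> \<Longrightarrow> a \<odot>\<^bsub>M\<^esub> x \<in> carrier M"
    and smult_l_distr:
      "\<lbrakk>a \<in> carrier R; b \<in> carrier R; x \<in> carrier M\<rbrakk> \<Longrightarrow>
        (a \<oplus> b) \<odot>\<^bsub>M\<^esub> x = a \<odot>\<^bsub>M\<^esub> x \<oplus>\<^bsub>M\<^esub> b \<odot>\<^bsub>M\<^esub> x"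
    and smult_r_distr:
      "\<lbrakk>a \<in> carrier R; x \<in> carrier M; y \<in> carrier M\<rbrakk> \<Longrightarrow>
        a \<odot>\<^bsub>M\<^esub> (x \<oplus>\<^bsub>M\<^esub> y) = a \<odot>\<^bsub>M\<^esub> x \<oplus>\<^bsub>M\<^esub> a \<odot>\<^bsub>M\<^esub> y"
    and smult_assoc:
      "\<lbrakk>a \<in> carrier R; b \<in> carrier R; x \<in> carrier M\<rbrakk> \<Longrightarrow>
        (a \<otimes> b) \<odot>\<^bsub>M\<^esub> x = a \<odot>\<^bsub>M\<^esub> (b \<odot>\<^bsub>M\<^esub> x)"
    and smult_one:
      "x \<in> carrier M \<Longrightarrow> \<one> \<odot>\<^bsub>M\<^esub> x = x"

definition left_module_hom ::
  "('r, 'a) ring_scheme \<Rightarrow> ('r, 'm, 'b) module_scheme \<Rightarrow> ('r, 'n, 'c) module_scheme \<Rightarrow> ('m \<Rightarrow> 'n) set"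
  where "left_module_hom R M M' =
    {h \<in> carrier M \<rightarrow> carrier M'.
      (\<forall>x\<in>carrier M. \<forall>y\<in>carrier M. h (x \<oplus>\<^bsub>M\<^esub> y) = h x \<oplus>\<^bsub>M'\<^esub> h y) \<and>
      (\<forall>a\<in>carrier R. \<forall>x\<in>carrier M. h (a \<odot>\<^bsub>M\<^esub> x) = a \<odot>\<^bsub>M'\<^esub> h x)}"

definition left_module_isomorphic ::
  "('r, 'a) ring_scheme \<Rightarrow> ('r, 'm, 'b) module_scheme \<Rightarrow> ('r, 'n, 'c) module_scheme \<Rightarrow> bool"
  where "left_module_isomorphic R M M' \<longleftrightarrow>
    (\<exists>h\<in>left_module_hom R M M'. bij_betw h (carrier M) (carrier M'))"

definition finitely_generated_module ::
  "('r, 'a) ring_scheme \<Rightarrow> ('r, 'm, 'b) module_scheme \<Rightarrow> bool"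
  where "finitely_generated_module R M \<longleftrightarrow>
    (\<exists>S. finite S \<and> S \<subseteq> carrier M \<and>
      (\<forall>x\<in>carrier M. \<exists>c\<in>S \<rightarrow> carrier R. x = (\<Oplus>\<^bsub>M\<^esub>s\<in>S. c s \<odot>\<^bsub>M\<^esub> s)))"

definition restrict_scalars ::
  "('s \<Rightarrow> 'r) \<Rightarrow> ('r, 'm, 'b) module_scheme \<Rightarrow> ('s, 'm) module"
  where "restrict_scalars f M =
    \<lparr>carrier = carrier M, monoid.mult = monoid.mult M, one = one M,
     ring.zero = ring.zero M, ring.add = ring.add M,
     smult = (\<lambda>a x. f a \<odot>\<^bsub>M\<^esub> x)\<rparr>"

definition free_module :: "('r, 'a) ring_scheme \<Rightarrow> 'i set \<Rightarrow> ('r, 'i \<Rightarrow> 'r) module"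
  where "free_module R I =
    \<lparr>carrier = {f \<in> I \<rightarrow>\<^sub>E carrier R. finite {i \<in> I. f i \<noteq> \<zero>\<^bsub>R\<^esub>}},
     monoid.mult = undefined, one = undefined,
     ring.zero = (\<lambda>i\<in>I. \<zero>\<^bsub>R\<^esub>),
     ring.add = (\<lambda>f g. \<lambda>i\<in>I. f i \<oplus>\<^bsub>R\<^esub> g i),
     smult = (\<lambda>a f. \<lambda>i\<in>I. a \<otimes>\<^bsub>R\<^esub> f i)\<rparr>"

text \<open>A module is projective if it is a direct summand of a free module. Index sets within the type
  of the elements of \<open>P\<close> are enough: if \<open>P\<close> is a summand of any free module, then the canonical
  surjection onto \<open>P\<close> from the free module on \<open>carrier P\<close> splits.\<close>

definition projective_module :: "('r, 'a) ring_scheme \<Rightarrow> ('r, 'm, 'b) module_scheme \<Rightarrow> bool"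
  where "projective_module R P \<longleftrightarrow>
    left_module R P \<and>
    (\<exists>(I :: 'm set).
      \<exists>i\<in>left_module_hom R P (free_module R I).
      \<exists>q\<in>left_module_hom R (free_module R I) P. \<forall>x\<in>carrier P. q (i x) = x)"

text \<open>The element \<open>\<Sum> a\<^sub>x x\<close> of \<open>R[G]\<close> is represented by its coefficient function \<open>x \<mapsto> a\<^sub>x\<close>,
  extended by \<open>undefined\<close> outside \<open>G\<close>; the product is convolution.\<close>

definition group_ring ::
  "('r, 'a) ring_scheme \<Rightarrow> ('g, 'b) monoid_scheme \<Rightarrow> ('g \<Rightarrow> 'r) ring"
  where "group_ring R G =
    \<lparr>carrier = carrier (free_module R (carrier G)),
     monoid.mult = (\<lambda>a b. \<lambda>x\<in>carrier G.
       \<Oplus>\<^bsub>R\<^esub>y\<in>{y \<in> carrier G. a y \<noteq> \<zero>\<^bsub>R\<^esub>}. a y \<otimes>\<^bsub>R\<^esub> b (inv\<^bsub>G\<^esub> y \<otimes>\<^bsub>G\<^esub> x)),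
     one = (\<lambda>x\<in>carrier G. if x = \<one>\<^bsub>G\<^esub> then \<one>\<^bsub>R\<^esub> else \<zero>\<^bsub>R\<^esub>),
     ring.zero = ring.zero (free_module R (carrier G)),
     ring.add = ring.add (free_module R (carrier G))\<rparr>"

text \<open>The element \<open>r g\<close> of \<open>R[G]\<close>; for \<open>g = 1\<close> this is the structure map \<open>R \<rightarrow> R[G]\<close>.\<close>

definition gr_monom ::
  "('r, 'a) ring_scheme \<Rightarrow> ('g, 'b) monoid_scheme \<Rightarrow> 'g \<Rightarrow> 'r \<Rightarrow> 'g \<Rightarrow> 'r"
  where "gr_monom R G g r = (\<lambda>x\<in>carrier G. if x = g then r else \<zero>\<^bsub>R\<^esub>)"

definition underlying_module ::
  "('r, 'a) ring_scheme \<Rightarrow> ('g, 'b) monoid_scheme \<Rightarrow> ('g \<Rightarrow> 'r, 'm, 'c) module_scheme \<Rightarrow> ('r, 'm) module"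
  where "underlying_module R G M = restrict_scalars (gr_monom R G \<one>\<^bsub>G\<^esub>) M"

definition group_lattice ::
  "('r, 'a) ring_scheme \<Rightarrow> ('g, 'b) monoid_scheme \<Rightarrow> ('g \<Rightarrow> 'r, 'm, 'c) module_scheme \<Rightarrow> bool"
  where "group_lattice R G M \<longleftrightarrow>
    left_module (group_ring R G) M \<and>
    finitely_generated_module (group_ring R G) M \<and>
    projective_module R (underlying_module R G M)"

text \<open>Restriction to the subgroup \<open>N\<close> is along the inclusion \<open>R[N] \<rightarrow> R[G]\<close>, extension of
  coefficient functions by zero.\<close>

definition res_module ::
  "('r, 'a) ring_scheme \<Rightarrow> ('g, 'b) monoid_scheme \<Rightarrow> 'g set \<Rightarrow> ('g \<Rightarrow> 'r, 'm, 'c) module_scheme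
    \<Rightarrow> ('g \<Rightarrow> 'r, 'm) module"
  where "res_module R G N M =
    restrict_scalars (\<lambda>a. \<lambda>x\<in>carrier G. if x \<in> N then a x else \<zero>\<^bsub>R\<^esub>) M"

text \<open>On \<open>M\<^sup>N\<close> a coset \<open>C \<in> G/N\<close> acts as any of its representatives.\<close>

definition invariants_module ::
  "('r, 'a) ring_scheme \<Rightarrow> ('g, 'b) monoid_scheme \<Rightarrow> 'g set \<Rightarrow> ('g \<Rightarrow> 'r, 'm, 'c) module_scheme
    \<Rightarrow> ('g set \<Rightarrow> 'r, 'm) module"
  where "invariants_module R G N M =
    \<lparr>carrier = {x \<in> carrier M. \<forall>n\<in>N. gr_monom R G n \<one>\<^bsub>R\<^esub> \<odot>\<^bsub>M\<^esub> x = x},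
     monoid.mult = monoid.mult M, one = one M,
     ring.zero = ring.zero M, ring.add = ring.add M,
     smult = (\<lambda>a x. \<Oplus>\<^bsub>M\<^esub>C\<in>{C \<in> carrier (G Mod N). a C \<noteq> \<zero>\<^bsub>R\<^esub>}.
       gr_monom R G (SOME g. g \<in> C) (a C) \<odot>\<^bsub>M\<^esub> x)\<rparr>"

text \<open>\<open>R[\<Omega>]\<close>, again in terms of coefficient functions: the coefficient of
  \<open>(\<Sum> a\<^sub>h h) (\<Sum> f\<^sub>v v)\<close> at \<open>w\<close> is the sum of the \<open>a\<^sub>h f\<^sub>v\<close> with \<open>h v = w\<close>.\<close>

definition set_module ::
  "('r, 'a) ring_scheme \<Rightarrow> ('h, 'b) monoid_scheme \<Rightarrow> 'w set \<Rightarrow> ('h \<Rightarrow> 'w \<Rightarrow> 'w)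
    \<Rightarrow> ('h \<Rightarrow> 'r, 'w \<Rightarrow> 'r) module"
  where "set_module R H \<Omega> \<phi> =
    \<lparr>carrier = carrier (free_module R \<Omega>),
     monoid.mult = undefined, one = undefined,
     ring.zero = ring.zero (free_module R \<Omega>),
     ring.add = ring.add (free_module R \<Omega>),
     smult = (\<lambda>a f. \<lambda>w\<in>\<Omega>.
       \<Oplus>\<^bsub>R\<^esub>h\<in>{h \<in> carrier H. a h \<noteq> \<zero>\<^bsub>R\<^esub>}. a h \<otimes>\<^bsub>R\<^esub> f (\<phi> (inv\<^bsub>H\<^esub> h) w))\<rparr>"

text \<open>Every finite \<open>H\<close>-set is isomorphic to one whose points are natural numbers.\<close>

definition permutation_module ::
  "('r, 'a) ring_scheme \<Rightarrow> ('h, 'b) monoid_scheme \<Rightarrow> ('h \<Rightarrow> 'r, 'm, 'c) module_scheme \<Rightarrow> bool"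
  where "permutation_module R H M \<longleftrightarrow>
    left_module (group_ring R H) M \<and>
    (\<exists>(\<Omega> :: nat set) \<phi>. finite \<Omega> \<and> group_action H \<Omega> \<phi> \<and>
      left_module_isomorphic (group_ring R H) M (set_module R H \<Omega> \<phi>))"

end

theory Submission
  imports "HOL-Computational_Algebra.Polynomial" Defs
begin

text \<open>Let \<open>g\<close> generate \<open>G\<close>, of order \<open>p\<^sup>k\<close>, let \<open>T\<close> be its action on \<open>M\<close>, and let \<open>N\<close> be generated by the
\<open>p\<^sup>a\<close>-th power of \<open>g\<close>. The vectors fixed by the \<open>p\<^sup>j\<close>-th power of \<open>T\<close> form a chain of submodules \<open>U\<^sub>j\<close>
that starts with \<open>U\<^sub>a = M\<^sup>N\<close> and ends with \<open>U\<^sub>k = M\<close>. A permutation module is handled through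
coordinates (\<open>coordinates\<close>): a bijective linear map to \<open>R\<^sup>\<Omega>\<close>, for a finite set \<open>\<Omega>\<close>, under which \<open>T\<close>
permutes the coordinates. Hypothesis (ii) provides them on \<open>U\<^sub>a\<close>, and they are pushed up the chain
(\<open>coordinates_ascend\<close>).

One step goes from \<open>P = U\<^sub>j\<close> to \<open>U = U\<^sub>j\<^sub>+\<^sub>1\<close>. Put \<open>q = p\<^sup>j\<close> and \<open>n = p q\<close>, let \<open>S\<close> be the \<open>q\<close>-th power of \<open>T\<close>,
and let \<open>\<Phi> = 1 + S + \<dots> + S\<^sup>p\<^sup>-\<^sup>1\<close> be the norm from \<open>U\<close> to \<open>P\<close>. By hypothesis (i), \<open>S\<close> permutes a basis
of \<open>M\<close>; so there is a linear projection \<open>\<rho>\<close> of \<open>U\<close> onto \<open>P\<close> such that every vector that \<open>S\<close> fixes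
modulo \<open>p\<close> is congruent to its image (\<open>projection_onto_fixed\<close>). This makes the kernel of \<open>\<Phi>\<close> equal
to \<open>(S - 1) U\<close> (\<open>kernel_of_norm\<close>), which is the vanishing of a Tate cohomology group of \<open>\<langle>S\<rangle>\<close>, and
it enters in two ways.

If \<open>\<Phi> U \<subseteq> p U\<close>, then \<open>U = P + (S - 1) U\<close>; as \<open>S - 1\<close> is nilpotent modulo \<open>p\<close>, this forces \<open>U = P\<close>
(\<open>norms_p_multiples_imp_fixed\<close>).

Otherwise, since \<open>T - 1\<close> is nilpotent modulo \<open>p\<close>, some \<open>\<Phi> x\<close> outside \<open>p U\<close> is fixed by \<open>T\<close> modulo \<open>p\<close>,
and the description of the kernel shows that modulo \<open>p\<close> it is a full norm \<open>(1 + T + \<dots> + T\<^sup>n\<^sup>-\<^sup>1) v\<close>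
(\<open>fixed_mod_p_is_norm\<close>). Some coordinate \<open>\<kappa>\<^sub>b\<close> of this full norm is a unit. The form
\<open>\<mu> = \<kappa>\<^sub>b \<circ> \<rho>\<close> on \<open>U\<close> then has a dual vector \<open>y\<close>, that is, \<open>\<mu> y = 1\<close> and \<open>\<mu> (T\<^sup>l y) = 0\<close> for
\<open>0 < l < n\<close>: the norm spans the socle of the group algebra of a cyclic \<open>p\<close>-group over the residue
field, and a form that does not kill the socle of a cyclic submodule is a generator of its dual
(\<open>dual_vector\<close>). The translates of \<open>y\<close> span a free summand of \<open>U\<close>, whose complement
\<open>U'\<close> is the set of \<open>x\<close> with \<open>\<mu> (T\<^sup>l x) = 0\<close> for all \<open>l\<close>. Because \<open>\<mu>\<close> factors through \<open>\<rho>\<close>, the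
intersection of \<open>U'\<close> and \<open>P\<close> is cut out of \<open>P\<close> by the vanishing of the coordinates in the orbit of
\<open>b\<close>, so it again has permuted coordinates, but fewer of them. Induction on \<open>card \<Omega>\<close> finishes the step (\<open>layer_coordinates\<close>).\<close>

section \<open>Integer polynomials modulo a prime\<close>

lemma frobenius_minus_one:
  fixes a :: "'a::comm_ring_1"
  assumes "Factorial_Ring.prime (p::nat)"
  shows "\<exists>g. (a - 1) ^ p = a ^ p - 1 + of_nat p * g"
proof -
  define t where "t k = of_nat (p choose k) * a ^ k * (- 1) ^ (p - k)" for k
  have p0: "p > 1" using assms by (rule prime_gt_1_nat)
  have p2: "p = 2" if "even p" using that assms primes_dvd_imp_eq two_is_prime_nat by blast
  have dvd: "of_nat p dvd t k" if "k \<in> {1..<p}" for k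
  proof -
    have "p dvd (p choose k)"
      using that assms by (intro dvd_choose_prime) auto
    thus ?thesis unfolding t_def by (metis dvd_mult2 of_nat_dvd_iff dvd_def of_nat_mult)
  qed
  have "(a - 1) ^ p = (\<Sum>k\<le>p. t k)"
    using binomial_ring[of a "-1" p] by (simp add: t_def)
  also have "{..p} = insert 0 (insert p {1..<p})" using p0 by auto
  also have "(\<Sum>k\<in>insert 0 (insert p {1..<p}). t k) = (- 1) ^ p + a ^ p + (\<Sum>k\<in>{1..<p}. t k)"
    using p0 by (simp add: t_def)
  finally have 1: "(a - 1) ^ p = (- 1) ^ p + a ^ p + (\<Sum>k\<in>{1..<p}. t k)" .
  have 2: "of_nat p dvd (\<Sum>k\<in>{1..<p}. t k)" using dvd by (intro dvd_sum) auto
  have 3: "of_nat p dvd (- 1) ^ p + (1 :: 'a)"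
  proof (cases "even p")
    case True
    thus ?thesis using p2 by simp
  qed auto
  have "of_nat p dvd (a - 1) ^ p - (a ^ p - 1)"
    using dvd_add[OF 2 3] unfolding 1 by (simp add: algebra_simps)
  then obtain g where "(a - 1) ^ p - (a ^ p - 1) = of_nat p * g" by (auto elim: dvdE)
  hence "(a - 1) ^ p = a ^ p - 1 + of_nat p * g" by (simp add: algebra_simps)
  thus ?thesis ..
qed

lemma frobenius_minus_one_iterated:
  fixes a :: "'a::comm_ring_1"
  assumes p: "Factorial_Ring.prime (p::nat)"
  shows "\<exists>g. (a - 1) ^ (p ^ m) = a ^ (p ^ m) - 1 + of_nat p * g"
proof (induction m)
  case 0
  show ?case by (rule exI[of _ 0]) simp
next
  case (Suc m)
  then obtain g where g: "(a - 1) ^ (p ^ m) = a ^ (p ^ m) - 1 + of_nat p * g" by blast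
  obtain h where h: "(a ^ (p ^ m) - 1) ^ p = (a ^ (p ^ m)) ^ p - 1 + of_nat p * h"
    using frobenius_minus_one[OF p] by blast
  have "of_nat p dvd (a ^ (p ^ m) - 1 + of_nat p * g) - (a ^ (p ^ m) - 1)" by simp
  also have "\<dots> dvd (a ^ (p ^ m) - 1 + of_nat p * g) ^ p - (a ^ (p ^ m) - 1) ^ p"
    unfolding power_diff_sumr2[of _ p "a ^ (p ^ m) - 1"] by simp
  finally obtain k where "(a ^ (p ^ m) - 1 + of_nat p * g) ^ p - (a ^ (p ^ m) - 1) ^ p = of_nat p * k"
    by (auto elim: dvdE)
  hence "(a - 1) ^ (p ^ Suc m) = a ^ (p ^ Suc m) - 1 + of_nat p * (h + k)"
    unfolding power_Suc2 power_mult g by (simp add: h algebra_simps)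
  thus ?case ..
qed

text \<open>On vectors fixed by \<open>a\<close> the geometric sum is multiplication by \<open>n\<close>; the cofactor measures the
difference elsewhere.\<close>

lemma geometric_cofactor:
  fixes a :: "'a::comm_ring_1"
  shows "\<exists>g. (\<Sum>i<n. a ^ i) = of_nat n + (a - 1) * g"
proof -
  have "a - 1 dvd (\<Sum>i<n. a ^ i - 1)"
    by (intro dvd_sum) (simp add: power_diff_1_eq)
  then obtain g where "(\<Sum>i<n. a ^ i - 1) = (a - 1) * g" by (auto elim: dvdE)
  hence "(\<Sum>i<n. a ^ i) = of_nat n + (a - 1) * g" by (simp add: sum_subtractf algebra_simps)
  thus ?thesis ..
qed

text \<open>The indeterminate. It is kept folded, so that its powers are not expanded into coefficient lists.\<close>

definition indet :: "int poly" ("\<xi>") where "\<xi> = pCons 0 (pCons 1 0)"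

lemma indet_minus_one_neq_0: "\<xi> - 1 \<noteq> 0"
  by (simp add: indet_def one_pCons)

text \<open>Modulo \<open>p\<close>, the norm element of a cyclic group of order \<open>p\<^sup>m\<close> is the last nonvanishing power of
the generator \<open>\<xi> - 1\<close> of the augmentation ideal. Both sides become \<open>\<xi>\<^sup>n - 1\<close> modulo \<open>p\<close> after
multiplication by \<open>\<xi> - 1\<close>, and \<open>\<xi> - 1\<close> can be cancelled since it is no zero divisor modulo \<open>p\<close>:
if it divides \<open>p g\<close>, then \<open>g\<close> vanishes at \<open>1\<close>.\<close>

lemma socle_identity:
  assumes p: "Factorial_Ring.prime (p::nat)"
  shows "\<exists>g. (\<xi> - 1) ^ (p ^ m - 1) = (\<Sum>i<p ^ m. \<xi> ^ i) + of_nat p * g"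
proof -
  define n where "n = p ^ m - 1"
  have n: "p ^ m = Suc n" using p by (simp add: n_def prime_gt_0_nat)
  obtain g where g: "(\<xi> - 1) ^ Suc n = \<xi> ^ Suc n - 1 + of_nat p * g"
    using frobenius_minus_one_iterated[OF p, of \<xi> m] unfolding n by blast
  have eq: "(\<xi> - 1) * ((\<xi> - 1) ^ n - (\<Sum>i<Suc n. \<xi> ^ i)) = of_nat p * g"
    unfolding right_diff_distrib power_diff_1_eq[of \<xi> "Suc n", symmetric]
    using g by (simp add: algebra_simps)
  have "poly (of_nat p * g) 1 = 0" unfolding eq[symmetric] by (simp add: indet_def)
  hence "poly g 1 = 0" using p by (simp add: prime_gt_0_nat)
  hence "\<xi> - 1 dvd g" by (simp add: poly_eq_0_iff_dvd indet_def one_pCons)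
  then obtain h where h: "g = (\<xi> - 1) * h" by (rule dvdE)
  have "(\<xi> - 1) * ((\<xi> - 1) ^ n - (\<Sum>i<Suc n. \<xi> ^ i)) = (\<xi> - 1) * (of_nat p * h)"
    unfolding eq h by (simp only: mult.left_commute)
  hence "(\<xi> - 1) ^ n - (\<Sum>i<Suc n. \<xi> ^ i) = of_nat p * h"
    using indet_minus_one_neq_0 mult_left_cancel by blast
  hence "(\<xi> - 1) ^ n = (\<Sum>i<Suc n. \<xi> ^ i) + of_nat p * h"
    by (metis diff_eq_eq add.commute)
  thus ?thesis unfolding n diff_Suc_1 by blast
qed

lemma geometric_sum_split:
  "(\<Sum>i<q. \<xi> ^ i) * (\<Sum>i<p. (\<xi> ^ q) ^ i) = (\<Sum>i<p * q. \<xi> ^ i)"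
proof -
  have "(\<xi> - 1) * ((\<Sum>i<q. \<xi> ^ i) * (\<Sum>i<p. (\<xi> ^ q) ^ i)) = (\<xi> ^ q - 1) * (\<Sum>i<p. (\<xi> ^ q) ^ i)"
    by (simp only: power_diff_1_eq mult.assoc)
  also have "\<dots> = (\<xi> ^ q) ^ p - 1" by (simp only: power_diff_1_eq)
  also have "\<dots> = \<xi> ^ (p * q) - 1" by (simp add: mult.commute flip: power_mult)
  also have "\<dots> = (\<xi> - 1) * (\<Sum>i<p * q. \<xi> ^ i)"
    by (simp only: power_diff_1_eq)
  finally show ?thesis using indet_minus_one_neq_0 mult_left_cancel by blast
qed

section \<open>Modules over a local ring with a linear operator\<close>

locale local_operator = module R M + R?: domain R
  for R :: "('r, 'a) ring_scheme" (structure) and M :: "('r, 'm, 'b) module_scheme" (structure) +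
  fixes p :: nat and T :: "'m \<Rightarrow> 'm"
  assumes prime_p: "Factorial_Ring.prime p"
    and p_not_unit: "[int p] \<cdot>\<^bsub>R\<^esub> \<one> \<notin> Units R"
    and p_nonzero: "[int p] \<cdot>\<^bsub>R\<^esub> \<one> \<noteq> \<zero>"
    and unit_or_p_dvd: "r \<in> carrier R \<Longrightarrow> r \<in> Units R \<or> (\<exists>s\<in>carrier R. r = [int p] \<cdot>\<^bsub>R\<^esub> \<one> \<otimes> s)"
    and T_closed: "x \<in> carrier M \<Longrightarrow> T x \<in> carrier M"
    and T_add: "\<lbrakk>x \<in> carrier M; y \<in> carrier M\<rbrakk> \<Longrightarrow> T (x \<oplus>\<^bsub>M\<^esub> y) = T x \<oplus>\<^bsub>M\<^esub> T y"
    and T_smult: "\<lbrakk>r \<in> carrier R; x \<in> carrier M\<rbrakk> \<Longrightarrow> T (r \<odot>\<^bsub>M\<^esub> x) = r \<odot>\<^bsub>M\<^esub> T x"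
begin

abbreviation vadd (infixl "\<boxplus>" 65) where "x \<boxplus> y \<equiv> x \<oplus>\<^bsub>M\<^esub> y"
abbreviation vsub (infixl "\<boxminus>" 65) where "x \<boxminus> y \<equiv> x \<ominus>\<^bsub>M\<^esub> y"
abbreviation scale (infixr "\<bullet>" 75) where "a \<bullet> x \<equiv> a \<odot>\<^bsub>M\<^esub> x"
abbreviation vzero ("\<zero>\<^sub>M") where "\<zero>\<^sub>M \<equiv> \<zero>\<^bsub>M\<^esub>"

definition \<iota> :: "int \<Rightarrow> 'r" where "\<iota> k = [k] \<cdot>\<^bsub>R\<^esub> \<one>"
abbreviation \<pi> :: 'r where "\<pi> \<equiv> \<iota> (int p)"

lemma iota_closed [simp]: "\<iota> k \<in> carrier R"
  by (simp add: \<iota>_def)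

lemma iota_0 [simp]: "\<iota> 0 = \<zero>"
  by (simp add: \<iota>_def add_pow_def)

lemma iota_1 [simp]: "\<iota> 1 = \<one>"
  by (simp add: \<iota>_def R.add.int_pow_1)

lemma iota_add: "\<iota> (a + b) = \<iota> a \<oplus> \<iota> b"
  by (simp add: \<iota>_def R.add.int_pow_mult)

lemma iota_mult: "\<iota> (a * b) = \<iota> a \<otimes> \<iota> b"
proof -
  have "\<iota> a \<otimes> \<iota> b = [a] \<cdot>\<^bsub>R\<^esub> ([b] \<cdot>\<^bsub>R\<^esub> \<one>)"
    by (simp add: \<iota>_def add_pow_ldistr_int)
  also have "\<dots> = [(a * b)] \<cdot>\<^bsub>R\<^esub> \<one>" by (simp add: R.add.int_pow_pow mult.commute)
  finally show ?thesis by (simp add: \<iota>_def)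
qed

text \<open>All operators that occur in the argument, norms in particular, are integer polynomials in \<open>T\<close>, so
identities between them can be proved in the commutative ring of integer polynomials.\<close>

primrec act_list :: "int list \<Rightarrow> 'm \<Rightarrow> 'm" where
  "act_list [] x = \<zero>\<^sub>M"
| "act_list (a # as) x = \<iota> a \<bullet> x \<boxplus> T (act_list as x)"

definition act :: "int poly \<Rightarrow> 'm \<Rightarrow> 'm" where "act f = act_list (coeffs f)"

lemma T_zero [simp]: "T \<zero>\<^sub>M = \<zero>\<^sub>M"
  by (metis M.zero_closed R.zero_closed T_closed T_smult smult_l_null)

lemma act_0 [simp]: "act 0 x = \<zero>\<^sub>M"
  by (simp add: act_def)

lemma act_pCons:
  assumes "x \<in> carrier M"
  shows "act (pCons a f) x = \<iota> a \<bullet> x \<boxplus> T (act f x)"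
  using assms by (auto simp: act_def cCons_def)

lemma act_closed [simp, intro]: "x \<in> carrier M \<Longrightarrow> act f x \<in> carrier M"
  by (induction f rule: pCons_induct) (auto simp: act_pCons T_closed)

lemma act_vadd:
  assumes [simp]: "x \<in> carrier M" "y \<in> carrier M"
  shows "act f (x \<boxplus> y) = act f x \<boxplus> act f y"
proof (induction f rule: pCons_induct)
  case (pCons a f)
  have [simp]: "T (act f x) \<in> carrier M" "T (act f y) \<in> carrier M" by (auto intro: T_closed)
  show ?case
    by (simp add: act_pCons pCons.IH T_add smult_r_distr M.a_ac)
qed simp

lemma act_scale:
  assumes [simp]: "r \<in> carrier R" "x \<in> carrier M"
  shows "act f (r \<bullet> x) = r \<bullet> act f x"
proof (induction f rule: pCons_induct)
  case (pCons a f)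
  have [simp]: "T (act f x) \<in> carrier M" by (auto intro: T_closed)
  show ?case
    by (simp add: act_pCons pCons.IH T_smult smult_r_distr m_comm flip: smult_assoc1)
qed simp

lemma act_add:
  assumes [simp]: "x \<in> carrier M"
  shows "act (f + g) x = act f x \<boxplus> act g x"
proof (induction f g rule: poly_induct2)
  case (pCons a f b g)
  have [simp]: "T (act f x) \<in> carrier M" "T (act g x) \<in> carrier M" by (auto intro: T_closed)
  show ?case
    by (simp add: act_pCons pCons.IH T_add smult_l_distr iota_add M.a_ac)
qed simp

lemma act_smult:
  assumes [simp]: "x \<in> carrier M"
  shows "act (Polynomial.smult k f) x = \<iota> k \<bullet> act f x"
proof (induction f rule: pCons_induct)
  case (pCons a f)
  have [simp]: "T (act f x) \<in> carrier M" by (auto intro: T_closed)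
  show ?case
    by (simp add: act_pCons pCons.IH T_smult smult_r_distr iota_mult smult_assoc1)
qed simp

lemma act_mult:
  assumes [simp]: "x \<in> carrier M"
  shows "act (f * g) x = act f (act g x)"
proof (induction f rule: pCons_induct)
  case (pCons a f)
  show ?case
    by (simp add: act_pCons pCons.IH act_add act_smult T_closed)
qed simp

lemma act_1 [simp]: "x \<in> carrier M \<Longrightarrow> act 1 x = x"
  by (simp add: one_pCons act_pCons)

lemma act_indet: "x \<in> carrier M \<Longrightarrow> act \<xi> x = T x"
  by (simp add: indet_def act_pCons T_closed)

lemma act_indet_power_Suc: "x \<in> carrier M \<Longrightarrow> act (\<xi> ^ Suc k) x = T (act (\<xi> ^ k) x)"
  by (simp add: act_mult act_indet)

lemma act_of_nat_mult: "x \<in> carrier M \<Longrightarrow> act (of_nat k * f) x = \<iota> (int k) \<bullet> act f x"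
  by (simp add: of_nat_poly act_smult)

lemma act_minus: "x \<in> carrier M \<Longrightarrow> act (f - g) x = act f x \<boxminus> act g x"
proof -
  assume x: "x \<in> carrier M"
  have "act f x = act (f - g) x \<boxplus> act g x" using act_add[OF x, of "f - g" g] by simp
  thus ?thesis using x
    by (simp add: M.minus_eq M.a_assoc M.r_neg)
qed

lemma act_vzero [simp]: "act f \<zero>\<^sub>M = \<zero>\<^sub>M"
  using act_scale[of \<zero> "\<zero>\<^sub>M" f] by simp

lemma act_commute: "x \<in> carrier M \<Longrightarrow> act f (act g x) = act g (act f x)"
  by (metis act_mult mult.commute)

lemma vsub_eq_scale: "x \<in> carrier M \<Longrightarrow> y \<in> carrier M \<Longrightarrow> x \<boxminus> y = x \<boxplus> (\<ominus> \<one>) \<bullet> y"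
  by (simp add: M.minus_eq smult_l_minus)

lemma act_vsub: "x \<in> carrier M \<Longrightarrow> y \<in> carrier M \<Longrightarrow> act f (x \<boxminus> y) = act f x \<boxminus> act f y"
  by (simp add: vsub_eq_scale act_vadd act_scale)

lemma scale_vsub: "r \<in> carrier R \<Longrightarrow> x \<in> carrier M \<Longrightarrow> y \<in> carrier M \<Longrightarrow> r \<bullet> (x \<boxminus> y) = r \<bullet> x \<boxminus> r \<bullet> y"
  by (simp add: M.minus_eq smult_r_distr smult_r_minus)

lemma vsub_eq_0_iff: "x \<in> carrier M \<Longrightarrow> y \<in> carrier M \<Longrightarrow> x \<boxminus> y = \<zero>\<^sub>M \<longleftrightarrow> x = y"
  by (metis M.minus_eq M.r_neg M.add.inv_solve_right M.l_zero M.zero_closed)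

lemma act_sub_one_eq_0_iff: "x \<in> carrier M \<Longrightarrow> act (f - 1) x = \<zero>\<^sub>M \<longleftrightarrow> act f x = x"
  by (simp add: act_minus vsub_eq_0_iff)

end

context local_operator
begin

lemma vadd_vsub_cancel: "x \<in> carrier M \<Longrightarrow> a \<in> carrier M \<Longrightarrow> a \<boxplus> (x \<boxminus> a) = x"
  by (simp add: M.minus_eq M.a_lcomm[of a x] M.r_neg)

lemma vsub_vsub_cancel: "x \<in> carrier M \<Longrightarrow> a \<in> carrier M \<Longrightarrow> a \<boxminus> (a \<boxminus> x) = x"
  by (simp add: M.minus_eq M.minus_add M.a_assoc[symmetric] M.r_neg)

definition stable :: "'m set \<Rightarrow> bool" where
  "stable U \<longleftrightarrow> U \<subseteq> carrier M \<and> \<zero>\<^sub>M \<in> U \<and> (\<forall>x\<in>U. \<forall>y\<in>U. x \<boxplus> y \<in> U) \<and>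
    (\<forall>r\<in>carrier R. \<forall>x\<in>U. r \<bullet> x \<in> U) \<and> (\<forall>x\<in>U. T x \<in> U)"

lemma stable_carrier: "stable U \<Longrightarrow> x \<in> U \<Longrightarrow> x \<in> carrier M"
  and stable_vzero: "stable U \<Longrightarrow> \<zero>\<^sub>M \<in> U"
  and stable_vadd: "stable U \<Longrightarrow> x \<in> U \<Longrightarrow> y \<in> U \<Longrightarrow> x \<boxplus> y \<in> U"
  and stable_scale: "stable U \<Longrightarrow> r \<in> carrier R \<Longrightarrow> x \<in> U \<Longrightarrow> r \<bullet> x \<in> U"
  and stable_T: "stable U \<Longrightarrow> x \<in> U \<Longrightarrow> T x \<in> U"
  by (auto simp: stable_def)

lemma stable_vsub: "stable U \<Longrightarrow> x \<in> U \<Longrightarrow> y \<in> U \<Longrightarrow> x \<boxminus> y \<in> U"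
  by (simp add: vsub_eq_scale stable_carrier stable_vadd stable_scale)

lemma stable_act: "stable U \<Longrightarrow> x \<in> U \<Longrightarrow> act f x \<in> U"
  by (induction f rule: pCons_induct)
    (auto simp: act_pCons stable_carrier stable_vzero intro!: stable_vadd stable_scale stable_T)

lemmas stableI = stable_vzero stable_vadd stable_scale stable_T stable_vsub stable_act

definition p_multiples :: "'m set \<Rightarrow> 'm set" where
  "p_multiples U = {\<pi> \<bullet> u | u. u \<in> U}"

lemma p_multiplesI: "u \<in> U \<Longrightarrow> \<pi> \<bullet> u \<in> p_multiples U"
  by (auto simp: p_multiples_def)

lemma p_multiplesE:
  assumes "x \<in> p_multiples U" obtains u where "u \<in> U" "x = \<pi> \<bullet> u"
  using assms by (auto simp: p_multiples_def)

definition linear_map :: "'m set \<Rightarrow> ('m \<Rightarrow> 'm) \<Rightarrow> bool" where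
  "linear_map U f \<longleftrightarrow> (\<forall>x\<in>U. f x \<in> carrier M) \<and> (\<forall>x\<in>U. \<forall>y\<in>U. f (x \<boxplus> y) = f x \<boxplus> f y) \<and>
    (\<forall>r\<in>carrier R. \<forall>x\<in>U. f (r \<bullet> x) = r \<bullet> f x)"

lemma linear_map_closed: "linear_map U f \<Longrightarrow> x \<in> U \<Longrightarrow> f x \<in> carrier M"
  and linear_map_vadd: "linear_map U f \<Longrightarrow> x \<in> U \<Longrightarrow> y \<in> U \<Longrightarrow> f (x \<boxplus> y) = f x \<boxplus> f y"
  and linear_map_scale: "linear_map U f \<Longrightarrow> r \<in> carrier R \<Longrightarrow> x \<in> U \<Longrightarrow> f (r \<bullet> x) = r \<bullet> f x"
  by (auto simp: linear_map_def)

definition linear_form :: "'m set \<Rightarrow> ('m \<Rightarrow> 'r) \<Rightarrow> bool" where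
  "linear_form U f \<longleftrightarrow> (\<forall>x\<in>U. f x \<in> carrier R) \<and> (\<forall>x\<in>U. \<forall>y\<in>U. f (x \<boxplus> y) = f x \<oplus> f y) \<and>
    (\<forall>r\<in>carrier R. \<forall>x\<in>U. f (r \<bullet> x) = r \<otimes> f x)"

lemma linear_form_closed: "linear_form U f \<Longrightarrow> x \<in> U \<Longrightarrow> f x \<in> carrier R"
  and linear_form_vadd: "linear_form U f \<Longrightarrow> x \<in> U \<Longrightarrow> y \<in> U \<Longrightarrow> f (x \<boxplus> y) = f x \<oplus> f y"
  and linear_form_scale: "linear_form U f \<Longrightarrow> r \<in> carrier R \<Longrightarrow> x \<in> U \<Longrightarrow> f (r \<bullet> x) = r \<otimes> f x"
  by (auto simp: linear_form_def)

lemma linear_form_vsub: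
  "linear_form U f \<Longrightarrow> stable U \<Longrightarrow> x \<in> U \<Longrightarrow> y \<in> U \<Longrightarrow> f (x \<boxminus> y) = f x \<ominus> f y"
  by (simp add: vsub_eq_scale stableI stable_carrier linear_form_closed linear_form_vadd
      linear_form_scale R.minus_eq l_minus)

lemma linear_form_vzero: "linear_form U f \<Longrightarrow> stable U \<Longrightarrow> f \<zero>\<^sub>M = \<zero>"
  using linear_form_scale[of U f \<zero> "\<zero>\<^sub>M"] by (simp add: stable_vzero linear_form_closed)

definition fixed :: "nat \<Rightarrow> 'm set \<Rightarrow> 'm set" where
  "fixed q U = {x \<in> U. act (\<xi> ^ q) x = x}"

lemma fixedD: "x \<in> fixed q U \<Longrightarrow> x \<in> U" "x \<in> fixed q U \<Longrightarrow> act (\<xi> ^ q) x = x"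
  by (auto simp: fixed_def)

lemma stable_fixed: "stable U \<Longrightarrow> stable (fixed q U)"
  unfolding stable_def[of "fixed q U"]
  by (auto simp: fixed_def stableI stable_carrier act_vadd act_scale act_indet[symmetric] act_commute[of _ "\<xi>^q" \<xi>])

lemma act_eq_on_fixed: "stable U \<Longrightarrow> x \<in> fixed q U \<Longrightarrow> act (\<xi> ^ q - 1) x = \<zero>\<^sub>M"
  by (simp add: fixed_def act_sub_one_eq_0_iff stable_carrier)

lemma fixed_iff: "stable U \<Longrightarrow> x \<in> U \<Longrightarrow> x \<in> fixed q U \<longleftrightarrow> act (\<xi> ^ q - 1) x = \<zero>\<^sub>M"
  by (simp add: fixed_def act_sub_one_eq_0_iff stable_carrier)

text \<open>The situation of one step: \<open>U\<close> is a module for a cyclic group of order \<open>p q\<close>, and \<open>\<rho>\<close> projects it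
onto the invariants of the subgroup of order \<open>p\<close>. The last condition is what remains of the
hypothesis that the restriction to this subgroup is a permutation module: a vector that is
invariant modulo \<open>p\<close> can be lifted to an invariant one. In this form it passes to summands.\<close>

definition layer :: "nat \<Rightarrow> 'm set \<Rightarrow> ('m \<Rightarrow> 'm) \<Rightarrow> bool" where
  "layer q U \<rho> \<longleftrightarrow> stable U \<and> U = fixed (p * q) U \<and> linear_map U \<rho> \<and>
     (\<forall>x\<in>U. \<rho> x \<in> fixed q U) \<and> (\<forall>x\<in>fixed q U. \<rho> x = x) \<and>
     (\<forall>x\<in>U. act (\<xi> ^ q - 1) x \<in> p_multiples U \<longrightarrow> x \<boxminus> \<rho> x \<in> p_multiples U)"

end

section \<open>The norm to the invariants of the subgroup of order p\<close>

text \<open>The second condition says in a coinductive form that no nonzero vector is divisible by all powers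
of \<open>p\<close>. It is inherited by submodules and plays the part of Nakayama's lemma.\<close>

locale separated_operator = local_operator +
  assumes torsion_free: "x \<in> carrier M \<Longrightarrow> \<pi> \<bullet> x = \<zero>\<^sub>M \<Longrightarrow> x = \<zero>\<^sub>M"
    and separated: "A \<subseteq> carrier M \<Longrightarrow> (\<And>x. x \<in> A \<Longrightarrow> \<exists>y\<in>A. x = \<pi> \<bullet> y) \<Longrightarrow> x \<in> A \<Longrightarrow> x = \<zero>\<^sub>M"
begin

lemma p_cancel: "x \<in> carrier M \<Longrightarrow> y \<in> carrier M \<Longrightarrow> \<pi> \<bullet> x = \<pi> \<bullet> y \<Longrightarrow> x = y"
  using torsion_free[of "x \<boxminus> y"] by (simp add: scale_vsub vsub_eq_0_iff)

lemma fixed_p_cancel: "x \<in> carrier M \<Longrightarrow> \<pi> \<bullet> x \<in> fixed q U \<Longrightarrow> x \<in> U \<Longrightarrow> x \<in> fixed q U"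
  by (auto simp: fixed_def act_scale p_cancel)

abbreviation norm_poly :: "nat \<Rightarrow> int poly" ("\<Phi>") where "\<Phi> q \<equiv> (\<Sum>i<p. (\<xi> ^ q) ^ i)"
abbreviation geom_poly :: "nat \<Rightarrow> int poly" ("\<Gamma>") where "\<Gamma> n \<equiv> (\<Sum>i<n. \<xi> ^ i)"

lemma act_norm_fixed:
  assumes U: "stable U" and x: "x \<in> fixed q U"
  shows "act (\<Phi> q) x = \<pi> \<bullet> x"
proof -
  obtain \<kappa> where \<kappa>: "\<Phi> q = of_nat p + \<kappa> * (\<xi> ^ q - 1)"
    using geometric_cofactor[of "\<xi> ^ q" p] by (metis mult.commute)
  have [simp]: "x \<in> carrier M" using U x by (auto simp: fixed_def stable_carrier)
  show ?thesis unfolding \<kappa>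
    using act_of_nat_mult[of x p 1] U x by (simp add: act_add act_mult act_eq_on_fixed)
qed

lemma norm_in_fixed:
  assumes L: "layer q U \<rho>" and x: "x \<in> U"
  shows "act (\<Phi> q) x \<in> fixed q U"
proof -
  have U: "stable U" and n: "x \<in> fixed (p * q) U" using L x by (auto simp: layer_def)
  have xc [simp]: "x \<in> carrier M" using U x by (rule stable_carrier)
  have "(\<xi> ^ q - 1) * \<Phi> q = (\<xi> ^ q) ^ p - 1"
    by (simp only: power_diff_1_eq[of "\<xi> ^ q" p])
  also have "\<dots> = \<xi> ^ (p * q) - 1" by (simp add: mult.commute flip: power_mult)
  finally have "(\<xi> ^ q - 1) * \<Phi> q = \<xi> ^ (p * q) - 1" .
  hence "act (\<xi> ^ q - 1) (act (\<Phi> q) x) = act (\<xi> ^ (p * q) - 1) x"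
    by (simp flip: act_mult)
  thus ?thesis using act_eq_on_fixed[OF U n] fixed_iff[OF U stable_act[OF U x]] by simp
qed

text \<open>If \<open>\<Phi> x = 0\<close>, then \<open>p x = (S - 1) v\<close> with \<open>v = - \<kappa> x\<close>, where \<open>\<Phi> = p + (S - 1) \<kappa>\<close> and \<open>S\<close> is the
\<open>q\<close>-th power of the operator. So \<open>v\<close> is invariant modulo \<open>p\<close>; replacing it by \<open>v - \<rho> v\<close>, which is
divisible by \<open>p\<close>, does not change \<open>(S - 1) v\<close>, and \<open>p\<close> can be cancelled.\<close>

lemma kernel_of_norm:
  assumes L: "layer q U \<rho>" and x: "x \<in> U" and "act (\<Phi> q) x = \<zero>\<^sub>M"
  obtains y where "y \<in> U" "x = act (\<xi> ^ q - 1) y"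
proof -
  have U: "stable U" and \<rho>: "linear_map U \<rho>" "\<And>x. x \<in> U \<Longrightarrow> \<rho> x \<in> fixed q U"
    and H: "\<And>x. x \<in> U \<Longrightarrow> act (\<xi> ^ q - 1) x \<in> p_multiples U \<Longrightarrow> x \<boxminus> \<rho> x \<in> p_multiples U"
    using L by (auto simp: layer_def)
  note [simp] = stable_carrier[OF U]
  obtain \<kappa> where \<kappa>: "\<Phi> q = of_nat p + (\<xi> ^ q - 1) * \<kappa>"
    using geometric_cofactor by blast
  define v where "v = act (- \<kappa>) x"
  have v: "v \<in> U" using U x by (simp add: v_def stable_act)
  have "(\<xi> ^ q - 1) * (- \<kappa>) = of_nat p * 1 - \<Phi> q" using \<kappa> by simp
  hence "act (\<xi> ^ q - 1) v = act (of_nat p * 1 - \<Phi> q) x"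
    using x by (simp add: v_def flip: act_mult)
  also have "\<dots> = \<pi> \<bullet> x"
    using x assms(3) by (simp only: act_minus act_of_nat_mult stable_carrier[OF U])
      (simp add: M.minus_eq)
  finally have dv: "act (\<xi> ^ q - 1) v = \<pi> \<bullet> x" .
  hence "v \<boxminus> \<rho> v \<in> p_multiples U" using H[OF v] x by (simp add: p_multiplesI)
  then obtain w where w: "w \<in> U" "v \<boxminus> \<rho> v = \<pi> \<bullet> w" by (rule p_multiplesE)
  have "act (\<xi> ^ q - 1) (v \<boxminus> \<rho> v) = \<pi> \<bullet> x"
    using v dv act_eq_on_fixed[OF U \<rho>(2)[OF v]] x fixedD(1)[OF \<rho>(2)[OF v]]
    by (simp add: act_vsub) (simp add: M.minus_eq)
  hence "\<pi> \<bullet> x = \<pi> \<bullet> act (\<xi> ^ q - 1) w" using w by (simp add: act_scale)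
  hence "x = act (\<xi> ^ q - 1) w" using x w by (auto intro: p_cancel[of x "act (\<xi> ^ q - 1) w"])
  thus thesis using that w by blast
qed

text \<open>If \<open>(T - 1) \<Phi> x = p z\<close>, then \<open>z\<close> is fixed by \<open>S\<close>, so \<open>p z = \<Phi> z\<close> and \<open>(T - 1) x - z\<close> lies in the kernel
of \<open>\<Phi>\<close>. Hence \<open>z = (T - 1) w\<close> with \<open>w = x - (1 + \<dots> + T\<^sup>q\<^sup>-\<^sup>1) v\<close>; it remains to see that \<open>w\<close> itself
is invariant under \<open>S\<close>, since then \<open>\<Phi> x\<close> is the full norm of \<open>v\<close> plus \<open>\<Phi> w = p w\<close>.\<close>

lemma fixed_mod_p_is_norm:
  assumes L: "layer q U \<rho>" and x: "x \<in> U"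
    and mod: "act (\<xi> - 1) (act (\<Phi> q) x) \<in> p_multiples U"
  obtains v w where "v \<in> U" "w \<in> fixed q U" "act (\<Phi> q) x = act (\<Gamma> (p * q)) v \<boxplus> \<pi> \<bullet> w"
proof -
  have U: "stable U" using L by (simp add: layer_def)
  note [simp] = stable_carrier[OF U]
  note [intro] = stableI[OF U]
  obtain z where z: "z \<in> U" "act (\<xi> - 1) (act (\<Phi> q) x) = \<pi> \<bullet> z"
    using mod by (rule p_multiplesE)
  have "act (\<xi> - 1) (act (\<Phi> q) x) \<in> fixed q U"
    by (intro stable_act stable_fixed U norm_in_fixed[OF L] x)
  hence zf: "z \<in> fixed q U" using z by (simp add: fixed_p_cancel)
  have "act (\<Phi> q) (act (\<xi> - 1) x \<boxminus> z) = \<zero>\<^sub>M"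
    using x z act_norm_fixed[OF U zf] act_commute[of x "\<Phi> q" "\<xi> - 1"]
    by (simp add: act_vsub vsub_eq_0_iff)
  then obtain v where v: "v \<in> U" "act (\<xi> - 1) x \<boxminus> z = act (\<xi> ^ q - 1) v"
    using kernel_of_norm[OF L, of "act (\<xi> - 1) x \<boxminus> z"] x z by blast
  have "act (\<xi> ^ q - 1) v = act (\<xi> - 1) (act (\<Gamma> q) v)"
    using v by (simp add: power_diff_1_eq flip: act_mult)
  define w where "w = x \<boxminus> act (\<Gamma> q) v"
  have w: "w \<in> U" using x v by (auto simp: w_def)
  have "act (\<xi> - 1) w = act (\<xi> - 1) x \<boxminus> (act (\<xi> - 1) x \<boxminus> z)"
    using x v \<open>act (\<xi> ^ q - 1) v = _\<close> by (simp add: w_def act_vsub)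
  also have "\<dots> = z"
    using x z by (simp add: vsub_vsub_cancel)
  finally have dw: "act (\<xi> - 1) w = z" .
  \<comment> \<open>\<open>s\<close> is fixed by the operator and killed by the norm, which is multiplication by \<open>p\<close> on it.\<close>
  define s where "s = act (\<xi> ^ q - 1) w"
  have s: "s \<in> U" using w by (auto simp: s_def)
  have "act (\<xi> - 1) s = act (\<xi> ^ q - 1) z"
    using w by (simp add: s_def act_commute flip: dw)
  also have "\<dots> = \<zero>\<^sub>M" using act_eq_on_fixed[OF U zf] .
  finally have s1: "act (\<xi> - 1) s = \<zero>\<^sub>M" .
  have "act (\<xi> ^ q - 1) s = act (\<Gamma> q) (act (\<xi> - 1) s)"
    using s by (simp add: power_diff_1_eq mult.commute flip: act_mult)
  hence "s \<in> fixed q U" using s1 s by (simp add: fixed_iff U)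
  hence "\<pi> \<bullet> s = act (\<Phi> q) s" using act_norm_fixed[OF U] by simp
  also have "\<dots> = act (\<xi> ^ q - 1) (act (\<Phi> q) w)" using w by (simp add: s_def act_commute)
  also have "\<dots> = \<zero>\<^sub>M" by (rule act_eq_on_fixed[OF U norm_in_fixed[OF L w]])
  finally have "s = \<zero>\<^sub>M" using s torsion_free by simp
  hence wf: "w \<in> fixed q U" using w by (simp add: fixed_iff U s_def)
  have "x = act (\<Gamma> q) v \<boxplus> w"
    using x v by (simp add: w_def vadd_vsub_cancel)
  hence "act (\<Phi> q) x = act (\<Phi> q) (act (\<Gamma> q) v) \<boxplus> act (\<Phi> q) w"
    using v w by (metis act_vadd act_closed stable_carrier[OF U])
  also have "act (\<Phi> q) w = \<pi> \<bullet> w" by (rule act_norm_fixed[OF U wf])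
  also have "act (\<Phi> q) (act (\<Gamma> q) v) = act (\<Gamma> (p * q)) v"
    using v by (simp add: geometric_sum_split mult.commute[of "\<Phi> q"] flip: act_mult)
  finally show thesis using that v wf by blast
qed

end

context local_operator
begin

section \<open>Forms with a dual vector\<close>

definition p_ideal :: "'r set" where "p_ideal = {\<pi> \<otimes> s | s. s \<in> carrier R}"

lemma p_ideal_closed: "a \<in> p_ideal \<Longrightarrow> a \<in> carrier R"
  by (auto simp: p_ideal_def)

lemma p_ideal_add: "a \<in> p_ideal \<Longrightarrow> b \<in> p_ideal \<Longrightarrow> a \<oplus> b \<in> p_ideal"
  by (auto simp: p_ideal_def simp flip: r_distr)

lemma p_ideal_mult: "a \<in> carrier R \<Longrightarrow> b \<in> p_ideal \<Longrightarrow> a \<otimes> b \<in> p_ideal"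
  by (auto simp: p_ideal_def m_lcomm[of a])

lemma p_ideal_minus: "a \<in> p_ideal \<Longrightarrow> b \<in> p_ideal \<Longrightarrow> a \<ominus> b \<in> p_ideal"
  using p_ideal_add[of a "\<ominus> \<one> \<otimes> b"] p_ideal_mult[of "\<ominus> \<one>" b]
  by (simp add: R.minus_eq l_minus p_ideal_closed)

lemma unit_or_p_ideal: "r \<in> carrier R \<Longrightarrow> r \<in> Units R \<or> r \<in> p_ideal"
  using unit_or_p_dvd by (auto simp: p_ideal_def \<iota>_def)

lemma not_unit_and_p_ideal: "r \<in> Units R \<Longrightarrow> r \<notin> p_ideal"
proof
  assume r: "r \<in> Units R" and "r \<in> p_ideal"
  then obtain s where "s \<in> carrier R" "r = \<pi> \<otimes> s" by (auto simp: p_ideal_def)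
  hence "\<pi> \<in> Units R" using r unit_factor[of \<pi> s] by simp
  thus False using p_not_unit by (simp add: \<iota>_def)
qed

lemma unit_add_p_ideal:
  assumes "a \<in> Units R" "b \<in> p_ideal"
  shows "a \<oplus> b \<in> Units R"
proof (rule ccontr)
  have c: "a \<in> carrier R" "b \<in> carrier R" using assms p_ideal_closed by auto
  assume "a \<oplus> b \<notin> Units R"
  hence "a \<oplus> b \<in> p_ideal" using unit_or_p_ideal[of "a \<oplus> b"] c by auto
  hence "(a \<oplus> b) \<ominus> b \<in> p_ideal" using assms(2) by (rule p_ideal_minus)
  hence "a \<in> p_ideal" using c by (simp add: R.minus_eq R.a_assoc R.r_neg)
  thus False using not_unit_and_p_ideal assms(1) by blast
qed

lemma unit_minus_p_ideal: "a \<in> Units R \<Longrightarrow> b \<in> p_ideal \<Longrightarrow> a \<ominus> b \<in> Units R"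
  using unit_add_p_ideal[of a "\<ominus> \<one> \<otimes> b"] p_ideal_mult[of "\<ominus> \<one>" b]
  by (simp add: R.minus_eq l_minus p_ideal_closed)

lemma linear_form_p_multiple:
  "linear_form U f \<Longrightarrow> x \<in> p_multiples U \<Longrightarrow> f x \<in> p_ideal"
  by (auto simp: p_multiples_def p_ideal_def linear_form_scale linear_form_closed)

text \<open>A matrix over a local ring that is triangular modulo the maximal ideal, with units on the diagonal,
is invertible. The induction keeps the remaining forms inside the maximal ideal, so that each
elimination step leaves the later diagonal entries units.\<close>

lemma triangular_forms_surjective:
  fixes n :: nat
  assumes V: "stable V" and lin: "\<And>k. k < n \<Longrightarrow> linear_form V (\<mu> k)"
    and v: "\<And>k. k < n \<Longrightarrow> v k \<in> V"
    and diag: "\<And>k. k < n \<Longrightarrow> \<mu> k (v k) \<in> Units R"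
    and below: "\<And>j k. j < k \<Longrightarrow> k < n \<Longrightarrow> \<mu> k (v j) \<in> p_ideal"
    and d: "\<And>k. k < n \<Longrightarrow> d k \<in> carrier R"
  obtains x where "x \<in> V" "\<And>k. k < n \<Longrightarrow> \<mu> k x = d k"
proof -
  note [simp] = linear_form_closed[OF lin]
  have "\<exists>x\<in>V. (\<forall>k<m. \<mu> k x = d k) \<and> (\<forall>k. m \<le> k \<longrightarrow> k < n \<longrightarrow> \<mu> k x \<in> p_ideal)"
    if "m \<le> n" "\<forall>k<n. d k \<in> carrier R" for m d
    using that
  proof (induction m arbitrary: d)
    case 0
    have "\<zero> \<in> p_ideal" by (force simp: p_ideal_def)
    thus ?case
      by (intro bexI[of _ "\<zero>\<^sub>M"]) (auto simp: linear_form_vzero[OF lin V] stable_vzero[OF V])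
  next
    case (Suc m)
    obtain x where x: "x \<in> V" "\<And>k. k < m \<Longrightarrow> \<mu> k x = d k"
        "\<And>k. m \<le> k \<Longrightarrow> k < n \<Longrightarrow> \<mu> k x \<in> p_ideal"
      using Suc.IH[of d] Suc.prems by auto
    obtain y where y: "y \<in> V" "\<And>k. k < m \<Longrightarrow> \<mu> k y = \<mu> k (v m)"
        "\<And>k. m \<le> k \<Longrightarrow> k < n \<Longrightarrow> \<mu> k y \<in> p_ideal"
      using Suc.IH[of "\<lambda>k. \<mu> k (v m)"] Suc.prems v by auto
    have m: "m < n" using Suc.prems by simp
    define w where "w = v m \<boxminus> y"
    have w: "w \<in> V" using v m y V by (simp add: w_def stableI)
    have lw: "\<mu> k w = \<mu> k (v m) \<ominus> \<mu> k y" if "k < n" for k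
      using that m v y by (simp add: w_def linear_form_vsub[OF lin V])
    have w0: "\<mu> k w = \<zero>" if "k < m" for k
      using that m v y by (simp add: lw R.minus_eq R.r_neg)
    have wm: "\<mu> m w \<in> Units R"
      using m diag y(3) by (simp add: lw unit_minus_p_ideal)
    have wk: "\<mu> k w \<in> p_ideal" if "m < k" "k < n" for k
      using that below y(3) by (simp add: lw p_ideal_minus)
    define t where "t = (d m \<ominus> \<mu> m x) \<otimes> inv (\<mu> m w)"
    have t: "t \<in> carrier R" using Suc.prems m x wm by (simp add: t_def)
    have tw: "t \<otimes> \<mu> m w = d m \<ominus> \<mu> m x"
      using Suc.prems m x w wm by (simp add: t_def R.m_assoc)
    have l: "\<mu> k (x \<boxplus> t \<bullet> w) = \<mu> k x \<oplus> t \<otimes> \<mu> k w" if "k < n" for k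
      using that x w t V by (simp add: linear_form_vadd[OF lin] linear_form_scale[OF lin] stableI)
    show ?case
    proof (intro bexI[of _ "x \<boxplus> t \<bullet> w"] conjI allI impI)
      show "x \<boxplus> t \<bullet> w \<in> V" using V x w t by (simp add: stableI)
    next
      fix k assume k: "k < Suc m"
      show "\<mu> k (x \<boxplus> t \<bullet> w) = d k"
      proof (cases "k = m")
        case True
        have "\<mu> m x \<oplus> (d m \<ominus> \<mu> m x) = d m"
          using Suc.prems m x
          by (simp add: R.minus_eq R.a_lcomm[of "\<mu> m x" "d m"] R.r_neg)
        thus ?thesis using True m l tw by simp
      next
        case False
        thus ?thesis using k m l w0 x t Suc.prems by simp
      qed
    next
      fix k assume k: "Suc m \<le> k" "k < n"
      thus "\<mu> k (x \<boxplus> t \<bullet> w) \<in> p_ideal"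
        using x wk t by (simp add: l p_ideal_add p_ideal_mult)
    qed
  qed
  from this[of n d] show thesis using that d by auto
qed

text \<open>The forms \<open>\<mu> \<circ> (T - 1)\<^sup>k\<close> are triangular modulo \<open>p\<close> on the vectors \<open>(T - 1)\<^sup>n\<^sup>-\<^sup>1\<^sup>-\<^sup>k x\<close>: the diagonal
entries are the value of \<open>\<mu>\<close> at \<open>(T - 1)\<^sup>n\<^sup>-\<^sup>1 x\<close>, which is the norm of \<open>x\<close> modulo \<open>p\<close>, and below the
diagonal the exponent reaches \<open>n\<close>. So these forms take arbitrary values on a suitable \<open>y\<close>, and the
values wanted for \<open>\<mu> \<circ> T\<^sup>l\<close> translate into \<open>(-1)\<^sup>k\<close> for \<open>\<mu> \<circ> (T - 1)\<^sup>k\<close> by binomial inversion.\<close>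

lemma dual_vector:
  assumes V: "stable V" and fixed: "V = fixed n V" and n: "n = p ^ k"
    and lin: "linear_form V \<mu>" and x: "x \<in> V" and unit: "\<mu> (act (\<Sum>i<n. \<xi> ^ i) x) \<in> Units R"
  obtains y where "y \<in> V" "\<mu> y = \<one>" "\<And>l. 0 < l \<Longrightarrow> l < n \<Longrightarrow> \<mu> (act (\<xi> ^ l) y) = \<zero>"
proof -
  have n0: "n > 0" using prime_p by (simp add: n prime_gt_0_nat)
  note [simp] = stable_carrier[OF V] stable_act[OF V]
  define form where "form k z = \<mu> (act ((\<xi> - 1) ^ k) z)" for k z
  define v where "v k = act ((\<xi> - 1) ^ (n - 1 - k)) x" for k
  obtain g where g: "(\<xi> - 1) ^ (n - 1) = (\<Sum>i<n. \<xi> ^ i) + of_nat p * g"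
    using socle_identity[OF prime_p, of k] unfolding n by blast
  obtain h where h: "(\<xi> - 1) ^ n = \<xi> ^ n - 1 + of_nat p * h"
    using frobenius_minus_one_iterated[OF prime_p, of \<xi> k] unfolding n by blast
  have pmul: "\<mu> (act (of_nat p * f) z) \<in> p_ideal" if "z \<in> V" for f z
    using that by (intro linear_form_p_multiple[OF lin]) (auto simp: act_of_nat_mult intro!: p_multiplesI)
  have form_v: "form k (v j) = \<mu> (act ((\<xi> - 1) ^ (k + (n - 1 - j))) x)" for j k
    using x by (simp add: form_def v_def power_add act_mult)
  have "linear_form V (form k)" for k
    using lin by (auto simp: form_def linear_form_def act_vadd act_scale)
  moreover have "v k \<in> V" for k using x by (simp add: v_def)
  moreover have "form k (v k) \<in> Units R" if "k < n" for k
  proof -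
    have "k + (n - 1 - k) = n - 1" using that by simp
    hence "form k (v k) = \<mu> (act (\<Sum>i<n. \<xi> ^ i) x \<boxplus> act (of_nat p * g) x)"
      using x by (simp only: form_v g act_add stable_carrier[OF V])
    also have "\<dots> = \<mu> (act (\<Sum>i<n. \<xi> ^ i) x) \<oplus> \<mu> (act (of_nat p * g) x)"
      using x lin by (simp add: linear_form_vadd)
    finally show ?thesis using unit pmul[OF x] by (simp add: unit_add_p_ideal)
  qed
  moreover have "form k (v j) \<in> p_ideal" if "j < k" "k < n" for j k
  proof -
    define i where "i = k - j - 1"
    have "k + (n - 1 - j) = n + i" using that by (simp add: i_def)
    hence "(\<xi> - 1) ^ (k + (n - 1 - j)) = (\<xi> - 1) ^ i * (\<xi> ^ n - 1) + of_nat p * (h * (\<xi> - 1) ^ i)"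
      by (simp add: power_add h algebra_simps)
    moreover have "act (\<xi> ^ n - 1) x = \<zero>\<^sub>M" using act_eq_on_fixed[OF V] fixed x by simp
    ultimately have "form k (v j) = \<mu> (act (of_nat p * (h * (\<xi> - 1) ^ i)) x)"
      using x by (simp add: form_v act_add act_mult)
    thus ?thesis using pmul[OF x] by simp
  qed
  ultimately obtain y where y: "y \<in> V" "\<And>k. k < n \<Longrightarrow> form k y = \<iota> ((- 1) ^ k)"
    by (rule triangular_forms_surjective[OF V, of n form v "\<lambda>k. \<iota> ((- 1) ^ k)"]) auto
  have shift: "\<mu> (act (\<xi> ^ Suc l * (\<xi> - 1) ^ k) y) = \<zero>" if "Suc l + k < n" for l k
    using that
  proof (induction l arbitrary: k)
    case 0
    have "\<xi> ^ Suc 0 * (\<xi> - 1) ^ k = (\<xi> - 1) ^ Suc k + (\<xi> - 1) ^ k"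
      by (simp add: algebra_simps)
    hence "\<mu> (act (\<xi> ^ Suc 0 * (\<xi> - 1) ^ k) y) = form (Suc k) y \<oplus> form k y"
      using y lin by (simp only: form_def act_add stable_carrier[OF V]) (simp add: linear_form_vadd)
    also have "form (Suc k) y = \<iota> ((- 1) ^ Suc k)" by (rule y(2)) (use 0 in simp)
    also have "form k y = \<iota> ((- 1) ^ k)" by (rule y(2)) (use 0 in simp)
    finally show ?case by (simp flip: iota_add)
  next
    case (Suc l)
    have "\<xi> ^ Suc (Suc l) * (\<xi> - 1) ^ k = \<xi> ^ Suc l * (\<xi> - 1) ^ Suc k + \<xi> ^ Suc l * (\<xi> - 1) ^ k"
      by (simp add: algebra_simps)
    hence "\<mu> (act (\<xi> ^ Suc (Suc l) * (\<xi> - 1) ^ k) y) =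
        \<mu> (act (\<xi> ^ Suc l * (\<xi> - 1) ^ Suc k) y) \<oplus> \<mu> (act (\<xi> ^ Suc l * (\<xi> - 1) ^ k) y)"
      using y lin by (simp only: act_add stable_carrier[OF V]) (simp add: linear_form_vadd)
    also have "\<dots> = \<zero>" using Suc.IH[of k] Suc.IH[of "Suc k"] Suc.prems by simp
    finally show ?case .
  qed
  have "\<mu> (act (\<xi> ^ l) y) = \<zero>" if "0 < l" "l < n" for l
    using shift[of "l - 1" 0] that by simp
  moreover have "\<mu> y = \<one>" using y(2)[of 0] y(1) n0 by (simp add: form_def)
  ultimately show thesis using that y(1) by blast
qed

end

context separated_operator
begin

lemma vadd_vsub_vadd:
  "\<lbrakk>z \<in> carrier M; a \<in> carrier M; b \<in> carrier M\<rbrakk> \<Longrightarrow> (z \<boxplus> a) \<boxminus> (z \<boxplus> b) = a \<boxminus> b"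
  by (simp add: M.minus_eq M.minus_add M.a_ac M.a_lcomm[of z] M.r_neg)

text \<open>Apply \<open>T - 1\<close> to \<open>\<Phi> x\<close> as long as the result stays outside \<open>p U\<close>; this stops because \<open>T - 1\<close> is
nilpotent modulo \<open>p\<close> on the invariants, and the last vector outside \<open>p U\<close> is fixed modulo \<open>p\<close>.\<close>

lemma norm_not_p_multiple:
  assumes L: "layer (p ^ j) U \<rho>" and x: "x \<in> U" and nz: "act (\<Phi> (p ^ j)) x \<notin> p_multiples U"
  obtains v where "v \<in> U" "act (\<Gamma> (p * p ^ j)) v \<notin> p_multiples U"
proof -
  let ?q = "p ^ j"
  have U: "stable U" using L by (simp add: layer_def)
  note [simp] = stable_carrier[OF U] stable_act[OF U]
  define y where "y = act (\<Phi> ?q) x"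
  have y: "y \<in> U" using x by (simp add: y_def)
  obtain g where g: "(\<xi> - 1) ^ ?q = \<xi> ^ ?q - 1 + of_nat p * g"
    using frobenius_minus_one_iterated[OF prime_p] by blast
  have "act (\<xi> ^ ?q - 1) y = \<zero>\<^sub>M"
    using norm_in_fixed[OF L x] by (simp add: act_eq_on_fixed[OF U] y_def)
  hence "act ((\<xi> - 1) ^ ?q) y = \<pi> \<bullet> act g y"
    using y by (simp only: g act_add stable_carrier[OF U] act_of_nat_mult) simp
  hence ex: "act ((\<xi> - 1) ^ ?q) y \<in> p_multiples U" using y by (simp add: p_multiplesI)
  define i where "i = (LEAST i. act ((\<xi> - 1) ^ i) y \<in> p_multiples U)"
  have i: "act ((\<xi> - 1) ^ i) y \<in> p_multiples U" unfolding i_def by (rule LeastI) (rule ex)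
  obtain i' where i': "i = Suc i'" using i nz y by (cases i) (auto simp: y_def)
  have not: "act ((\<xi> - 1) ^ i') y \<notin> p_multiples U"
    using not_less_Least[of i' "\<lambda>i. act ((\<xi> - 1) ^ i) y \<in> p_multiples U"] i' by (simp add: i_def)
  define z where "z = act ((\<xi> - 1) ^ i') x"
  have z: "z \<in> U" using x by (simp add: z_def)
  have zy: "act (\<Phi> ?q) z = act ((\<xi> - 1) ^ i') y" using x by (simp add: z_def y_def act_commute)
  have "act (\<xi> - 1) (act (\<Phi> ?q) z) \<in> p_multiples U"
    using i i' y by (simp add: zy act_mult)
  then obtain v w where vw: "v \<in> U" "w \<in> fixed ?q U"
      "act (\<Phi> ?q) z = act (\<Gamma> (p * ?q)) v \<boxplus> \<pi> \<bullet> w"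
    using fixed_mod_p_is_norm[OF L z] by blast
  have "act (\<Gamma> (p * ?q)) v \<notin> p_multiples U"
  proof
    assume "act (\<Gamma> (p * ?q)) v \<in> p_multiples U"
    then obtain u where u: "u \<in> U" "act (\<Gamma> (p * ?q)) v = \<pi> \<bullet> u" by (rule p_multiplesE)
    hence "act (\<Phi> ?q) z = \<pi> \<bullet> (u \<boxplus> w)" using vw fixedD(1)[OF vw(2)] by (simp add: smult_r_distr)
    hence "act (\<Phi> ?q) z \<in> p_multiples U"
      using u fixedD(1)[OF vw(2)] by (auto intro!: p_multiplesI stable_vadd[OF U])
    thus False using not zy by simp
  qed
  thus thesis using that vw by blast
qed

text \<open>The hypothesis puts \<open>x - z\<close> in the kernel of the norm for some invariant \<open>z\<close>, so \<open>U\<close> is the sum of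
the invariants and \<open>(S - 1) U\<close>, hence of the invariants and \<open>(S - 1)\<^sup>p U \<subseteq> p U\<close>. Consequently
every \<open>x - \<rho> x\<close> is \<open>p\<close> times a vector of the same shape, and separatedness applies.\<close>

lemma norms_p_multiples_imp_fixed:
  assumes L: "layer q U \<rho>" and all: "\<And>x. x \<in> U \<Longrightarrow> act (\<Phi> q) x \<in> p_multiples U"
  shows "U = fixed q U"
proof -
  have U: "stable U" and n: "U = fixed (p * q) U" and \<rho>: "linear_map U \<rho>"
      "\<And>x. x \<in> U \<Longrightarrow> \<rho> x \<in> fixed q U" "\<And>x. x \<in> fixed q U \<Longrightarrow> \<rho> x = x"
    using L by (auto simp: layer_def)
  note [simp] = stable_carrier[OF U] stable_act[OF U]
  have step: "\<exists>z\<in>fixed q U. \<exists>y\<in>U. x = z \<boxplus> act (\<xi> ^ q - 1) y" if x: "x \<in> U" for x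
  proof -
    obtain z where z: "z \<in> U" "act (\<Phi> q) x = \<pi> \<bullet> z" using all[OF x] by (rule p_multiplesE)
    have zf: "z \<in> fixed q U" using norm_in_fixed[OF L x] z by (simp add: fixed_p_cancel)
    have "act (\<Phi> q) (x \<boxminus> z) = \<zero>\<^sub>M"
      using x z act_norm_fixed[OF U zf] by (simp add: act_vsub vsub_eq_0_iff)
    then obtain y where y: "y \<in> U" "x \<boxminus> z = act (\<xi> ^ q - 1) y"
      using kernel_of_norm[OF L, of "x \<boxminus> z"] stable_vsub[OF U] x z by blast
    hence "x = z \<boxplus> act (\<xi> ^ q - 1) y" using x z vadd_vsub_cancel[of x z] by simp
    thus ?thesis using zf y by blast
  qed
  have steps: "\<exists>z\<in>fixed q U. \<exists>y\<in>U. x = z \<boxplus> act ((\<xi> ^ q - 1) ^ i) y" if "x \<in> U" for x i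
    using that
  proof (induction i arbitrary: x)
    case 0
    thus ?case
      by (intro bexI[of _ "\<zero>\<^sub>M"] bexI[of _ x]) (auto simp: stable_vzero[OF stable_fixed[OF U]])
  next
    case (Suc i)
    obtain z y where zy: "z \<in> fixed q U" "y \<in> U" "x = z \<boxplus> act ((\<xi> ^ q - 1) ^ i) y"
      using Suc.IH[OF Suc.prems] by blast
    obtain z' y' where zy': "z' \<in> fixed q U" "y' \<in> U" "y = z' \<boxplus> act (\<xi> ^ q - 1) y'"
      using step[OF zy(2)] by blast
    have zf: "act ((\<xi> ^ q - 1) ^ i) z' \<in> fixed q U"
      using stable_act[OF stable_fixed[OF U] zy'(1)] .
    have "x = (z \<boxplus> act ((\<xi> ^ q - 1) ^ i) z') \<boxplus> act ((\<xi> ^ q - 1) ^ Suc i) y'"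
      using zy zy' fixedD(1)[OF zy(1)] fixedD(1)[OF zy'(1)]
      by (simp add: act_vadd act_mult act_commute[of _ "\<xi>^q-1"] M.a_assoc)
    thus ?case using stable_vadd[OF stable_fixed[OF U] zy(1) zf] zy' by blast
  qed
  obtain g where g: "(\<xi> ^ q - 1) ^ p = (\<xi> ^ q) ^ p - 1 + of_nat p * g"
    using frobenius_minus_one[OF prime_p] by blast
  have "(\<xi> ^ q - 1) ^ p = \<xi> ^ (p * q) - 1 + of_nat p * g"
    unfolding g by (simp add: mult.commute flip: power_mult)
  hence act_p: "act ((\<xi> ^ q - 1) ^ p) y = \<pi> \<bullet> act g y" if "y \<in> U" for y
    using that act_eq_on_fixed[OF U, of y "p * q"] n
    by (simp only: act_add stable_carrier[OF U] act_of_nat_mult) simp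
  have mod: "\<exists>u\<in>U. x \<boxminus> \<rho> x = \<pi> \<bullet> (u \<boxminus> \<rho> u)" if x: "x \<in> U" for x
  proof -
    obtain z y where zy: "z \<in> fixed q U" "y \<in> U" "x = z \<boxplus> act ((\<xi> ^ q - 1) ^ p) y"
      using steps[OF x] by blast
    define u where "u = act g y"
    have u: "u \<in> U" using zy by (simp add: u_def)
    have xz: "x = z \<boxplus> \<pi> \<bullet> u" using zy act_p by (simp add: u_def)
    have zU: "z \<in> U" using zy fixedD by blast
    have [simp]: "\<rho> u \<in> carrier M" using \<rho>(1) u by (rule linear_map_closed)
    have "\<rho> x = z \<boxplus> \<pi> \<bullet> \<rho> u"
      using xz zU u \<rho>(3)[OF zy(1)] \<rho>(1) U by (simp add: linear_map_vadd linear_map_scale stableI)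
    hence "x \<boxminus> \<rho> x = \<pi> \<bullet> u \<boxminus> \<pi> \<bullet> \<rho> u"
      using xz zU u by (simp add: vadd_vsub_vadd)
    thus ?thesis using u by (intro bexI[of _ u]) (simp_all add: scale_vsub)
  qed
  have "x \<in> fixed q U" if x: "x \<in> U" for x
  proof -
    have "x \<boxminus> \<rho> x = \<zero>\<^sub>M"
    proof (rule separated[of "(\<lambda>x. x \<boxminus> \<rho> x) ` U"])
      show "(\<lambda>x. x \<boxminus> \<rho> x) ` U \<subseteq> carrier M" using \<rho>(1) by (auto simp: linear_map_closed)
    qed (use x mod in auto)
    hence "x = \<rho> x" using x \<rho>(1) by (simp add: vsub_eq_0_iff linear_map_closed)
    thus ?thesis using \<rho>(2)[OF x] by simp
  qed
  thus ?thesis by (auto simp: fixed_def)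
qed

end

context local_operator
begin

section \<open>Permuted coordinates\<close>

text \<open>The map \<open>x \<mapsto> (\<omega> \<mapsto> \<kappa> \<omega> x)\<close> is an isomorphism from \<open>U\<close>, with the operator \<open>f(T)\<close>, to the
functions on \<open>\<Omega>\<close> with the permutation operator of \<open>\<tau>\<close>. Coordinate functions, rather
than basis vectors, keep linear combinations out of the argument. The polynomial \<open>f\<close> is a parameter
because the restriction to a subgroup only sees a power of \<open>T\<close>.\<close>

definition coordinates ::
  "int poly \<Rightarrow> 'm set \<Rightarrow> 'i set \<Rightarrow> ('i \<Rightarrow> 'i) \<Rightarrow> ('i \<Rightarrow> 'm \<Rightarrow> 'r) \<Rightarrow> bool" where
  "coordinates f U \<Omega> \<tau> \<kappa> \<longleftrightarrow> finite \<Omega> \<and> bij_betw \<tau> \<Omega> \<Omega> \<and> (\<forall>\<omega>\<in>\<Omega>. linear_form U (\<kappa> \<omega>)) \<and>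
     (\<forall>\<omega>\<in>\<Omega>. \<forall>x\<in>U. \<kappa> (\<tau> \<omega>) (act f x) = \<kappa> \<omega> x) \<and>
     (\<forall>x\<in>U. (\<forall>\<omega>\<in>\<Omega>. \<kappa> \<omega> x = \<zero>) \<longrightarrow> x = \<zero>\<^sub>M) \<and>
     (\<forall>c\<in>\<Omega> \<rightarrow> carrier R. \<exists>x\<in>U. \<forall>\<omega>\<in>\<Omega>. \<kappa> \<omega> x = c \<omega>)"

lemma coordinates_finite: "coordinates f U \<Omega> \<tau> \<kappa> \<Longrightarrow> finite \<Omega>"
  and coordinates_bij: "coordinates f U \<Omega> \<tau> \<kappa> \<Longrightarrow> bij_betw \<tau> \<Omega> \<Omega>"
  and coordinates_linear: "coordinates f U \<Omega> \<tau> \<kappa> \<Longrightarrow> \<omega> \<in> \<Omega> \<Longrightarrow> linear_form U (\<kappa> \<omega>)"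
  and coordinates_act: "coordinates f U \<Omega> \<tau> \<kappa> \<Longrightarrow> \<omega> \<in> \<Omega> \<Longrightarrow> x \<in> U \<Longrightarrow> \<kappa> (\<tau> \<omega>) (act f x) = \<kappa> \<omega> x"
  and coordinates_zero: "coordinates f U \<Omega> \<tau> \<kappa> \<Longrightarrow> x \<in> U \<Longrightarrow> (\<And>\<omega>. \<omega> \<in> \<Omega> \<Longrightarrow> \<kappa> \<omega> x = \<zero>) \<Longrightarrow> x = \<zero>\<^sub>M"
  by (auto simp: coordinates_def)

lemma coordinates_mem: "coordinates f U \<Omega> \<tau> \<kappa> \<Longrightarrow> \<omega> \<in> \<Omega> \<Longrightarrow> \<tau> \<omega> \<in> \<Omega>"
  using coordinates_bij bij_betwE by metis

lemma coordinates_obtain: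
  assumes "coordinates f U \<Omega> \<tau> \<kappa>" "\<And>\<omega>. \<omega> \<in> \<Omega> \<Longrightarrow> c \<omega> \<in> carrier R"
  obtains x where "x \<in> U" "\<And>\<omega>. \<omega> \<in> \<Omega> \<Longrightarrow> \<kappa> \<omega> x = c \<omega>"
proof -
  have "c \<in> \<Omega> \<rightarrow> carrier R" using assms(2) by auto
  thus thesis using assms(1) that unfolding coordinates_def by meson
qed

lemma coordinates_eqI:
  assumes C: "coordinates f U \<Omega> \<tau> \<kappa>" and U: "stable U" and xy: "x \<in> U" "y \<in> U"
    and eq: "\<And>\<omega>. \<omega> \<in> \<Omega> \<Longrightarrow> \<kappa> \<omega> x = \<kappa> \<omega> y"
  shows "x = y"
proof -
  have "x \<boxminus> y = \<zero>\<^sub>M"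
    using xy eq stable_vsub[OF U xy] linear_form_closed[OF coordinates_linear[OF C]]
    by (intro coordinates_zero[OF C])
      (auto simp: linear_form_vsub[OF coordinates_linear[OF C] U] R.minus_eq R.r_neg)
  thus ?thesis using xy stable_carrier[OF U] by (simp add: vsub_eq_0_iff)
qed

lemma coordinates_p_multiple:
  assumes C: "coordinates f U \<Omega> \<tau> \<kappa>" and U: "stable U" and x: "x \<in> U"
    and "\<And>\<omega>. \<omega> \<in> \<Omega> \<Longrightarrow> \<kappa> \<omega> x \<in> p_ideal"
  shows "x \<in> p_multiples U"
proof -
  have "\<forall>\<omega>\<in>\<Omega>. \<exists>s. s \<in> carrier R \<and> \<kappa> \<omega> x = \<pi> \<otimes> s"
    using assms(4) by (fastforce simp: p_ideal_def)
  then obtain s where s: "\<And>\<omega>. \<omega> \<in> \<Omega> \<Longrightarrow> s \<omega> \<in> carrier R" "\<And>\<omega>. \<omega> \<in> \<Omega> \<Longrightarrow> \<kappa> \<omega> x = \<pi> \<otimes> s \<omega>"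
    by metis
  obtain u where u: "u \<in> U" "\<And>\<omega>. \<omega> \<in> \<Omega> \<Longrightarrow> \<kappa> \<omega> u = s \<omega>"
    using coordinates_obtain[OF C, of s] s by blast
  have "x = \<pi> \<bullet> u"
    using u s x stable_scale[OF U]
    by (intro coordinates_eqI[OF C U]) (auto simp: linear_form_scale[OF coordinates_linear[OF C]])
  thus ?thesis using u by (simp add: p_multiplesI)
qed

primrec comb :: "(nat \<Rightarrow> 'r) \<Rightarrow> 'm \<Rightarrow> nat \<Rightarrow> 'm" where
  "comb a y 0 = \<zero>\<^sub>M"
| "comb a y (Suc n) = comb a y n \<boxplus> a n \<bullet> act (\<xi> ^ n) y"

lemma comb_in:
  "stable U \<Longrightarrow> y \<in> U \<Longrightarrow> (\<And>l. l < n \<Longrightarrow> a l \<in> carrier R) \<Longrightarrow> comb a y n \<in> U"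
  by (induction n) (auto intro!: stableI)

lemma comb_closed [simp]:
  "y \<in> carrier M \<Longrightarrow> (\<And>l. l < n \<Longrightarrow> a l \<in> carrier R) \<Longrightarrow> comb a y n \<in> carrier M"
  by (induction n) auto

lemma comb_cong: "(\<And>l. l < n \<Longrightarrow> a l = b l) \<Longrightarrow> comb a y n = comb b y n"
  by (induction n) auto

lemma comb_add:
  "y \<in> carrier M \<Longrightarrow> (\<And>l. l < n \<Longrightarrow> a l \<in> carrier R) \<Longrightarrow> (\<And>l. l < n \<Longrightarrow> b l \<in> carrier R) \<Longrightarrow>
   comb (\<lambda>l. a l \<oplus> b l) y n = comb a y n \<boxplus> comb b y n"
  by (induction n) (auto simp: smult_l_distr M.a_ac)

lemma comb_scale:
  "y \<in> carrier M \<Longrightarrow> r \<in> carrier R \<Longrightarrow> (\<And>l. l < n \<Longrightarrow> a l \<in> carrier R) \<Longrightarrow>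
   comb (\<lambda>l. r \<otimes> a l) y n = r \<bullet> comb a y n"
  by (induction n) (auto simp: smult_r_distr smult_assoc1)

lemma comb_zero: "y \<in> carrier M \<Longrightarrow> (\<And>l. l < n \<Longrightarrow> a l = \<zero>) \<Longrightarrow> comb a y n = \<zero>\<^sub>M"
  by (induction n) auto

lemma comb_shift:
  assumes [simp]: "y \<in> carrier M"
  shows "(\<And>l. l < Suc n \<Longrightarrow> a l \<in> carrier R) \<Longrightarrow>
    comb a y (Suc n) = a 0 \<bullet> y \<boxplus> T (comb (\<lambda>l. a (Suc l)) y n)"
proof (induction n)
  case (Suc n)
  have 1: "comb (\<lambda>l. a (Suc l)) y n \<in> carrier M" using Suc.prems by simp
  have "comb a y (Suc (Suc n)) =
      (a 0 \<bullet> y \<boxplus> T (comb (\<lambda>l. a (Suc l)) y n)) \<boxplus> a (Suc n) \<bullet> act (\<xi> ^ Suc n) y"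
    using Suc by simp
  also have "act (\<xi> ^ Suc n) y = T (act (\<xi> ^ n) y)" by (simp only: act_indet_power_Suc assms)
  finally show ?case
    using 1 Suc.prems by (simp add: T_add T_smult T_closed M.a_assoc)
qed simp

lemma linear_form_comb:
  assumes U: "stable U" and \<mu>: "linear_form U \<mu>" and y: "y \<in> U"
    and d: "\<And>l. l < n \<Longrightarrow> \<mu> (act (\<xi> ^ l) y) = (if l = m then \<one> else \<zero>)"
    and a: "\<And>l. l < n \<Longrightarrow> a l \<in> carrier R"
  shows "\<mu> (comb a y n) = (if m < n then a m else \<zero>)"
  using d a
proof (induction n)
  case 0
  thus ?case by (simp add: linear_form_vzero[OF \<mu> U])
next
  case (Suc n)
  have "\<mu> (comb a y (Suc n)) = \<mu> (comb a y n) \<oplus> a n \<otimes> \<mu> (act (\<xi> ^ n) y)"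
    using Suc.prems comb_in[OF U y, of n a] y U
    by (simp add: linear_form_vadd[OF \<mu>] linear_form_scale[OF \<mu>] stableI)
  also have "\<mu> (comb a y n) = (if m < n then a m else \<zero>)" using Suc by simp
  finally show ?case using Suc.prems by (auto simp: less_Suc_eq)
qed

end

section \<open>Splitting off a free summand\<close>

text \<open>With \<open>y\<close> dual to \<open>\<mu>\<close>, the translates of \<open>y\<close> form a basis of a free module over the group ring of
the cyclic group of order \<open>n\<close>, and \<open>\<mu>\<close> determines an equivariant retraction of \<open>U\<close> onto it.\<close>

locale dual_pair = local_operator R M p T
  for R :: "('r, 'a) ring_scheme" (structure) and M :: "('r, 'm, 'b) module_scheme" (structure)
    and p T +
  fixes U :: "'m set" and n :: nat and \<mu> :: "'m \<Rightarrow> 'r" and y :: 'm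
  assumes U: "stable U" and period: "U = fixed n U" and n_pos: "n > 0"
    and \<mu>: "linear_form U \<mu>" and y: "y \<in> U"
    and dual_0: "\<mu> y = \<one>" and dual: "\<And>l. 0 < l \<Longrightarrow> l < n \<Longrightarrow> \<mu> (act (\<xi> ^ l) y) = \<zero>"
begin

lemma U_carrier [simp]: "x \<in> U \<Longrightarrow> x \<in> carrier M"
  and U_act [simp]: "x \<in> U \<Longrightarrow> act f x \<in> U"
  and U_T [simp]: "x \<in> U \<Longrightarrow> T x \<in> U"
  and mu_closed [simp]: "x \<in> U \<Longrightarrow> \<mu> x \<in> carrier R"
  using U \<mu> by (auto intro: stable_carrier stableI linear_form_closed)

lemma act_add_period: "x \<in> U \<Longrightarrow> act (\<xi> ^ (k + n)) x = act (\<xi> ^ k) x"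
  using period by (simp add: power_add act_mult fixed_def) (metis (mono_tags, lifting) mem_Collect_eq)

text \<open>The coefficient of \<open>T\<^sup>l y\<close> in the image of \<open>x\<close> under the retraction.\<close>

definition dcoeff :: "'m \<Rightarrow> nat \<Rightarrow> 'r" where "dcoeff x l = \<mu> (act (\<xi> ^ (n - l)) x)"

lemma dcoeff_closed [simp]: "x \<in> U \<Longrightarrow> dcoeff x l \<in> carrier R"
  by (simp add: dcoeff_def)

lemma linear_form_dcoeff: "linear_form U (\<lambda>x. dcoeff x l)"
  using \<mu> unfolding dcoeff_def linear_form_def by (auto simp: act_vadd act_scale)

lemma dcoeff_T:
  assumes "x \<in> U" "l < n"
  shows "dcoeff (T x) (Suc l mod n) = dcoeff x l"
proof (cases "Suc l = n")
  case True
  hence "n - l = 1" by simp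
  thus ?thesis using True assms act_add_period[of x 1] act_indet_power_Suc[of x n]
    by (simp add: dcoeff_def act_indet act_commute[of x \<xi>] flip: act_mult power_Suc2)
      (simp add: act_indet act_commute[of x \<xi>] flip: act_indet)
next
  case False
  hence "n - l = Suc (n - Suc l)" "Suc l mod n = Suc l" using assms by auto
  thus ?thesis using assms
    by (simp add: dcoeff_def act_mult act_indet act_commute[of _ \<xi>] flip: act_indet)
qed

lemma dcoeff_comb:
  assumes a: "\<And>l. l < n \<Longrightarrow> a l \<in> carrier R" and m: "m < n"
  shows "dcoeff (comb a y n) m = a m"
proof -
  have "dcoeff (act (\<xi> ^ l) y) m = (if l = m then \<one> else \<zero>)" if "l < n" for l
  proof -
    have eq: "dcoeff (act (\<xi> ^ l) y) m = \<mu> (act (\<xi> ^ (n - m + l)) y)"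
      using y by (simp add: dcoeff_def power_add act_mult)
    consider "l < m" | "l = m" | k where "l = m + k" "0 < k" by (metis less_imp_add_positive linorder_neqE_nat)
    thus ?thesis
    proof cases
      case 1
      thus ?thesis using m by (simp add: eq dual)
    next
      case 2
      hence "n - m + l = 0 + n" using m by simp
      thus ?thesis using 2 y dual_0 act_add_period[of y 0] unfolding eq by simp
    next
      case 3
      hence "n - m + l = k + n" using m by simp
      thus ?thesis using 3 that y act_add_period[of y k] unfolding eq by (simp add: dual add.commute[of n])
    qed
  qed
  thus ?thesis using linear_form_comb[OF U linear_form_dcoeff y, of n m m a] a m by simp
qed

definition proj :: "'m \<Rightarrow> 'm" where "proj x = x \<boxminus> comb (dcoeff x) y n"

definition compl :: "'m set" where "compl = {x \<in> U. \<forall>l. \<mu> (act (\<xi> ^ l) x) = \<zero>}"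

lemma comb_U: "(\<And>l. l < n \<Longrightarrow> a l \<in> carrier R) \<Longrightarrow> comb a y n \<in> U"
  by (rule comb_in[OF U y])

lemma proj_in_U: "x \<in> U \<Longrightarrow> proj x \<in> U"
  by (auto simp: proj_def intro!: stable_vsub[OF U] comb_U)

lemma proj_T:
  assumes x: "x \<in> U"
  shows "proj (T x) = T (proj x)"
proof -
  obtain m where m: "n = Suc m" using n_pos by (cases n) auto
  have ym [simp]: "y \<in> carrier M" using y by simp
  have comb_n: "comb a y n = comb a y m \<boxplus> a m \<bullet> act (\<xi> ^ m) y" for a
    by (simp add: m)
  have c: "comb (dcoeff x) y m \<in> carrier M" using x by (intro comb_closed) auto
  have "comb (dcoeff (T x)) y n = dcoeff (T x) 0 \<bullet> y \<boxplus> T (comb (\<lambda>l. dcoeff (T x) (Suc l)) y m)"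
  proof -
    have "comb a y n = a 0 \<bullet> y \<boxplus> T (comb (\<lambda>l. a (Suc l)) y m)" if "\<And>l. a l \<in> carrier R" for a
      using comb_shift[OF ym, of m a] that unfolding m by blast
    thus ?thesis using x by simp
  qed
  also have "dcoeff (T x) 0 = dcoeff x m" using dcoeff_T[OF x, of m] m by simp
  also have "comb (\<lambda>l. dcoeff (T x) (Suc l)) y m = comb (dcoeff x) y m"
    using dcoeff_T[OF x] m by (intro comb_cong) (metis Suc_less_eq less_Suc_eq mod_less)
  also have "dcoeff x m \<bullet> y \<boxplus> T (comb (dcoeff x) y m) = T (comb (dcoeff x) y n)"
  proof -
    have "T (act (\<xi> ^ m) y) = y"
      using act_add_period[OF y, of 0] m by (simp flip: act_indet_power_Suc)
    thus ?thesis using x c by (simp add: comb_n T_add T_smult T_closed M.a_comm)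
  qed
  finally have "comb (dcoeff (T x)) y n = T (comb (dcoeff x) y n)" .
  thus ?thesis using x comb_U[of "dcoeff x"]
    by (simp add: proj_def act_vsub flip: act_indet)
qed

lemma proj_act_power: "x \<in> U \<Longrightarrow> proj (act (\<xi> ^ k) x) = act (\<xi> ^ k) (proj x)"
proof (induction k)
  case (Suc k)
  have "proj (act (\<xi> ^ Suc k) x) = T (proj (act (\<xi> ^ k) x))"
    using Suc.prems by (simp only: act_indet_power_Suc U_carrier proj_T U_act)
  thus ?case using Suc proj_in_U[OF Suc.prems] by (simp only: act_indet_power_Suc U_carrier)
qed (simp add: proj_in_U)

lemma proj_in_compl:
  assumes x: "x \<in> U"
  shows "proj x \<in> compl"
proof -
  have "\<mu> (proj z) = \<zero>" if z: "z \<in> U" for z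
  proof -
    have "\<mu> (comb (dcoeff z) y n) = dcoeff z 0"
      using linear_form_comb[OF U \<mu> y, of n 0 "dcoeff z"] z dual dual_0 n_pos y
      by (auto split: if_splits)
    also have "\<dots> = \<mu> z" using act_add_period[OF z, of 0] z by (simp add: dcoeff_def)
    finally show ?thesis
      using z comb_U[of "dcoeff z"]
      by (simp add: proj_def linear_form_vsub[OF \<mu> U] R.minus_eq R.r_neg)
  qed
  thus ?thesis using x proj_in_U by (simp add: compl_def flip: proj_act_power)
qed

lemma compl_subset: "compl \<subseteq> U"
  by (auto simp: compl_def)

lemma compl_memD: "x \<in> compl \<Longrightarrow> x \<in> U"
  by (auto simp: compl_def)

lemma stable_compl: "stable compl"
proof -
  have "\<mu> (act (\<xi> ^ l) (T x)) = \<mu> (act (\<xi> ^ Suc l) x)" if "x \<in> U" for x l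
    using that by (simp add: act_mult act_commute flip: act_indet)
  thus ?thesis
    unfolding stable_def compl_def
    using \<mu> U by (auto simp: stableI act_vadd act_scale linear_form_vadd linear_form_scale linear_form_vzero
        simp del: power_Suc)
qed

lemma proj_compl: "x \<in> compl \<Longrightarrow> proj x = x"
proof -
  assume "x \<in> compl"
  hence x: "x \<in> U" "\<And>l. dcoeff x l = \<zero>" by (auto simp: compl_def dcoeff_def)
  hence "comb (dcoeff x) y n = \<zero>\<^sub>M" using y by (intro comb_zero) auto
  thus ?thesis using x by (simp add: proj_def M.minus_eq)
qed

lemma proj_vadd:
  assumes "x \<in> U" "z \<in> U"
  shows "proj (x \<boxplus> z) = proj x \<boxplus> proj z"
proof -
  have "dcoeff (x \<boxplus> z) = (\<lambda>l. dcoeff x l \<oplus> dcoeff z l)"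
    using assms by (intro ext) (simp add: linear_form_vadd[OF linear_form_dcoeff])
  hence "comb (dcoeff (x \<boxplus> z)) y n = comb (dcoeff x) y n \<boxplus> comb (dcoeff z) y n"
    using assms y by (simp add: comb_add)
  thus ?thesis
    using assms comb_U[of "dcoeff x"] comb_U[of "dcoeff z"]
    by (simp add: proj_def M.minus_eq M.minus_add M.a_ac)
qed

lemma proj_scale:
  assumes "r \<in> carrier R" "x \<in> U"
  shows "proj (r \<bullet> x) = r \<bullet> proj x"
proof -
  have "dcoeff (r \<bullet> x) = (\<lambda>l. r \<otimes> dcoeff x l)"
    using assms by (intro ext) (simp add: linear_form_scale[OF linear_form_dcoeff])
  hence "comb (dcoeff (r \<bullet> x)) y n = r \<bullet> comb (dcoeff x) y n"
    using assms y by (simp add: comb_scale)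
  thus ?thesis using assms comb_U[of "dcoeff x"] by (simp add: proj_def scale_vsub)
qed

lemma proj_comb: "(\<And>l. l < n \<Longrightarrow> a l \<in> carrier R) \<Longrightarrow> proj (comb a y n) = \<zero>\<^sub>M"
proof -
  assume a: "\<And>l. l < n \<Longrightarrow> a l \<in> carrier R"
  have "comb (dcoeff (comb a y n)) y n = comb a y n"
    using dcoeff_comb[OF a] by (intro comb_cong) auto
  thus ?thesis using comb_U[OF a] by (simp add: proj_def vsub_eq_0_iff)
qed

text \<open>The free summand contributes \<open>n\<close> cyclically permuted coordinates, numbered \<open>0, \<dots>, n - 1\<close>; those of
the complement are shifted by \<open>n\<close> and extended along the equivariant projection.\<close>

lemma coordinates_extend:
  fixes \<Omega> :: "nat set"
  assumes C: "coordinates \<xi> compl \<Omega> \<tau> \<kappa>"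
  shows "\<exists>(\<Omega>' :: nat set) \<tau>' \<kappa>'. coordinates \<xi> U \<Omega>' \<tau>' \<kappa>'"
proof -
  define \<Omega>' where "\<Omega>' = {..<n} \<union> (+) n ` \<Omega>"
  define \<tau>' where "\<tau>' i = (if i < n then Suc i mod n else n + \<tau> (i - n))" for i
  define \<kappa>' where "\<kappa>' i x = (if i < n then dcoeff x i else \<kappa> (i - n) (proj x))" for i x
  have lin: "linear_form compl (\<kappa> \<omega>)" if "\<omega> \<in> \<Omega>" for \<omega> using C that by (rule coordinates_linear)
  have mem: "i < n \<or> (\<exists>\<omega>\<in>\<Omega>. i = n + \<omega>)" if "i \<in> \<Omega>'" for i using that by (auto simp: \<Omega>'_def)
  have "coordinates \<xi> U \<Omega>' \<tau>' \<kappa>'"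
    unfolding coordinates_def
  proof (intro conjI ballI impI)
    show fin: "finite \<Omega>'" using coordinates_finite[OF C] by (simp add: \<Omega>'_def)
    have "\<tau>' ` \<Omega>' \<subseteq> \<Omega>'"
      using coordinates_mem[OF C] n_pos by (auto simp: \<tau>'_def \<Omega>'_def)
    moreover have "inj_on \<tau>' \<Omega>'"
    proof (rule inj_onI)
      fix i j assume ij: "i \<in> \<Omega>'" "j \<in> \<Omega>'" "\<tau>' i = \<tau>' j"
      have small: "\<tau>' k < n \<longleftrightarrow> k < n" for k using n_pos by (simp add: \<tau>'_def)
      show "i = j"
      proof (cases "i < n")
        case True
        hence "j < n" using small[of i] small[of j] ij by simp
        thus ?thesis using True ij by (auto simp: \<tau>'_def mod_Suc split: if_splits)
      next
        case False
        hence "\<not> j < n" using small[of i] small[of j] ij by simp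
        with False obtain a b where "a \<in> \<Omega>" "b \<in> \<Omega>" "i = n + a" "j = n + b" using mem ij by blast
        thus ?thesis using ij coordinates_bij[OF C] by (auto simp: \<tau>'_def bij_betw_def inj_on_def)
      qed
    qed
    ultimately show "bij_betw \<tau>' \<Omega>' \<Omega>'"
      using fin by (simp add: bij_betw_def endo_inj_surj)
  next
    fix i assume i: "i \<in> \<Omega>'"
    show "linear_form U (\<kappa>' i)"
    proof (cases "i < n")
      case True
      thus ?thesis using linear_form_dcoeff[of i] by (simp add: \<kappa>'_def[abs_def])
    next
      case False
      then obtain \<omega> where "\<omega> \<in> \<Omega>" "i = n + \<omega>" using mem i by blast
      thus ?thesis using lin[of \<omega>]
        by (auto simp: linear_form_def \<kappa>'_def proj_vadd proj_scale proj_in_compl)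
    qed
  next
    fix i x assume i: "i \<in> \<Omega>'" and x: "x \<in> U"
    show "\<kappa>' (\<tau>' i) (act \<xi> x) = \<kappa>' i x"
    proof (cases "i < n")
      case True
      thus ?thesis using dcoeff_T[OF x True] x by (simp add: \<kappa>'_def \<tau>'_def act_indet)
    next
      case False
      then obtain \<omega> where w: "\<omega> \<in> \<Omega>" "i = n + \<omega>" using mem i by blast
      have "proj (act \<xi> x) = act \<xi> (proj x)" using proj_T[OF x] x proj_in_U[OF x] by (simp add: act_indet)
      thus ?thesis using coordinates_act[OF C w(1) proj_in_compl[OF x]] w
        by (simp add: \<kappa>'_def \<tau>'_def)
    qed
  next
    fix x assume x: "x \<in> U" and z: "\<forall>i\<in>\<Omega>'. \<kappa>' i x = \<zero>"
    have "dcoeff x l = \<zero>" if "l < n" for l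
      using z that by (force simp: \<Omega>'_def \<kappa>'_def)
    hence "comb (dcoeff x) y n = \<zero>\<^sub>M" using y by (intro comb_zero) auto
    hence "proj x = x" using x by (simp add: proj_def M.minus_eq)
    moreover have "proj x = \<zero>\<^sub>M"
    proof (rule coordinates_zero[OF C proj_in_compl[OF x]])
      fix \<omega> assume "\<omega> \<in> \<Omega>"
      hence "n + \<omega> \<in> \<Omega>'" by (simp add: \<Omega>'_def)
      thus "\<kappa> \<omega> (proj x) = \<zero>" using z by (force simp: \<kappa>'_def)
    qed
    ultimately show "x = \<zero>\<^sub>M" by simp
  next
    fix c assume c: "c \<in> \<Omega>' \<rightarrow> carrier R"
    hence c1: "c l \<in> carrier R" if "l < n" for l using that by (auto simp: \<Omega>'_def)
    have c2: "c (n + \<omega>) \<in> carrier R" if "\<omega> \<in> \<Omega>" for \<omega> using c that by (auto simp: \<Omega>'_def)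
    obtain z where z: "z \<in> compl" "\<And>\<omega>. \<omega> \<in> \<Omega> \<Longrightarrow> \<kappa> \<omega> z = c (n + \<omega>)"
      using coordinates_obtain[OF C, of "\<lambda>\<omega>. c (n + \<omega>)"] c2 by blast
    define x where "x = comb c y n \<boxplus> z"
    have zU: "z \<in> U" and cU: "comb c y n \<in> U" using z compl_subset comb_U c1 by auto
    have xU: "x \<in> U" using zU cU U by (simp add: x_def stableI)
    have "dcoeff x l = c l" if "l < n" for l
    proof -
      have "dcoeff z l = \<zero>" using z by (simp add: compl_def dcoeff_def)
      thus ?thesis using that zU cU c1 dcoeff_comb[of c l]
        by (simp add: x_def linear_form_vadd[OF linear_form_dcoeff])
    qed
    moreover have "proj x = z"
      using zU cU c1 z by (simp add: x_def proj_vadd proj_comb proj_compl)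
    ultimately show "\<exists>x\<in>U. \<forall>i\<in>\<Omega>'. \<kappa>' i x = c i"
      using xU z by (intro bexI[of _ x]) (auto simp: \<Omega>'_def \<kappa>'_def)
  qed
  thus ?thesis by blast
qed

end

context local_operator
begin

lemma stable_carrier_set: "stable (carrier M)"
  by (auto simp: stable_def T_closed)

lemma coordinates_power:
  assumes C: "coordinates f U \<Omega> \<tau> \<kappa>" and U: "stable U"
  shows "coordinates (f ^ k) U \<Omega> (\<tau> ^^ k) \<kappa>"
proof (induction k)
  case 0
  show ?case using C U by (auto simp: coordinates_def stable_carrier bij_betw_def)
next
  case (Suc k)
  have bij: "bij_betw (\<tau> ^^ Suc k) \<Omega> \<Omega>"
    using coordinates_bij[OF C] by (rule bij_betw_funpow)
  have "\<kappa> ((\<tau> ^^ Suc k) \<omega>) (act (f ^ Suc k) x) = \<kappa> \<omega> x" if "\<omega> \<in> \<Omega>" "x \<in> U" for \<omega> x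
    using that coordinates_act[OF C coordinates_mem[OF Suc that(1)], of "act (f ^ k) x"]
      coordinates_act[OF Suc that] U
    by (simp add: act_mult stable_carrier stable_act)
  thus ?case using C bij unfolding coordinates_def by blast
qed

text \<open>Choose a representative in each orbit of \<open>\<tau>\<close>, and let every coordinate of \<open>\<rho> x\<close> be the coordinate of
\<open>x\<close> at the representative of its orbit. If \<open>x\<close> is invariant modulo \<open>p\<close>, its coordinates are
constant on orbits modulo \<open>p\<close>, so \<open>\<rho>\<close> changes them only by multiples of \<open>p\<close>.\<close>

lemma projection_onto_fixed:
  assumes C: "coordinates f U \<Omega> \<tau> \<kappa>" and U: "stable U"
  obtains \<rho> where "linear_map U \<rho>" "\<And>x. x \<in> U \<Longrightarrow> \<rho> x \<in> U" "\<And>x. x \<in> U \<Longrightarrow> act f (\<rho> x) = \<rho> x"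
    "\<And>x. x \<in> U \<Longrightarrow> act f x = x \<Longrightarrow> \<rho> x = x"
    "\<And>x. x \<in> U \<Longrightarrow> act (f - 1) x \<in> p_multiples U \<Longrightarrow> x \<boxminus> \<rho> x \<in> p_multiples U"
proof -
  note lin = coordinates_linear[OF C]
  note [simp] = linear_form_closed[OF lin] stable_carrier[OF U]
  \<comment> \<open>the orbits, as the classes of the equivalence relation generated by \<open>\<omega> \<sim> \<tau> \<omega>\<close>\<close>
  define s where "s = {(\<omega>, \<tau> \<omega>) | \<omega>. \<omega> \<in> \<Omega>}"
  define E where "E = (s \<union> s\<inverse>)\<^sup>*"
  define rep where "rep \<omega> = (SOME \<omega>'. (\<omega>, \<omega>') \<in> E)" for \<omega>
  have rep: "(\<omega>, rep \<omega>) \<in> E" for \<omega> unfolding rep_def by (rule someI[of _ \<omega>]) (simp add: E_def)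
  have in_\<Omega>: "\<omega>' \<in> \<Omega>" if "(\<omega>, \<omega>') \<in> E" "\<omega> \<in> \<Omega>" for \<omega> \<omega>'
    using that(1) unfolding E_def
    by (induction rule: rtrancl_induct) (use that(2) coordinates_mem[OF C] in \<open>auto simp: s_def\<close>)
  have sym: "sym E" unfolding E_def by (intro sym_rtrancl sym_Un_converse)
  have rep_\<tau>: "rep (\<tau> \<omega>) = rep \<omega>" if "\<omega> \<in> \<Omega>" for \<omega>
  proof -
    have "(\<omega>, \<tau> \<omega>) \<in> E" using that by (auto simp: E_def s_def)
    hence "(\<tau> \<omega>, \<omega>') \<in> E \<longleftrightarrow> (\<omega>, \<omega>') \<in> E" for \<omega>'
      using sym unfolding E_def by (meson rtrancl_trans symD)
    thus ?thesis by (simp add: rep_def)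
  qed
  have rep_\<Omega> [simp]: "rep \<omega> \<in> \<Omega>" if "\<omega> \<in> \<Omega>" for \<omega> using in_\<Omega>[OF rep that] .
  have "\<forall>x. \<exists>y. x \<in> U \<longrightarrow> y \<in> U \<and> (\<forall>\<omega>\<in>\<Omega>. \<kappa> \<omega> y = \<kappa> (rep \<omega>) x)"
  proof
    fix x
    show "\<exists>y. x \<in> U \<longrightarrow> y \<in> U \<and> (\<forall>\<omega>\<in>\<Omega>. \<kappa> \<omega> y = \<kappa> (rep \<omega>) x)"
    proof (cases "x \<in> U")
      case True
      then obtain y where "y \<in> U" "\<And>\<omega>. \<omega> \<in> \<Omega> \<Longrightarrow> \<kappa> \<omega> y = \<kappa> (rep \<omega>) x"
        using coordinates_obtain[OF C, of "\<lambda>\<omega>. \<kappa> (rep \<omega>) x"] by auto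
      thus ?thesis by blast
    qed simp
  qed
  then obtain \<rho> where \<rho>: "\<And>x. x \<in> U \<Longrightarrow> \<rho> x \<in> U" "\<And>x \<omega>. x \<in> U \<Longrightarrow> \<omega> \<in> \<Omega> \<Longrightarrow> \<kappa> \<omega> (\<rho> x) = \<kappa> (rep \<omega>) x"
    by metis
  have 1: "linear_map U \<rho>"
    unfolding linear_map_def
  proof (intro conjI ballI)
    fix x y assume xy: "x \<in> U" "y \<in> U"
    show "\<rho> (x \<boxplus> y) = \<rho> x \<boxplus> \<rho> y"
      by (rule coordinates_eqI[OF C U]) (use xy \<rho> U in \<open>simp_all add: stableI linear_form_vadd[OF lin]\<close>)
  next
    fix r x assume rx: "r \<in> carrier R" "x \<in> U"
    show "\<rho> (r \<bullet> x) = r \<bullet> \<rho> x"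
      by (rule coordinates_eqI[OF C U]) (use rx \<rho> U in \<open>simp_all add: stableI linear_form_scale[OF lin]\<close>)
  qed (use \<rho> in auto)
  have 2: "act f (\<rho> x) = \<rho> x" if x: "x \<in> U" for x
  proof (rule coordinates_eqI[OF C U])
    fix \<omega>' assume "\<omega>' \<in> \<Omega>"
    then obtain \<omega> where w: "\<omega> \<in> \<Omega>" "\<omega>' = \<tau> \<omega>"
      using coordinates_bij[OF C] by (auto simp: bij_betw_def)
    show "\<kappa> \<omega>' (act f (\<rho> x)) = \<kappa> \<omega>' (\<rho> x)"
      using w x \<rho> coordinates_act[OF C w(1) \<rho>(1)[OF x]] coordinates_mem[OF C w(1)] rep_\<tau>
      by simp
  qed (use x \<rho> U in \<open>simp_all add: stableI\<close>)
  have 3: "\<rho> x = x" if x: "x \<in> U" "act f x = x" for x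
  proof (rule coordinates_eqI[OF C U])
    fix \<omega> assume w: "\<omega> \<in> \<Omega>"
    have "\<kappa> \<omega>' x = \<kappa> \<omega> x" if "(\<omega>, \<omega>') \<in> E" for \<omega>'
      using that unfolding E_def
    proof (induction rule: rtrancl_induct)
      case (step a b)
      have "\<kappa> (\<tau> c) x = \<kappa> c x" if "c \<in> \<Omega>" for c using coordinates_act[OF C that x(1)] x by simp
      thus ?case using step by (auto simp: s_def)
    qed simp
    thus "\<kappa> \<omega> (\<rho> x) = \<kappa> \<omega> x" using rep x w \<rho> by simp
  qed (use x \<rho> in auto)
  have 4: "x \<boxminus> \<rho> x \<in> p_multiples U" if x: "x \<in> U" and m: "act (f - 1) x \<in> p_multiples U" for x
  proof (rule coordinates_p_multiple[OF C U])
    show "x \<boxminus> \<rho> x \<in> U" using x \<rho> U by (simp add: stableI)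
    have step: "\<kappa> c x \<ominus> \<kappa> (\<tau> c) x \<in> p_ideal" if "c \<in> \<Omega>" for c
    proof -
      have "\<kappa> (\<tau> c) (act (f - 1) x) = \<kappa> c x \<ominus> \<kappa> (\<tau> c) x"
        using x U coordinates_mem[OF C that] coordinates_act[OF C that x]
        by (simp add: act_minus linear_form_vsub[OF lin] stableI)
      thus ?thesis using linear_form_p_multiple[OF lin[OF coordinates_mem[OF C that]] m] by simp
    qed
    fix \<omega> assume w: "\<omega> \<in> \<Omega>"
    have zero: "\<zero> \<in> p_ideal" by (force simp: p_ideal_def)
    have tele: "(a \<ominus> b) \<oplus> (b \<ominus> c) = a \<ominus> c" "(a \<ominus> b) \<ominus> (c \<ominus> b) = a \<ominus> c"
      if "a \<in> carrier R" "b \<in> carrier R" "c \<in> carrier R" for a b c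
      using that by algebra+
    have "\<kappa> \<omega> x \<ominus> \<kappa> \<omega>' x \<in> p_ideal" if "(\<omega>, \<omega>') \<in> E" for \<omega>'
      using that unfolding E_def
    proof (induction rule: rtrancl_induct)
      case base
      show ?case using w x zero by (simp add: R.minus_eq R.r_neg)
    next
      case (step b c)
      have bc: "b \<in> \<Omega>" "c \<in> \<Omega>"
        using step.hyps in_\<Omega>[OF _ w] unfolding E_def by (auto intro: rtrancl_into_rtrancl)
      consider "c = \<tau> b" | "b = \<tau> c" using step.hyps by (auto simp: s_def)
      thus ?case
      proof cases
        case 1
        show ?thesis
          using p_ideal_add[OF step.IH \<open>\<And>c. c \<in> \<Omega> \<Longrightarrow> \<kappa> c x \<ominus> \<kappa> (\<tau> c) x \<in> p_ideal\<close>[OF bc(1)]]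
            bc w x by (simp add: 1 tele)
      next
        case 2
        show ?thesis
          using p_ideal_minus[OF step.IH \<open>\<And>c. c \<in> \<Omega> \<Longrightarrow> \<kappa> c x \<ominus> \<kappa> (\<tau> c) x \<in> p_ideal\<close>[OF bc(2)]]
            bc w x by (simp add: 2 tele)
      qed
    qed
    thus "\<kappa> \<omega> (x \<boxminus> \<rho> x) \<in> p_ideal"
      using w x rep \<rho> by (simp add: linear_form_vsub[OF lin U])
  qed
  show thesis using that[OF 1 \<rho>(1) 2 3 4] .
qed

end

context separated_operator
begin

text \<open>All data of a layer are transported to the complement by the equivariant projection onto it.\<close>

lemma layer_complement:
  assumes L: "layer q U \<rho>" and D: "dual_pair R M p T U (p * q) \<mu> y"
  shows "layer q (dual_pair.compl R M T U \<mu>) (\<lambda>x. dual_pair.proj R M T (p * q) \<mu> y (\<rho> x))"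
proof -
  interpret D: dual_pair R M p T U "p * q" \<mu> y by (fact D)
  let ?\<theta> = D.proj and ?V = D.compl
  have U: "stable U" and n: "U = fixed (p * q) U" and \<rho>: "linear_map U \<rho>"
      "\<And>x. x \<in> U \<Longrightarrow> \<rho> x \<in> fixed q U" "\<And>x. x \<in> fixed q U \<Longrightarrow> \<rho> x = x"
      "\<And>x. x \<in> U \<Longrightarrow> act (\<xi> ^ q - 1) x \<in> p_multiples U \<Longrightarrow> x \<boxminus> \<rho> x \<in> p_multiples U"
    using L by (auto simp: layer_def)
  have \<rho>U: "x \<in> U \<Longrightarrow> \<rho> x \<in> U" for x using \<rho>(2) fixedD(1) by blast
  have proj_minus: "?\<theta> (a \<boxminus> b) = ?\<theta> a \<boxminus> ?\<theta> b" if "a \<in> U" "b \<in> U" for a b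
    using that U by (simp add: vsub_eq_scale D.proj_vadd D.proj_scale stableI D.proj_in_U)
  show ?thesis
    unfolding layer_def
  proof (intro conjI ballI impI)
    show "?V = fixed (p * q) ?V" using n by (auto simp: fixed_def dest: D.compl_memD)
    show "linear_map ?V (\<lambda>x. ?\<theta> (\<rho> x))"
      using \<rho>(1) \<rho>U D.compl_subset
      by (auto simp: linear_map_def D.proj_vadd D.proj_scale D.proj_in_U subset_iff)
  next
    fix x assume "x \<in> ?V"
    hence x: "x \<in> U" by (rule D.compl_memD)
    show "?\<theta> (\<rho> x) \<in> fixed q ?V"
      using \<rho>(2)[OF x] \<rho>U[OF x] D.proj_in_compl D.proj_act_power[of "\<rho> x" q]
      by (simp add: fixed_def)
  next
    fix x assume "x \<in> fixed q ?V"
    hence x: "x \<in> ?V" "x \<in> fixed q U" by (auto simp: fixed_def dest: D.compl_memD)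
    thus "?\<theta> (\<rho> x) = x" using \<rho>(3) by (simp add: D.proj_compl)
  next
    fix x assume xV: "x \<in> ?V" and m: "act (\<xi> ^ q - 1) x \<in> p_multiples ?V"
    have x: "x \<in> U" using xV by (rule D.compl_memD)
    have "act (\<xi> ^ q - 1) x \<in> p_multiples U" using m D.compl_subset by (auto simp: p_multiples_def)
    then obtain u where u: "u \<in> U" "x \<boxminus> \<rho> x = \<pi> \<bullet> u" using \<rho>(4)[OF x] by (auto elim: p_multiplesE)
    have "x \<boxminus> ?\<theta> (\<rho> x) = ?\<theta> (x \<boxminus> \<rho> x)" using x xV \<rho>U by (simp add: proj_minus D.proj_compl)
    also have "\<dots> = \<pi> \<bullet> ?\<theta> u" using u by (simp add: D.proj_scale)
    finally show "x \<boxminus> ?\<theta> (\<rho> x) \<in> p_multiples ?V"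
      using D.proj_in_compl u by (simp add: p_multiplesI)
  qed (rule D.stable_compl)
qed

text \<open>One step of the ascent. Each free summand that is split off removes from the invariants exactly
the coordinates in one orbit of \<open>\<tau>\<close>.\<close>

lemma layer_coordinates:
  fixes \<Omega> :: "nat set"
  assumes "layer (p ^ j) U \<rho>" and "coordinates \<xi> (fixed (p ^ j) U) \<Omega> \<tau> \<kappa>"
  shows "\<exists>(\<Omega>' :: nat set) \<tau>' \<kappa>'. coordinates \<xi> U \<Omega>' \<tau>' \<kappa>'"
  using assms
proof (induction "card \<Omega>" arbitrary: U \<rho> \<Omega> rule: less_induct)
  case less
  let ?q = "p ^ j"
  let ?P = "fixed ?q U"
  note L = less.prems(1) and C = less.prems(2)
  have U: "stable U" and n: "U = fixed (p * ?q) U" and \<rho>: "linear_map U \<rho>"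
      "\<And>x. x \<in> U \<Longrightarrow> \<rho> x \<in> ?P" "\<And>x. x \<in> ?P \<Longrightarrow> \<rho> x = x"
    using L by (auto simp: layer_def)
  have P: "stable ?P" using U by (rule stable_fixed)
  show ?case
  proof (cases "\<forall>x\<in>U. act (\<Phi> ?q) x \<in> p_multiples U")
    case True
    hence "U = ?P" using norms_p_multiples_imp_fixed[OF L] by blast
    thus ?thesis using C by metis
  next
    case False
    then obtain x where x: "x \<in> U" "act (\<Gamma> (p * ?q)) x \<notin> p_multiples U"
      using norm_not_p_multiple[OF L] by blast
    define z where "z = act (\<Gamma> (p * ?q)) x"
    have "z = act (\<Phi> ?q) (act (\<Gamma> ?q) x)"
      using x U stable_carrier
      by (simp add: z_def geometric_sum_split[symmetric] act_mult act_commute[of x "\<Gamma> ?q"])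
    hence z: "z \<in> ?P" using norm_in_fixed[OF L stable_act[OF U x(1)]] by simp
    obtain b where b: "b \<in> \<Omega>" "\<kappa> b z \<notin> p_ideal"
      using coordinates_p_multiple[OF C P z] x(2) fixedD(1) unfolding z_def p_multiples_def by blast
    have b_lin: "linear_form ?P (\<kappa> b)" using C b(1) by (rule coordinates_linear)
    \<comment> \<open>extending the coordinate from the invariants by \<open>\<rho>\<close> keeps the complement compatible with the coordinates\<close>
    define \<mu> where "\<mu> x = \<kappa> b (\<rho> x)" for x
    have \<mu>_lin: "linear_form U \<mu>"
      using \<rho> b_lin by (auto simp: \<mu>_def linear_form_def linear_map_vadd linear_map_scale)
    have \<mu>_P: "\<mu> x = \<kappa> b x" if "x \<in> ?P" for x using that by (simp add: \<mu>_def \<rho>(3))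
    have "\<kappa> b z \<in> Units R"
      using unit_or_p_ideal[OF linear_form_closed[OF b_lin z]] b(2) by blast
    hence unit: "\<mu> (act (\<Gamma> (p * ?q)) x) \<in> Units R" using \<mu>_P[OF z] by (simp add: z_def)
    have pq: "p * ?q = p ^ Suc j" by simp
    obtain y where y: "y \<in> U" "\<mu> y = \<one>" "\<And>l. 0 < l \<Longrightarrow> l < p * ?q \<Longrightarrow> \<mu> (act (\<xi> ^ l) y) = \<zero>"
      using dual_vector[OF U n pq \<mu>_lin x(1) unit] by blast
    interpret D: dual_pair R M p T U "p * ?q" \<mu> y
      by unfold_locales (use U n \<mu>_lin y prime_p in \<open>auto simp: prime_gt_0_nat\<close>)
    define V where "V = D.compl"
    \<comment> \<open>the complement of the orbit of \<open>b\<close>; being mapped into itself by \<open>\<tau>\<close>, it is permuted since it is finite\<close>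
    define B where "B = {\<omega> \<in> \<Omega>. \<forall>l. (\<tau> ^^ l) \<omega> \<noteq> b}"
    have fin: "finite \<Omega>" using C by (rule coordinates_finite)
    have orth: "\<mu> (act (\<xi> ^ l) x) = \<kappa> \<omega> x" if "x \<in> ?P" "\<omega> \<in> \<Omega>" "(\<tau> ^^ l) \<omega> = b" for x \<omega> l
      using coordinates_act[OF coordinates_power[OF C P, of l] that(2,1)] that(3)
        \<mu>_P[OF stable_act[OF P that(1)]] by simp
    have PV: "fixed ?q V = {x \<in> ?P. \<forall>\<omega>\<in>\<Omega> - B. \<kappa> \<omega> x = \<zero>}"
    proof (intro equalityI subsetI)
      fix x assume "x \<in> fixed ?q V"
      hence x: "x \<in> ?P" "x \<in> V" by (auto simp: fixed_def V_def dest: D.compl_memD)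
      have "\<kappa> \<omega> x = \<zero>" if "\<omega> \<in> \<Omega> - B" for \<omega>
      proof -
        obtain l where "(\<tau> ^^ l) \<omega> = b" using \<open>\<omega> \<in> \<Omega> - B\<close> by (auto simp: B_def)
        thus ?thesis using orth[of x \<omega> l] x that by (simp add: V_def D.compl_def)
      qed
      thus "x \<in> {x \<in> ?P. \<forall>\<omega>\<in>\<Omega> - B. \<kappa> \<omega> x = \<zero>}" using x by blast
    next
      fix x assume x: "x \<in> {x \<in> ?P. \<forall>\<omega>\<in>\<Omega> - B. \<kappa> \<omega> x = \<zero>}"
      have "\<mu> (act (\<xi> ^ l) x) = \<zero>" for l
      proof -
        have "bij_betw (\<tau> ^^ l) \<Omega> \<Omega>" using coordinates_bij[OF C] by (rule bij_betw_funpow)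
        then obtain \<omega> where "\<omega> \<in> \<Omega>" "(\<tau> ^^ l) \<omega> = b" using b(1) unfolding bij_betw_def by (metis imageE)
        thus ?thesis using orth[of x \<omega> l] x by (auto simp: B_def)
      qed
      thus "x \<in> fixed ?q V" using x by (auto simp: fixed_def V_def D.compl_def)
    qed
    have CB: "coordinates \<xi> (fixed ?q V) B \<tau> \<kappa>"
      unfolding coordinates_def
    proof (intro conjI ballI impI)
      show fB: "finite B" using fin by (simp add: B_def)
      have "\<tau> ` B \<subseteq> B"
        using coordinates_mem[OF C] by (auto simp: B_def) (metis funpow_swap1 funpow_simps_right(2) comp_apply)
      moreover have "inj_on \<tau> B"
        using coordinates_bij[OF C] by (auto simp: bij_betw_def B_def intro: inj_on_subset)
      ultimately show "bij_betw \<tau> B B" using fB by (simp add: bij_betw_def endo_inj_surj)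
    next
      fix \<omega> assume w: "\<omega> \<in> B"
      hence "linear_form ?P (\<kappa> \<omega>)" using coordinates_linear[OF C] by (simp add: B_def)
      thus "linear_form (fixed ?q V) (\<kappa> \<omega>)" unfolding PV linear_form_def by auto
    next
      fix \<omega> x assume "\<omega> \<in> B" "x \<in> fixed ?q V"
      thus "\<kappa> (\<tau> \<omega>) (act \<xi> x) = \<kappa> \<omega> x"
        unfolding PV using coordinates_act[OF C] by (simp add: B_def)
    next
      fix x assume x: "x \<in> fixed ?q V" and z: "\<forall>\<omega>\<in>B. \<kappa> \<omega> x = \<zero>"
      have "x \<in> ?P" "\<And>\<omega>. \<omega> \<in> \<Omega> \<Longrightarrow> \<kappa> \<omega> x = \<zero>" using x z unfolding PV by auto
      thus "x = \<zero>\<^sub>M" by (rule coordinates_zero[OF C])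
    next
      fix c assume c: "c \<in> B \<rightarrow> carrier R"
      have "(if \<omega> \<in> B then c \<omega> else \<zero>) \<in> carrier R" for \<omega> using c by auto
      then obtain x where x: "x \<in> ?P" "\<And>\<omega>. \<omega> \<in> \<Omega> \<Longrightarrow> \<kappa> \<omega> x = (if \<omega> \<in> B then c \<omega> else \<zero>)"
        using coordinates_obtain[OF C, of "\<lambda>\<omega>. if \<omega> \<in> B then c \<omega> else \<zero>"] by blast
      hence "x \<in> fixed ?q V" unfolding PV by auto
      moreover have "\<forall>\<omega>\<in>B. \<kappa> \<omega> x = c \<omega>" using x by (auto simp: B_def)
      ultimately show "\<exists>x\<in>fixed ?q V. \<forall>\<omega>\<in>B. \<kappa> \<omega> x = c \<omega>" by blast
    qed
    have "b \<notin> B" by (auto simp: B_def intro: exI[of _ 0])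
    hence "B \<subset> \<Omega>" using b(1) by (auto simp: B_def)
    hence "card B < card \<Omega>" using fin by (rule psubset_card_mono[rotated])
    moreover have "layer ?q V (\<lambda>x. D.proj (\<rho> x))"
      unfolding V_def using L D.dual_pair_axioms by (rule layer_complement)
    ultimately obtain \<Omega>' :: "nat set" and \<tau>' \<kappa>' where "coordinates \<xi> V \<Omega>' \<tau>' \<kappa>'"
      using less.hyps CB by blast
    thus ?thesis unfolding V_def by (rule D.coordinates_extend)
  qed
qed

text \<open>The hypothesis on the \<open>p\<^sup>a\<close>-th power of \<open>T\<close> serves at every step of the chain: a basis permuted by this
power is permuted by all its further powers, and the resulting projection of the whole module
restricts to each layer.\<close>

theorem coordinates_ascend:
  fixes \<Omega> :: "nat set"
  assumes C0: "coordinates (\<xi> ^ (p ^ a)) (carrier M) \<Omega>\<^sub>0 \<tau>\<^sub>0 \<kappa>\<^sub>0"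
    and C: "coordinates \<xi> (fixed (p ^ a) (carrier M)) \<Omega> \<tau> \<kappa>"
  shows "\<exists>(\<Omega>' :: nat set) \<tau>' \<kappa>'. coordinates \<xi> (fixed (p ^ (a + i)) (carrier M)) \<Omega>' \<tau>' \<kappa>'"
proof (induction i)
  case 0
  show ?case using C by auto
next
  case (Suc i)
  let ?q = "p ^ (a + i)"
  let ?M = "carrier M"
  define U where "U = fixed (p ^ (a + Suc i)) ?M"
  note M = stable_carrier_set
  have U: "stable U" unfolding U_def using M by (rule stable_fixed)
  have CS: "coordinates (\<xi> ^ ?q) ?M \<Omega>\<^sub>0 (\<tau>\<^sub>0 ^^ (p ^ i)) \<kappa>\<^sub>0"
    using coordinates_power[OF C0 M, of "p ^ i"] by (simp add: power_add flip: power_mult)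
  obtain \<rho> where \<rho>: "linear_map ?M \<rho>" "\<And>x. x \<in> ?M \<Longrightarrow> \<rho> x \<in> ?M"
      "\<And>x. x \<in> ?M \<Longrightarrow> act (\<xi> ^ ?q) (\<rho> x) = \<rho> x" "\<And>x. x \<in> ?M \<Longrightarrow> act (\<xi> ^ ?q) x = x \<Longrightarrow> \<rho> x = x"
      "\<And>x. x \<in> ?M \<Longrightarrow> act (\<xi> ^ ?q - 1) x \<in> p_multiples ?M \<Longrightarrow> x \<boxminus> \<rho> x \<in> p_multiples ?M"
    using projection_onto_fixed[OF CS M] by blast
  have fix_power: "act (\<xi> ^ (m * ?q)) x = x" if "x \<in> ?M" "act (\<xi> ^ ?q) x = x" for x m
    by (induction m) (use that in \<open>simp_all add: power_add act_mult\<close>)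
  have UM: "U \<subseteq> ?M" by (auto simp: U_def fixed_def)
  have sub: "fixed ?q U = fixed ?q ?M"
    using fix_power[of _ p] by (auto simp: U_def fixed_def)
  have \<rho>U: "\<rho> x \<in> fixed ?q U" if "x \<in> U" for x
    using that \<rho>(2,3) UM unfolding sub by (auto simp: fixed_def)
  have "layer ?q U \<rho>"
    unfolding layer_def
  proof (intro conjI ballI impI)
    show "stable U" by (rule U)
    show "U = fixed (p * ?q) U" by (auto simp: U_def fixed_def)
    show "linear_map U \<rho>" using \<rho>(1) UM by (auto simp: linear_map_def subset_iff)
  next
    fix x assume "x \<in> fixed ?q U"
    thus "\<rho> x = x" using \<rho>(4) unfolding sub by (auto simp: fixed_def)
  next
    fix x assume x: "x \<in> U" and m: "act (\<xi> ^ ?q - 1) x \<in> p_multiples U"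
    have "act (\<xi> ^ ?q - 1) x \<in> p_multiples ?M" using m UM by (auto simp: p_multiples_def)
    then obtain u where u: "u \<in> ?M" "x \<boxminus> \<rho> x = \<pi> \<bullet> u"
      using \<rho>(5) x UM by (meson p_multiplesE subsetD)
    have "x \<boxminus> \<rho> x \<in> U" using x \<rho>U fixedD(1) U by (blast intro: stable_vsub)
    hence "u \<in> U" using u fixed_p_cancel[of u] unfolding U_def by simp
    thus "x \<boxminus> \<rho> x \<in> p_multiples U" using u by (simp add: p_multiplesI)
  qed (rule \<rho>U)
  thus ?case using Suc layer_coordinates unfolding U_def[symmetric] sub[symmetric] by blast
qed

end

section \<open>Discrete valuation domains\<close>

context discrete_valuation_domain
begin

lemma unit_or_multiple_of_generator:
  assumes m: "maximalideal (PIdl q) R" and q: "q \<in> carrier R" and r: "r \<in> carrier R"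
  shows "r \<in> Units R \<or> (\<exists>s\<in>carrier R. r = q \<otimes> s)"
proof (rule disjCI)
  assume no: "\<not> (\<exists>s\<in>carrier R. r = q \<otimes> s)"
  show "r \<in> Units R"
  proof (rule ccontr)
    assume nu: "r \<notin> Units R"
    have "r \<noteq> \<zero>" using no q r_null by (metis zero_closed)
    then obtain b where b: "b \<in> carrier R" "ring_irreducible b" "b divides r"
      using exists_irreducible_divisor[of r] r nu by blast
    have "PIdl b = PIdl q"
      using unique_maximalideal irreducible_imp_maximalideal[OF b(1,2)] m by blast
    hence "b \<in> PIdl q" using cgenideal_self[OF b(1)] by simp
    then obtain t where t: "t \<in> carrier R" "b = t \<otimes> q" by (auto simp: cgenideal_def)
    obtain s where "s \<in> carrier R" "r = b \<otimes> s" using b(3) by (auto simp: factor_def)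
    hence "r = q \<otimes> (t \<otimes> s)" "t \<otimes> s \<in> carrier R" using t q by (auto simp: m_ac)
    thus False using no by blast
  qed
qed

end

context principal_domain
begin

lemma generator_not_unit: "maximalideal (PIdl q) R \<Longrightarrow> q \<in> carrier R \<Longrightarrow> q \<notin> Units R"
  using ideal_eq_carrier_iff[of q] maximalideal.I_notcarr by metis

text \<open>Otherwise some nonzero \<open>b \<in> A\<close> is minimal with respect to proper divisibility, which is well-founded
in a principal ideal domain. But \<open>b = q c\<close> with \<open>c \<in> A\<close> a proper divisor of \<open>b\<close>.\<close>

lemma infinitely_divisible_imp_zero:
  assumes q: "q \<in> carrier R" "q \<notin> Units R" and A: "A \<subseteq> carrier R"
    and div: "\<And>a. a \<in> A \<Longrightarrow> \<exists>b\<in>A. a = q \<otimes> b" and a: "a \<in> A"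
  shows "a = \<zero>"
  using a
proof (induction a rule: wf_induct_rule[OF mult_of.division_wellfounded])
  case (1 b)
  show ?case
  proof (rule ccontr)
    assume b0: "b \<noteq> \<zero>"
    obtain c where c: "c \<in> A" "b = q \<otimes> c" using div 1(2) by blast
    have bc: "b \<in> carrier R" "c \<in> carrier R" "b \<noteq> \<zero>" "c \<noteq> \<zero>" "q \<noteq> \<zero>" using 1(2) b0 c A q by auto
    have "\<not> b divides\<^bsub>mult_of R\<^esub> c"
    proof
      assume "b divides\<^bsub>mult_of R\<^esub> c"
      then obtain d where d: "d \<in> carrier R" "c = b \<otimes> d" by (auto simp: factor_def)
      hence "c \<otimes> \<one> = c \<otimes> (q \<otimes> d)" using c bc q by (simp add: m_ac)
      hence "q \<otimes> d = \<one>" using m_lcancel[of c \<one> "q \<otimes> d"] bc d q by simp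
      thus False using q d by (auto simp: Units_def m_comm)
    qed
    moreover have "c divides\<^bsub>mult_of R\<^esub> b"
      using c bc q m_comm by (auto simp: factor_def)
    ultimately have "properfactor (mult_of R) c b" by (simp add: properfactor_def)
    hence "c = \<zero>" using bc c by (intro 1(1)) auto
    thus False using bc by simp
  qed
qed

end

text \<open>A module with coordinates inherits torsion-freeness and separatedness from the ring, coordinate by
coordinate.\<close>

context local_operator
begin

lemma coordinates_torsion_free:
  assumes C: "coordinates f (carrier M) \<Omega> \<tau> \<kappa>" and x: "x \<in> carrier M" "\<pi> \<bullet> x = \<zero>\<^sub>M"
  shows "x = \<zero>\<^sub>M"
proof (rule coordinates_zero[OF C x(1)])
  fix \<omega> assume w: "\<omega> \<in> \<Omega>"
  note lin = coordinates_linear[OF C w]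
  have "\<pi> \<otimes> \<kappa> \<omega> x = \<zero>"
    using linear_form_scale[OF lin, of \<pi> x] x linear_form_vzero[OF lin] stable_carrier_set by simp
  moreover have "\<pi> \<noteq> \<zero>" using p_nonzero by (simp add: \<iota>_def)
  ultimately show "\<kappa> \<omega> x = \<zero>" using integral[of \<pi> "\<kappa> \<omega> x"] linear_form_closed[OF lin] x by auto
qed

lemma coordinates_separated:
  assumes C: "coordinates f (carrier M) \<Omega> \<tau> \<kappa>" and A: "A \<subseteq> carrier M"
    and div: "\<And>x. x \<in> A \<Longrightarrow> \<exists>y\<in>A. x = \<pi> \<bullet> y" and x: "x \<in> A"
    and R: "\<And>B b. B \<subseteq> carrier R \<Longrightarrow> (\<And>a. a \<in> B \<Longrightarrow> \<exists>b\<in>B. a = \<pi> \<otimes> b) \<Longrightarrow> b \<in> B \<Longrightarrow> b = \<zero>"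
  shows "x = \<zero>\<^sub>M"
proof (rule coordinates_zero[OF C])
  show "x \<in> carrier M" using x A by blast
  fix \<omega> assume w: "\<omega> \<in> \<Omega>"
  note lin = coordinates_linear[OF C w]
  show "\<kappa> \<omega> x = \<zero>"
  proof (rule R[of "\<kappa> \<omega> ` A"])
    show "\<kappa> \<omega> ` A \<subseteq> carrier R" using A linear_form_closed[OF lin] by auto
    fix a assume "a \<in> \<kappa> \<omega> ` A"
    then obtain z where z: "z \<in> A" "a = \<kappa> \<omega> z" by blast
    obtain y where y: "y \<in> A" "z = \<pi> \<bullet> y" using div z by blast
    hence "a = \<pi> \<otimes> \<kappa> \<omega> y" using z A linear_form_scale[OF lin] by (auto simp: subset_iff)
    thus "\<exists>b\<in>\<kappa> \<omega> ` A. a = \<pi> \<otimes> b" using y by blast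
  qed (use x in blast)
qed

lemma separated_operatorI:
  assumes C: "coordinates f (carrier M) \<Omega> \<tau> \<kappa>"
    and R: "\<And>B b. B \<subseteq> carrier R \<Longrightarrow> (\<And>a. a \<in> B \<Longrightarrow> \<exists>b\<in>B. a = \<pi> \<otimes> b) \<Longrightarrow> b \<in> B \<Longrightarrow> b = \<zero>"
  shows "separated_operator R M p T"
proof unfold_locales
  fix x assume "x \<in> carrier M" "\<pi> \<bullet> x = \<zero>\<^sub>M"
  thus "x = \<zero>\<^sub>M" by (rule coordinates_torsion_free[OF C])
next
  fix A x assume "A \<subseteq> carrier M" "\<And>x. x \<in> A \<Longrightarrow> \<exists>y\<in>A. x = \<pi> \<bullet> y" "x \<in> A"
  thus "x = \<zero>\<^sub>M" by (rule coordinates_separated[OF C _ _ _ R])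
qed

end

section \<open>Modules over group rings\<close>

lemma (in group) finite_group_ring_carrier:
  "finite (carrier G) \<Longrightarrow> carrier (group_ring R G) = carrier G \<rightarrow>\<^sub>E carrier R"
  by (auto simp: group_ring_def free_module_def)

locale finite_group_module = R?: cring R + G?: group G + GM: left_module "group_ring R G" M
  for R :: "('r, 'a) ring_scheme" and G :: "('g, 'b) monoid_scheme"
    and M :: "('g \<Rightarrow> 'r, 'm, 'c) module_scheme" +
  assumes finite_G: "finite (carrier G)"
begin

abbreviation mon :: "'g \<Rightarrow> 'r \<Rightarrow> 'g \<Rightarrow> 'r" where "mon x r \<equiv> gr_monom R G x r"

lemma gr_carrier: "carrier (group_ring R G) = carrier G \<rightarrow>\<^sub>E carrier R"
  using finite_G by (rule finite_group_ring_carrier)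

lemma mon_closed [simp]: "r \<in> carrier R \<Longrightarrow> mon x r \<in> carrier (group_ring R G)"
  by (auto simp: gr_carrier gr_monom_def)

lemma mon_mult:
  assumes "x \<in> carrier G" "y \<in> carrier G" "r \<in> carrier R" "s \<in> carrier R"
  shows "mon x r \<otimes>\<^bsub>group_ring R G\<^esub> mon y s = mon (x \<otimes>\<^bsub>G\<^esub> y) (r \<otimes>\<^bsub>R\<^esub> s)"
proof -
  have "(\<Oplus>\<^bsub>R\<^esub>u\<in>{u \<in> carrier G. mon x r u \<noteq> \<zero>\<^bsub>R\<^esub>}. mon x r u \<otimes>\<^bsub>R\<^esub> mon y s (inv\<^bsub>G\<^esub> u \<otimes>\<^bsub>G\<^esub> z)) =
      mon (x \<otimes>\<^bsub>G\<^esub> y) (r \<otimes>\<^bsub>R\<^esub> s) z" if z: "z \<in> carrier G" for z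
  proof (cases "r = \<zero>\<^bsub>R\<^esub>")
    case True
    hence e: "{u \<in> carrier G. mon x r u \<noteq> \<zero>\<^bsub>R\<^esub>} = {}" by (auto simp: gr_monom_def)
    show ?thesis unfolding e using assms z True by (simp add: gr_monom_def)
  next
    case False
    hence e: "{u \<in> carrier G. mon x r u \<noteq> \<zero>\<^bsub>R\<^esub>} = {x}" using assms by (auto simp: gr_monom_def)
    have "inv\<^bsub>G\<^esub> x \<otimes>\<^bsub>G\<^esub> z = y \<longleftrightarrow> z = x \<otimes>\<^bsub>G\<^esub> y"
      using assms z by (metis G.inv_closed G.l_inv G.l_one G.m_assoc G.r_inv)
    thus ?thesis unfolding e using assms z by (simp add: gr_monom_def)
  qed
  thus ?thesis
    by (auto simp: group_ring_def gr_monom_def[of R G "x \<otimes>\<^bsub>G\<^esub> y"] intro!: restrict_ext)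
qed

lemma mon_add:
  assumes "r \<in> carrier R" "s \<in> carrier R"
  shows "mon x (r \<oplus>\<^bsub>R\<^esub> s) = mon x r \<oplus>\<^bsub>group_ring R G\<^esub> mon x s"
  using assms by (auto simp: group_ring_def free_module_def gr_monom_def fun_eq_iff)

lemma mon_one: "\<one>\<^bsub>group_ring R G\<^esub> = mon \<one>\<^bsub>G\<^esub> \<one>\<^bsub>R\<^esub>"
  by (simp add: group_ring_def gr_monom_def)

lemma mon_mon_smult:
  assumes "x \<in> carrier G" "y \<in> carrier G" "r \<in> carrier R" "s \<in> carrier R" "v \<in> carrier M"
  shows "mon x r \<odot>\<^bsub>M\<^esub> (mon y s \<odot>\<^bsub>M\<^esub> v) = mon (x \<otimes>\<^bsub>G\<^esub> y) (r \<otimes>\<^bsub>R\<^esub> s) \<odot>\<^bsub>M\<^esub> v"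
  using assms by (simp add: GM.smult_assoc[symmetric] mon_mult)

lemma mon_one_smult: "v \<in> carrier M \<Longrightarrow> mon \<one>\<^bsub>G\<^esub> \<one>\<^bsub>R\<^esub> \<odot>\<^bsub>M\<^esub> v = v"
  using GM.smult_one[of v] by (simp add: mon_one)

lemma gr_zero_smult:
  assumes v: "v \<in> carrier M"
  shows "\<zero>\<^bsub>group_ring R G\<^esub> \<odot>\<^bsub>M\<^esub> v = \<zero>\<^bsub>M\<^esub>"
proof -
  have c: "\<zero>\<^bsub>group_ring R G\<^esub> \<odot>\<^bsub>M\<^esub> v \<in> carrier M" using v by (simp add: GM.smult_closed)
  have "\<zero>\<^bsub>group_ring R G\<^esub> \<odot>\<^bsub>M\<^esub> v \<oplus>\<^bsub>M\<^esub> \<zero>\<^bsub>group_ring R G\<^esub> \<odot>\<^bsub>M\<^esub> v = \<zero>\<^bsub>group_ring R G\<^esub> \<odot>\<^bsub>M\<^esub> v"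
    using GM.smult_l_distr[of "\<zero>\<^bsub>group_ring R G\<^esub>" "\<zero>\<^bsub>group_ring R G\<^esub>" v] v by simp
  thus ?thesis using c by (metis GM.M.add.r_cancel_one')
qed

lemma module_underlying: "module R (underlying_module R G M)"
proof (rule moduleI)
  show "abelian_group (underlying_module R G M)"
  proof (rule abelian_groupI)
    fix x assume x: "x \<in> carrier (underlying_module R G M)"
    hence x': "x \<in> carrier M" by (simp add: underlying_module_def restrict_scalars_def)
    hence "\<ominus>\<^bsub>M\<^esub> x \<in> carrier M \<and> \<ominus>\<^bsub>M\<^esub> x \<oplus>\<^bsub>M\<^esub> x = \<zero>\<^bsub>M\<^esub>" by (simp add: GM.M.l_neg)
    thus "\<exists>y\<in>carrier (underlying_module R G M). y \<oplus>\<^bsub>underlying_module R G M\<^esub> x = \<zero>\<^bsub>underlying_module R G M\<^esub>"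
      by (auto simp: underlying_module_def restrict_scalars_def)
  qed (auto simp: underlying_module_def restrict_scalars_def GM.M.a_ac)
qed (auto simp: underlying_module_def restrict_scalars_def GM.smult_closed GM.smult_r_distr
      mon_add GM.smult_l_distr mon_mon_smult mon_one_smult intro: R.is_cring)

text \<open>An \<open>R\<close>-linear form is determined on \<open>a \<odot> v\<close> by the monomials of \<open>a\<close>. This is the only place where
general elements of the group ring are decomposed.\<close>

lemma additive_smult:
  assumes f: "\<And>v. v \<in> carrier M \<Longrightarrow> f v \<in> carrier R"
      "\<And>v w. v \<in> carrier M \<Longrightarrow> w \<in> carrier M \<Longrightarrow> f (v \<oplus>\<^bsub>M\<^esub> w) = f v \<oplus>\<^bsub>R\<^esub> f w"
      "\<And>r v. r \<in> carrier R \<Longrightarrow> v \<in> carrier M \<Longrightarrow> f (mon \<one>\<^bsub>G\<^esub> r \<odot>\<^bsub>M\<^esub> v) = r \<otimes>\<^bsub>R\<^esub> f v"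
    and a: "a \<in> carrier (group_ring R G)" and v: "v \<in> carrier M"
  shows "f (a \<odot>\<^bsub>M\<^esub> v) =
    (\<Oplus>\<^bsub>R\<^esub>y\<in>{y \<in> carrier G. a y \<noteq> \<zero>\<^bsub>R\<^esub>}. a y \<otimes>\<^bsub>R\<^esub> f (mon y \<one>\<^bsub>R\<^esub> \<odot>\<^bsub>M\<^esub> v))"
proof -
  have gen: "f (a \<odot>\<^bsub>M\<^esub> v) = (\<Oplus>\<^bsub>R\<^esub>y\<in>F. a y \<otimes>\<^bsub>R\<^esub> f (mon y \<one>\<^bsub>R\<^esub> \<odot>\<^bsub>M\<^esub> v))"
    if "finite F" "F \<subseteq> carrier G" "a \<in> carrier (group_ring R G)" "\<forall>y\<in>carrier G - F. a y = \<zero>\<^bsub>R\<^esub>" for F a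
    using that
  proof (induction F arbitrary: a rule: finite_induct)
    case empty
    hence "a z = (\<lambda>z\<in>carrier G. \<zero>\<^bsub>R\<^esub>) z" for z by (cases "z \<in> carrier G") (auto simp: gr_carrier)
    hence "a = \<zero>\<^bsub>group_ring R G\<^esub>" by (auto simp: group_ring_def free_module_def)
    moreover have "f \<zero>\<^bsub>M\<^esub> = \<zero>\<^bsub>R\<^esub>"
      using f(1)[of "\<zero>\<^bsub>M\<^esub>"] f(2)[of "\<zero>\<^bsub>M\<^esub>" "\<zero>\<^bsub>M\<^esub>"] by simp
    ultimately show ?case using gr_zero_smult[OF v] by simp
  next
    case (insert y F)
    have y: "y \<in> carrier G" using insert.prems by simp
    have ac: "a z \<in> carrier R" if "z \<in> carrier G" for z using insert.prems(2) that by (auto simp: gr_carrier)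
    define b where "b = (\<lambda>z\<in>carrier G. if z = y then \<zero>\<^bsub>R\<^esub> else a z)"
    have b: "b \<in> carrier (group_ring R G)" using ac by (auto simp: b_def gr_carrier)
    have ab: "a = mon y (a y) \<oplus>\<^bsub>group_ring R G\<^esub> b"
      using insert.prems(2) ac
      by (auto simp: b_def group_ring_def free_module_def gr_monom_def fun_eq_iff PiE_def extensional_def)
    have b0: "\<forall>z\<in>carrier G - F. b z = \<zero>\<^bsub>R\<^esub>" using insert.prems(3) by (auto simp: b_def)
    have IH: "f (b \<odot>\<^bsub>M\<^esub> v) = (\<Oplus>\<^bsub>R\<^esub>z\<in>F. b z \<otimes>\<^bsub>R\<^esub> f (mon z \<one>\<^bsub>R\<^esub> \<odot>\<^bsub>M\<^esub> v))"
      using insert.IH[OF _ b b0] insert.prems(1) by simp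
    have fc: "f (mon z \<one>\<^bsub>R\<^esub> \<odot>\<^bsub>M\<^esub> v) \<in> carrier R" for z using v by (simp add: f(1) GM.smult_closed)
    have "a \<odot>\<^bsub>M\<^esub> v = mon y (a y) \<odot>\<^bsub>M\<^esub> v \<oplus>\<^bsub>M\<^esub> b \<odot>\<^bsub>M\<^esub> v"
      using GM.smult_l_distr[of "mon y (a y)" b v] ab ac[OF y] b v by simp
    hence "f (a \<odot>\<^bsub>M\<^esub> v) = f (mon y (a y) \<odot>\<^bsub>M\<^esub> v) \<oplus>\<^bsub>R\<^esub> f (b \<odot>\<^bsub>M\<^esub> v)"
      using ac[OF y] b v by (simp add: f(2) GM.smult_closed)
    also have "mon y (a y) \<odot>\<^bsub>M\<^esub> v = mon \<one>\<^bsub>G\<^esub> (a y) \<odot>\<^bsub>M\<^esub> (mon y \<one>\<^bsub>R\<^esub> \<odot>\<^bsub>M\<^esub> v)"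
      using y ac[OF y] v by (simp add: mon_mon_smult)
    also have "f \<dots> = a y \<otimes>\<^bsub>R\<^esub> f (mon y \<one>\<^bsub>R\<^esub> \<odot>\<^bsub>M\<^esub> v)"
      using ac[OF y] v by (simp add: f(3) GM.smult_closed)
    also have "f (b \<odot>\<^bsub>M\<^esub> v) = (\<Oplus>\<^bsub>R\<^esub>z\<in>F. a z \<otimes>\<^bsub>R\<^esub> f (mon z \<one>\<^bsub>R\<^esub> \<odot>\<^bsub>M\<^esub> v))"
      unfolding IH using insert.hyps(2) insert.prems(1) ac fc
      by (intro R.finsum_cong') (auto simp: b_def)
    finally show ?case
      using insert.hyps insert.prems(1) ac fc by (subst R.finsum_insert) auto
  qed
  show ?thesis by (rule gen) (use a finite_G in auto)
qed

end

text \<open>The isomorphism with \<open>R[\<Omega>]\<close>, described by its components and by the action of monomials alone.\<close>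

definition permutation_coordinates ::
  "('r, 'a) ring_scheme \<Rightarrow> ('h, 'b) monoid_scheme \<Rightarrow> ('h \<Rightarrow> 'r, 'm, 'c) module_scheme
    \<Rightarrow> 'w set \<Rightarrow> ('h \<Rightarrow> 'w \<Rightarrow> 'w) \<Rightarrow> ('w \<Rightarrow> 'm \<Rightarrow> 'r) \<Rightarrow> bool" where
  "permutation_coordinates R H Y \<Omega> \<phi> \<kappa> \<longleftrightarrow>
    finite \<Omega> \<and> (\<forall>y\<in>carrier H. bij_betw (\<phi> y) \<Omega> \<Omega>) \<and>
    (\<forall>\<omega>\<in>\<Omega>. \<forall>x\<in>carrier Y. \<kappa> \<omega> x \<in> carrier R) \<and>
    (\<forall>\<omega>\<in>\<Omega>. \<forall>x\<in>carrier Y. \<forall>y\<in>carrier Y. \<kappa> \<omega> (x \<oplus>\<^bsub>Y\<^esub> y) = \<kappa> \<omega> x \<oplus>\<^bsub>R\<^esub> \<kappa> \<omega> y) \<and>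
    (\<forall>\<omega>\<in>\<Omega>. \<forall>r\<in>carrier R. \<forall>x\<in>carrier Y.
      \<kappa> \<omega> (gr_monom R H \<one>\<^bsub>H\<^esub> r \<odot>\<^bsub>Y\<^esub> x) = r \<otimes>\<^bsub>R\<^esub> \<kappa> \<omega> x) \<and>
    (\<forall>\<omega>\<in>\<Omega>. \<forall>y\<in>carrier H. \<forall>x\<in>carrier Y. \<kappa> (\<phi> y \<omega>) (gr_monom R H y \<one>\<^bsub>R\<^esub> \<odot>\<^bsub>Y\<^esub> x) = \<kappa> \<omega> x) \<and>
    (\<forall>x\<in>carrier Y. (\<forall>\<omega>\<in>\<Omega>. \<kappa> \<omega> x = \<zero>\<^bsub>R\<^esub>) \<longrightarrow> x = \<zero>\<^bsub>Y\<^esub>) \<and>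
    (\<forall>c\<in>\<Omega> \<rightarrow> carrier R. \<exists>x\<in>carrier Y. \<forall>\<omega>\<in>\<Omega>. \<kappa> \<omega> x = c \<omega>)"

lemma (in cring) permutation_module_coordinates:
  fixes H :: "('h, 'd) monoid_scheme" and Y :: "('h \<Rightarrow> 'a, 'x, 'c) module_scheme"
  assumes Y: "permutation_module R H Y" and H: "group H" and fin: "finite (carrier H)"
  obtains \<Omega> :: "nat set" and \<phi> \<kappa> where "permutation_coordinates R H Y \<Omega> \<phi> \<kappa>"
proof -
  interpret H: group H by (rule H)
  have mod: "left_module (group_ring R H) Y"
    and "\<exists>(\<Omega> :: nat set) \<phi>. finite \<Omega> \<and> group_action H \<Omega> \<phi> \<and>
      left_module_isomorphic (group_ring R H) Y (set_module R H \<Omega> \<phi>)"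
    using Y by (auto simp: permutation_module_def)
  then obtain \<Omega> :: "nat set" and \<phi> h where fO: "finite \<Omega>" and act: "group_action H \<Omega> \<phi>"
    and h: "h \<in> left_module_hom (group_ring R H) Y (set_module R H \<Omega> \<phi>)"
    and bij: "bij_betw h (carrier Y) (carrier (set_module R H \<Omega> \<phi>))"
    unfolding left_module_isomorphic_def by blast
  interpret Y: left_module "group_ring R H" Y by (rule mod)
  interpret A: group_action H \<Omega> \<phi> by (rule act)
  have car: "carrier (set_module R H \<Omega> \<phi>) = \<Omega> \<rightarrow>\<^sub>E carrier R"
    using fO by (auto simp: set_module_def free_module_def)
  define \<kappa> where "\<kappa> \<omega> x = h x \<omega>" for \<omega> x
  have hc: "h x \<in> \<Omega> \<rightarrow>\<^sub>E carrier R" if "x \<in> carrier Y" for x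
    using h that unfolding left_module_hom_def car[symmetric] by blast
  have kc: "\<kappa> \<omega> x \<in> carrier R" if "\<omega> \<in> \<Omega>" "x \<in> carrier Y" for \<omega> x
    using hc[OF that(2)] that(1) by (auto simp: \<kappa>_def)
  have kadd: "\<kappa> \<omega> (x \<oplus>\<^bsub>Y\<^esub> y) = \<kappa> \<omega> x \<oplus> \<kappa> \<omega> y" if "\<omega> \<in> \<Omega>" "x \<in> carrier Y" "y \<in> carrier Y" for \<omega> x y
    using h that by (simp add: left_module_hom_def \<kappa>_def set_module_def free_module_def)
  have \<phi>: "\<phi> y \<omega> \<in> \<Omega>" if "y \<in> carrier H" "\<omega> \<in> \<Omega>" for y \<omega> using A.element_image[OF that refl] .
  have kmon: "\<kappa> \<omega> (gr_monom R H y r \<odot>\<^bsub>Y\<^esub> x) = r \<otimes> \<kappa> (\<phi> (inv\<^bsub>H\<^esub> y) \<omega>) x"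
    if w: "\<omega> \<in> \<Omega>" and y: "y \<in> carrier H" and r: "r \<in> carrier R" and x: "x \<in> carrier Y" for \<omega> y r x
  proof -
    have "gr_monom R H y r \<in> carrier (group_ring R H)"
      using r by (auto simp: H.finite_group_ring_carrier[OF fin] gr_monom_def)
    hence "\<kappa> \<omega> (gr_monom R H y r \<odot>\<^bsub>Y\<^esub> x) =
        (gr_monom R H y r \<odot>\<^bsub>set_module R H \<Omega> \<phi>\<^esub> h x) \<omega>"
      using h x by (simp add: left_module_hom_def \<kappa>_def)
    also have "\<dots> = (\<Oplus>u\<in>{u \<in> carrier H. gr_monom R H y r u \<noteq> \<zero>}. gr_monom R H y r u \<otimes> \<kappa> (\<phi> (inv\<^bsub>H\<^esub> u) \<omega>) x)"
      using w by (simp add: set_module_def \<kappa>_def)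
    also have "\<dots> = r \<otimes> \<kappa> (\<phi> (inv\<^bsub>H\<^esub> y) \<omega>) x"
    proof (cases "r = \<zero>")
      case True
      hence e: "{u \<in> carrier H. gr_monom R H y r u \<noteq> \<zero>} = {}" by (auto simp: gr_monom_def)
      show ?thesis unfolding e using True kc[OF \<phi>[OF H.inv_closed[OF y] w] x] by simp
    next
      case False
      hence e: "{u \<in> carrier H. gr_monom R H y r u \<noteq> \<zero>} = {y}" using y by (auto simp: gr_monom_def)
      show ?thesis unfolding e using r y kc[OF \<phi>[OF H.inv_closed[OF y] w] x] by (simp add: gr_monom_def)
    qed
    finally show ?thesis .
  qed
  have kone: "\<kappa> \<omega> (gr_monom R H \<one>\<^bsub>H\<^esub> r \<odot>\<^bsub>Y\<^esub> x) = r \<otimes> \<kappa> \<omega> x"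
    if "\<omega> \<in> \<Omega>" "r \<in> carrier R" "x \<in> carrier Y" for \<omega> r x
    using kmon[OF that(1) H.one_closed that(2,3)] that(1)
    by (metis A.id_eq_one H.inv_one restrict_apply')
  have kact: "\<kappa> (\<phi> y \<omega>) (gr_monom R H y \<one> \<odot>\<^bsub>Y\<^esub> x) = \<kappa> \<omega> x"
    if "\<omega> \<in> \<Omega>" "y \<in> carrier H" "x \<in> carrier Y" for \<omega> y x
    using kmon[OF \<phi>[OF that(2,1)] that(2) one_closed that(3)] A.orbit_sym_aux[OF that(2,1) refl] kc that
    by simp
  have kinj: "x = \<zero>\<^bsub>Y\<^esub>" if x: "x \<in> carrier Y" and z: "\<And>\<omega>. \<omega> \<in> \<Omega> \<Longrightarrow> \<kappa> \<omega> x = \<zero>" for x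
  proof -
    have "\<kappa> \<omega> \<zero>\<^bsub>Y\<^esub> = \<zero>" if "\<omega> \<in> \<Omega>" for \<omega>
      using kadd[OF that Y.M.zero_closed Y.M.zero_closed] kc[OF that Y.M.zero_closed]
      by (metis Y.M.l_zero Y.M.zero_closed add.r_cancel_one')
    hence "h x = h \<zero>\<^bsub>Y\<^esub>" using z hc[OF x] hc[OF Y.M.zero_closed]
      by (intro PiE_ext[of _ \<Omega> "\<lambda>_. carrier R"]) (auto simp: \<kappa>_def)
    thus ?thesis using bij x Y.M.zero_closed by (auto simp: bij_betw_def inj_on_def)
  qed
  have ksurj: "\<exists>x\<in>carrier Y. \<forall>\<omega>\<in>\<Omega>. \<kappa> \<omega> x = c \<omega>" if "c \<in> \<Omega> \<rightarrow> carrier R" for c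
  proof -
    have "restrict c \<Omega> \<in> carrier (set_module R H \<Omega> \<phi>)" using that by (auto simp: car)
    then obtain x where "x \<in> carrier Y" "h x = restrict c \<Omega>"
      using bij unfolding bij_betw_def by (metis imageE)
    thus ?thesis by (intro bexI[of _ x]) (auto simp: \<kappa>_def)
  qed
  have "bij_betw (\<phi> y) \<Omega> \<Omega>" if "y \<in> carrier H" for y
    using A.bij_prop0[OF that] by (auto simp: Bij_def)
  hence "permutation_coordinates R H Y \<Omega> \<phi> \<kappa>"
    unfolding permutation_coordinates_def
    by (intro conjI ballI impI fO kc kadd kone kact kinj ksurj) auto
  thus thesis by (rule that)
qed

context finite_group_module
begin

text \<open>Only the existence of a permuted index \<open>\<omega>'\<close> is demanded. The coordinate functions are pairwise
different, so \<open>\<omega>'\<close> is unique, and uniqueness makes the permutations into a group action.\<close>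

lemma permutation_moduleI:
  fixes \<Omega> :: "nat set"
  assumes nontrivial: "\<one>\<^bsub>R\<^esub> \<noteq> \<zero>\<^bsub>R\<^esub>" and fin: "finite \<Omega>"
    and closed: "\<And>\<omega> x. \<omega> \<in> \<Omega> \<Longrightarrow> x \<in> carrier M \<Longrightarrow> \<kappa> \<omega> x \<in> carrier R"
    and add: "\<And>\<omega> x y. \<omega> \<in> \<Omega> \<Longrightarrow> x \<in> carrier M \<Longrightarrow> y \<in> carrier M \<Longrightarrow>
      \<kappa> \<omega> (x \<oplus>\<^bsub>M\<^esub> y) = \<kappa> \<omega> x \<oplus>\<^bsub>R\<^esub> \<kappa> \<omega> y"
    and scal: "\<And>\<omega> r x. \<omega> \<in> \<Omega> \<Longrightarrow> r \<in> carrier R \<Longrightarrow> x \<in> carrier M \<Longrightarrow>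
      \<kappa> \<omega> (mon \<one>\<^bsub>G\<^esub> r \<odot>\<^bsub>M\<^esub> x) = r \<otimes>\<^bsub>R\<^esub> \<kappa> \<omega> x"
    and perm: "\<And>y \<omega>. y \<in> carrier G \<Longrightarrow> \<omega> \<in> \<Omega> \<Longrightarrow>
      \<exists>\<omega>'\<in>\<Omega>. \<forall>x\<in>carrier M. \<kappa> \<omega>' (mon y \<one>\<^bsub>R\<^esub> \<odot>\<^bsub>M\<^esub> x) = \<kappa> \<omega> x"
    and inj: "\<And>x y. x \<in> carrier M \<Longrightarrow> y \<in> carrier M \<Longrightarrow> (\<And>\<omega>. \<omega> \<in> \<Omega> \<Longrightarrow> \<kappa> \<omega> x = \<kappa> \<omega> y) \<Longrightarrow> x = y"
    and surj: "\<And>c. c \<in> \<Omega> \<rightarrow> carrier R \<Longrightarrow> \<exists>x\<in>carrier M. \<forall>\<omega>\<in>\<Omega>. \<kappa> \<omega> x = c \<omega>"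
  shows "permutation_module R G M"
proof -
  have mc: "mon y \<one>\<^bsub>R\<^esub> \<odot>\<^bsub>M\<^esub> x \<in> carrier M" if "x \<in> carrier M" for x y
    using that by (simp add: GM.smult_closed)
  have sep: "\<omega> = \<omega>'" if w: "\<omega> \<in> \<Omega>" "\<omega>' \<in> \<Omega>" and eq: "\<And>x. x \<in> carrier M \<Longrightarrow> \<kappa> \<omega> x = \<kappa> \<omega>' x" for \<omega> \<omega>'
  proof (rule ccontr)
    assume ne: "\<omega> \<noteq> \<omega>'"
    obtain x where "x \<in> carrier M" "\<forall>\<nu>\<in>\<Omega>. \<kappa> \<nu> x = (if \<nu> = \<omega> then \<one>\<^bsub>R\<^esub> else \<zero>\<^bsub>R\<^esub>)"
      using surj[of "\<lambda>\<nu>. if \<nu> = \<omega> then \<one>\<^bsub>R\<^esub> else \<zero>\<^bsub>R\<^esub>"] by auto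
    thus False using eq[of x] w ne nontrivial by simp
  qed
  define \<phi> where "\<phi> y = (\<lambda>\<omega>\<in>\<Omega>. SOME \<omega>'. \<omega>' \<in> \<Omega> \<and> (\<forall>x\<in>carrier M. \<kappa> \<omega>' (mon y \<one>\<^bsub>R\<^esub> \<odot>\<^bsub>M\<^esub> x) = \<kappa> \<omega> x))"
    for y
  have \<phi>': "\<phi> y \<omega> \<in> \<Omega> \<and> (\<forall>x\<in>carrier M. \<kappa> (\<phi> y \<omega>) (mon y \<one>\<^bsub>R\<^esub> \<odot>\<^bsub>M\<^esub> x) = \<kappa> \<omega> x)"
    if "y \<in> carrier G" "\<omega> \<in> \<Omega>" for y \<omega>
    using someI_ex[of "\<lambda>\<omega>'. \<omega>' \<in> \<Omega> \<and> (\<forall>x\<in>carrier M. \<kappa> \<omega>' (mon y \<one>\<^bsub>R\<^esub> \<odot>\<^bsub>M\<^esub> x) = \<kappa> \<omega> x)"]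
      perm[OF that] that(2) unfolding \<phi>_def by auto
  have \<phi>_in: "\<phi> y \<omega> \<in> \<Omega>" if "y \<in> carrier G" "\<omega> \<in> \<Omega>" for y \<omega> using \<phi>'[OF that] by blast
  have \<phi>_eq: "\<kappa> (\<phi> y \<omega>) (mon y \<one>\<^bsub>R\<^esub> \<odot>\<^bsub>M\<^esub> x) = \<kappa> \<omega> x"
    if "y \<in> carrier G" "\<omega> \<in> \<Omega>" "x \<in> carrier M" for y \<omega> x using \<phi>'[OF that(1,2)] that(3) by blast
  have transl: "\<exists>z\<in>carrier M. x = mon y \<one>\<^bsub>R\<^esub> \<odot>\<^bsub>M\<^esub> z" if "y \<in> carrier G" "x \<in> carrier M" for x y
    using that mc[of x "inv\<^bsub>G\<^esub> y"]
    by (intro bexI[of _ "mon (inv\<^bsub>G\<^esub> y) \<one>\<^bsub>R\<^esub> \<odot>\<^bsub>M\<^esub> x"]) (simp_all add: mon_mon_smult mon_one_smult)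
  have \<phi>_mult: "\<phi> (y \<otimes>\<^bsub>G\<^esub> z) \<omega> = \<phi> y (\<phi> z \<omega>)" if y: "y \<in> carrier G" and z: "z \<in> carrier G" and w: "\<omega> \<in> \<Omega>" for y z \<omega>
  proof (rule sep)
    fix x assume "x \<in> carrier M"
    then obtain v where v: "v \<in> carrier M" "x = mon (y \<otimes>\<^bsub>G\<^esub> z) \<one>\<^bsub>R\<^esub> \<odot>\<^bsub>M\<^esub> v"
      using transl[of "y \<otimes>\<^bsub>G\<^esub> z" x] y z by blast
    have "\<kappa> (\<phi> y (\<phi> z \<omega>)) x = \<kappa> \<omega> v"
      using v y z w \<phi>_eq[OF y \<phi>_in[OF z w] mc[OF v(1), of z]] \<phi>_eq[OF z w v(1)]
      by (simp add: mon_mon_smult)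
    thus "\<kappa> (\<phi> (y \<otimes>\<^bsub>G\<^esub> z) \<omega>) x = \<kappa> (\<phi> y (\<phi> z \<omega>)) x"
      using v \<phi>_eq[of "y \<otimes>\<^bsub>G\<^esub> z" \<omega> v] y z w by simp
  qed (use that \<phi>_in in auto)
  have \<phi>_one: "\<phi> \<one>\<^bsub>G\<^esub> \<omega> = \<omega>" if w: "\<omega> \<in> \<Omega>" for \<omega>
    using \<phi>_eq[OF G.one_closed w] \<phi>_in[OF G.one_closed w] w by (intro sep) (auto simp: mon_one_smult)
  have \<phi>_inv: "\<phi> y (\<phi> (inv\<^bsub>G\<^esub> y) \<omega>) = \<omega>" "\<phi> (inv\<^bsub>G\<^esub> y) (\<phi> y \<omega>) = \<omega>" if "y \<in> carrier G" "\<omega> \<in> \<Omega>" for y \<omega>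
    using that \<phi>_one by (simp_all flip: \<phi>_mult)
  have bij: "\<phi> y \<in> Bij \<Omega>" if y: "y \<in> carrier G" for y
  proof -
    have "bij_betw (\<phi> y) \<Omega> \<Omega>"
      by (rule bij_betw_byWitness[where f' = "\<phi> (inv\<^bsub>G\<^esub> y)"]) (use y \<phi>_inv \<phi>_in in auto)
    thus ?thesis by (simp add: Bij_def \<phi>_def)
  qed
  have "group_action G \<Omega> \<phi>"
  proof (unfold group_action_def group_hom_def group_hom_axioms_def, intro conjI)
    show "\<phi> \<in> hom G (BijGroup \<Omega>)"
    proof (rule homI, goal_cases)
      case (2 y z)
      note yz = this
      have "\<phi> (y \<otimes>\<^bsub>G\<^esub> z) \<omega> = compose \<Omega> (\<phi> y) (\<phi> z) \<omega>" for \<omega>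
        using yz \<phi>_mult by (cases "\<omega> \<in> \<Omega>") (simp_all add: compose_def, simp add: \<phi>_def)
      thus ?case
        using yz bij by (simp add: BijGroup_def fun_eq_iff)
    qed (use bij in \<open>simp add: BijGroup_def\<close>)
  qed (auto simp: group_BijGroup G.group_axioms)
  moreover define h where "h x = (\<lambda>\<omega>\<in>\<Omega>. \<kappa> \<omega> x)" for x
  have car: "carrier (set_module R G \<Omega> \<phi>) = \<Omega> \<rightarrow>\<^sub>E carrier R"
    using fin by (auto simp: set_module_def free_module_def)
  have "h \<in> left_module_hom (group_ring R G) M (set_module R G \<Omega> \<phi>)"
    unfolding left_module_hom_def car
  proof (intro CollectI conjI ballI Pi_I)
    fix x assume "x \<in> carrier M"
    thus "h x \<in> \<Omega> \<rightarrow>\<^sub>E carrier R" using closed by (auto simp: h_def)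
  next
    fix x y assume "x \<in> carrier M" "y \<in> carrier M"
    thus "h (x \<oplus>\<^bsub>M\<^esub> y) = h x \<oplus>\<^bsub>set_module R G \<Omega> \<phi>\<^esub> h y"
      using add by (auto simp: h_def set_module_def free_module_def)
  next
    fix a x assume a: "a \<in> carrier (group_ring R G)" and x: "x \<in> carrier M"
    have "\<kappa> \<omega> (a \<odot>\<^bsub>M\<^esub> x) =
        (\<Oplus>\<^bsub>R\<^esub>y\<in>{y \<in> carrier G. a y \<noteq> \<zero>\<^bsub>R\<^esub>}. a y \<otimes>\<^bsub>R\<^esub> h x (\<phi> (inv\<^bsub>G\<^esub> y) \<omega>))" if w: "\<omega> \<in> \<Omega>" for \<omega>
    proof -
      have "\<kappa> \<omega> (a \<odot>\<^bsub>M\<^esub> x) =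
          (\<Oplus>\<^bsub>R\<^esub>y\<in>{y \<in> carrier G. a y \<noteq> \<zero>\<^bsub>R\<^esub>}. a y \<otimes>\<^bsub>R\<^esub> \<kappa> \<omega> (mon y \<one>\<^bsub>R\<^esub> \<odot>\<^bsub>M\<^esub> x))"
        using w a x by (intro additive_smult closed add scal)
      also have "\<dots> = (\<Oplus>\<^bsub>R\<^esub>y\<in>{y \<in> carrier G. a y \<noteq> \<zero>\<^bsub>R\<^esub>}. a y \<otimes>\<^bsub>R\<^esub> h x (\<phi> (inv\<^bsub>G\<^esub> y) \<omega>))"
      proof (rule R.finsum_cong')
        have ac: "a y \<in> carrier R" if "y \<in> carrier G" for y using a that by (auto simp: gr_carrier)
        show "(\<lambda>y. a y \<otimes>\<^bsub>R\<^esub> h x (\<phi> (inv\<^bsub>G\<^esub> y) \<omega>)) \<in> {y \<in> carrier G. a y \<noteq> \<zero>\<^bsub>R\<^esub>} \<rightarrow> carrier R"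
          using ac x w \<phi>_in closed by (auto simp: h_def)
        fix y assume "y \<in> {y \<in> carrier G. a y \<noteq> \<zero>\<^bsub>R\<^esub>}"
        hence y: "y \<in> carrier G" by simp
        show "a y \<otimes>\<^bsub>R\<^esub> \<kappa> \<omega> (mon y \<one>\<^bsub>R\<^esub> \<odot>\<^bsub>M\<^esub> x) = a y \<otimes>\<^bsub>R\<^esub> h x (\<phi> (inv\<^bsub>G\<^esub> y) \<omega>)"
          using \<phi>_eq[OF y \<phi>_in[OF G.inv_closed[OF y] w] x] \<phi>_inv(1)[OF y w] \<phi>_in[OF G.inv_closed[OF y] w]
          by (simp add: h_def)
      qed simp
      finally show ?thesis .
    qed
    thus "h (a \<odot>\<^bsub>M\<^esub> x) = a \<odot>\<^bsub>set_module R G \<Omega> \<phi>\<^esub> h x"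
      by (auto simp: set_module_def h_def[of "a \<odot>\<^bsub>M\<^esub> x"] intro!: restrict_ext)
  qed
  moreover have "bij_betw h (carrier M) (carrier (set_module R G \<Omega> \<phi>))"
  proof (rule bij_betw_imageI)
    show "inj_on h (carrier M)"
      by (rule inj_onI, rule inj) (auto simp: h_def fun_eq_iff restrict_def split: if_splits)
    show "h ` carrier M = carrier (set_module R G \<Omega> \<phi>)"
      unfolding car
    proof safe
      fix x \<omega> assume "x \<in> carrier M" "\<omega> \<in> \<Omega>"
      thus "h x \<omega> \<in> carrier R" using closed by (simp add: h_def)
    next
      fix x \<omega> assume "\<omega> \<notin> \<Omega>"
      thus "h x \<omega> = undefined" by (simp add: h_def)
    next
      fix c assume c: "c \<in> \<Omega> \<rightarrow>\<^sub>E carrier R"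
      then obtain x where x: "x \<in> carrier M" "\<forall>\<omega>\<in>\<Omega>. \<kappa> \<omega> x = c \<omega>" using surj[of c] by auto
      have "h x \<in> \<Omega> \<rightarrow>\<^sub>E carrier R" using x closed by (auto simp: h_def)
      hence "h x = c" by (rule PiE_ext[OF _ c]) (use x in \<open>simp add: h_def\<close>)
      thus "c \<in> h ` carrier M" using x by blast
    qed
  qed
  ultimately show ?thesis
    using fin GM.left_module_axioms unfolding permutation_module_def left_module_isomorphic_def by blast
qed

end

text \<open>Let \<open>p\<^sup>a\<close> be the least power of \<open>p\<close> with \<open>g [^] p\<^sup>a \<in> N\<close>. If \<open>g [^] m \<in> N\<close>, then \<open>g [^] gcd m (p\<^sup>k) \<in> N\<close> by
Bezout's identity, and this gcd is a power of \<open>p\<close>.\<close>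

lemma (in group) cyclic_p_group_subgroup:
  fixes p :: nat
  assumes p: "Factorial_Ring.prime p" and ord: "order G = p ^ k"
    and cyc: "cyclic_group G" and N: "subgroup N G"
  obtains g a where "g \<in> carrier G" "carrier G = range (\<lambda>l::nat. g [^] l)" "a \<le> k"
    "N = range (\<lambda>l::nat. g [^] (p ^ a * l))" "g [^] (p ^ k) = \<one>"
proof -
  obtain g where g: "g \<in> carrier G" and int: "carrier G = range (\<lambda>n::int. g [^] n)"
    using cyc by (auto simp: cyclic_group)
  have pk: "g [^] (p ^ k) = \<one>" using pow_order_eq_1[OF g] ord by simp
  have pk_pos: "p ^ k > 0" using p by (simp add: prime_gt_0_nat)
  have nat_pow: "g [^] n = g [^] nat (n mod int (p ^ k))" for n :: int
  proof -
    have "g [^] n = g [^] (n mod int (p ^ k) + int (p ^ k) * (n div int (p ^ k)))" by simp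
    also have "\<dots> = g [^] (n mod int (p ^ k)) \<otimes> (g [^] int (p ^ k)) [^] (n div int (p ^ k))"
      using g by (simp only: int_pow_mult int_pow_pow)
    also have "g [^] int (p ^ k) = \<one>" using pk by (simp only: int_pow_int)
    finally have "g [^] n = g [^] (n mod int (p ^ k))" using g by simp
    also have "n mod int (p ^ k) = int (nat (n mod int (p ^ k)))" using pk_pos by simp
    finally show ?thesis by (simp only: int_pow_int)
  qed
  have G: "carrier G = range (\<lambda>l::nat. g [^] l)"
  proof (intro equalityI subsetI)
    fix x assume "x \<in> carrier G"
    then obtain n :: int where "x = g [^] n" using int by blast
    thus "x \<in> range (\<lambda>l::nat. g [^] l)" using nat_pow[of n] by blast
  qed (use g in auto)
  define a where "a = (LEAST a. g [^] (p ^ a) \<in> N)"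
  have one: "g [^] (p ^ k) \<in> N" using pk subgroup.one_closed[OF N] by simp
  have a: "g [^] (p ^ a) \<in> N" unfolding a_def by (rule LeastI[of "\<lambda>a. g [^] (p ^ a) \<in> N"]) (rule one)
  have ak: "a \<le> k" unfolding a_def by (rule Least_le) (rule one)
  have "N = range (\<lambda>l::nat. g [^] (p ^ a * l))"
  proof (intro equalityI subsetI)
    fix x assume x: "x \<in> N"
    then obtain m :: nat where m: "x = g [^] m" using G subgroup.mem_carrier[OF N] by blast
    obtain b where b: "gcd m (p ^ k) = p ^ b"
      using divides_primepow_nat[OF p] gcd_dvd2 by metis
    obtain u v :: int where uv: "u * int m + v * int (p ^ k) = int (p ^ b)"
      using bezout_int[of "int m" "int (p ^ k)"] b by (metis gcd_int_int_eq)
    have "g [^] (p ^ b) = g [^] (int m * u + int (p ^ k) * v)"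
      using uv by (simp add: mult.commute flip: int_pow_int)
    also have "\<dots> = (g [^] int m) [^] u \<otimes> (g [^] int (p ^ k)) [^] v"
      using g by (simp only: int_pow_mult int_pow_pow)
    also have "\<dots> = x [^] u" using g pk m by (simp only: int_pow_int) simp
    also have "\<dots> \<in> N" using x subgroup_int_pow_closed[OF N] by blast
    finally have "a \<le> b" unfolding a_def by (rule Least_le)
    hence "p ^ a dvd m" using b by (metis dvd_trans gcd_dvd1 le_imp_power_dvd)
    thus "x \<in> range (\<lambda>l::nat. g [^] (p ^ a * l))" using m by (auto elim: dvdE)
  next
    fix x assume "x \<in> range (\<lambda>l::nat. g [^] (p ^ a * l))"
    then obtain l :: nat where "x = (g [^] (p ^ a)) [^] l" using g by (auto simp: nat_pow_pow)
    thus "x \<in> N" using a N by (metis int_pow_int subgroup_int_pow_closed)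
  qed
  thus thesis using that g G ak pk by blast
qed

lemma gr_monom_restrict_extend:
  assumes "N \<subseteq> carrier G" "y \<in> N"
  shows "(\<lambda>x\<in>carrier G. if x \<in> N then gr_monom R (G\<lparr>carrier := N\<rparr>) y r x else \<zero>\<^bsub>R\<^esub>) = gr_monom R G y r"
proof
  fix x
  show "(\<lambda>x\<in>carrier G. if x \<in> N then gr_monom R (G\<lparr>carrier := N\<rparr>) y r x else \<zero>\<^bsub>R\<^esub>) x = gr_monom R G y r x"
    using assms by (cases "x \<in> N"; cases "x \<in> carrier G") (auto simp: gr_monom_def)
qed

context finite_group_module
begin

text \<open>All representatives of a coset act alike on invariant vectors, since the factor from \<open>N\<close> can be made
to act first.\<close>

lemma invariants_smult_monom:
  assumes N: "subgroup N G" and comm: "comm_group G"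
    and y: "y \<in> carrier G" and r: "r \<in> carrier R" and x: "x \<in> carrier (invariants_module R G N M)"
  shows "gr_monom R (G Mod N) (N #>\<^bsub>G\<^esub> y) r \<odot>\<^bsub>invariants_module R G N M\<^esub> x = mon y r \<odot>\<^bsub>M\<^esub> x"
proof -
  let ?C = "N #>\<^bsub>G\<^esub> y"
  have C: "?C \<in> carrier (G Mod N)" using y by (auto simp: FactGroup_def RCOSETS_def)
  have xM: "x \<in> carrier M" and xN: "\<And>n. n \<in> N \<Longrightarrow> mon n \<one>\<^bsub>R\<^esub> \<odot>\<^bsub>M\<^esub> x = x"
    using x by (auto simp: invariants_module_def)
  have "y \<in> ?C" using y N by (rule G.rcos_self)
  hence "(SOME g. g \<in> ?C) \<in> ?C" by (rule someI)
  then obtain n where n: "n \<in> N" "(SOME g. g \<in> ?C) = n \<otimes>\<^bsub>G\<^esub> y" by (auto simp: r_coset_def)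
  have nG: "n \<in> carrier G" by (rule subgroup.mem_carrier[OF N n(1)])
  have "mon (SOME g. g \<in> ?C) r \<odot>\<^bsub>M\<^esub> x = mon y r \<odot>\<^bsub>M\<^esub> (mon n \<one>\<^bsub>R\<^esub> \<odot>\<^bsub>M\<^esub> x)"
    using n nG y r xM comm_monoid.m_comm[OF comm_group.axioms(1)[OF comm], of n y]
    by (simp add: mon_mon_smult)
  hence rep: "mon (SOME g. g \<in> ?C) r \<odot>\<^bsub>M\<^esub> x = mon y r \<odot>\<^bsub>M\<^esub> x" using xN n by simp
  have c: "mon y r \<odot>\<^bsub>M\<^esub> x \<in> carrier M" using r xM by (simp add: GM.smult_closed)
  have sum: "gr_monom R (G Mod N) ?C r \<odot>\<^bsub>invariants_module R G N M\<^esub> x =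
      (\<Oplus>\<^bsub>M\<^esub>D\<in>{D \<in> carrier (G Mod N). gr_monom R (G Mod N) ?C r D \<noteq> \<zero>\<^bsub>R\<^esub>}.
        mon (SOME g. g \<in> D) (gr_monom R (G Mod N) ?C r D) \<odot>\<^bsub>M\<^esub> x)"
    by (simp add: invariants_module_def)
  show ?thesis
  proof (cases "r = \<zero>\<^bsub>R\<^esub>")
    case True
    hence e: "{D \<in> carrier (G Mod N). gr_monom R (G Mod N) ?C r D \<noteq> \<zero>\<^bsub>R\<^esub>} = {}" by (auto simp: gr_monom_def)
    have "mon y r = \<zero>\<^bsub>group_ring R G\<^esub>" using True by (auto simp: gr_monom_def group_ring_def free_module_def)
    thus ?thesis unfolding sum e using gr_zero_smult[OF xM] by simp
  next
    case False
    hence e: "{D \<in> carrier (G Mod N). gr_monom R (G Mod N) ?C r D \<noteq> \<zero>\<^bsub>R\<^esub>} = {?C}"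
      using C by (auto simp: gr_monom_def)
    have "(\<Oplus>\<^bsub>M\<^esub>D\<in>{?C}. mon (SOME g. g \<in> D) (gr_monom R (G Mod N) ?C r D) \<odot>\<^bsub>M\<^esub> x) = mon y r \<odot>\<^bsub>M\<^esub> x"
      using C rep c by (simp add: gr_monom_def[of R "G Mod N"])
    thus ?thesis unfolding sum e .
  qed
qed

end

theorem corollaryB:
  fixes R :: "('r, 'a) ring_scheme"
    and G :: "('g, 'b) monoid_scheme"
    and M :: "('g \<Rightarrow> 'r, 'm, 'c) module_scheme"
    and N :: "'g set"
    and p :: nat
  assumes "discrete_valuation_domain R"
    and "\<forall>n::nat. n > 0 \<longrightarrow> [n] \<cdot>\<^bsub>R\<^esub> \<one>\<^bsub>R\<^esub> \<noteq> \<zero>\<^bsub>R\<^esub>"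
    and "Factorial_Ring.prime p"
    and "maximalideal (PIdl\<^bsub>R\<^esub> ([p] \<cdot>\<^bsub>R\<^esub> \<one>\<^bsub>R\<^esub>)) R"
    and "group G" and "finite (carrier G)" and "cyclic_group G" and "\<exists>k. order G = p ^ k"
    and "N \<lhd> G"
    and "group_lattice R G M"
    and "permutation_module R (G\<lparr>carrier := N\<rparr>) (res_module R G N M)"
    and "permutation_module R (G Mod N) (invariants_module R G N M)"
  shows "permutation_module R G M"
proof -
  note p = assms(3) and max = assms(4) and finG = assms(6)
  interpret DV: discrete_valuation_domain R by (rule assms(1))
  interpret GG: group G by (rule assms(5))
  interpret NN: normal N G by (rule assms(9))
  have N: "subgroup N G" by (rule NN.subgroup_axioms)
  have NG: "N \<subseteq> carrier G" by (rule subgroup.subset[OF N])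
  have "left_module (group_ring R G) M" using assms(10) by (simp add: group_lattice_def)
  then interpret F: finite_group_module R G M
    by (simp add: finite_group_module_def finite_group_module_axioms_def DV.is_cring GG.is_group finG)
  obtain k where k: "order G = p ^ k" using assms(8) by blast
  obtain g a where g: "g \<in> carrier G" and G: "carrier G = range (\<lambda>l::nat. g [^]\<^bsub>G\<^esub> l)" and ak: "a \<le> k"
    and Ng: "N = range (\<lambda>l::nat. g [^]\<^bsub>G\<^esub> (p ^ a * l))" and gk: "g [^]\<^bsub>G\<^esub> (p ^ k) = \<one>\<^bsub>G\<^esub>"
    using GG.cyclic_p_group_subgroup[OF p k assms(7) N] by blast
  have comm: "comm_group G" by (rule GG.cyclic_imp_abelian_group[OF assms(7)])
  define q where "q = [p] \<cdot>\<^bsub>R\<^esub> \<one>\<^bsub>R\<^esub>"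
  have q: "[int p] \<cdot>\<^bsub>R\<^esub> \<one>\<^bsub>R\<^esub> = q" by (simp add: q_def add_pow_int_ge)
  have qR: "q \<in> carrier R" by (simp add: q_def)
  define V where "V = underlying_module R G M"
  define T where "T x = gr_monom R G g \<one>\<^bsub>R\<^esub> \<odot>\<^bsub>M\<^esub> x" for x
  have V: "carrier V = carrier M" "\<And>x y. x \<oplus>\<^bsub>V\<^esub> y = x \<oplus>\<^bsub>M\<^esub> y" "\<zero>\<^bsub>V\<^esub> = \<zero>\<^bsub>M\<^esub>"
      "\<And>r x. r \<odot>\<^bsub>V\<^esub> x = gr_monom R G \<one>\<^bsub>G\<^esub> r \<odot>\<^bsub>M\<^esub> x"
    by (simp_all add: V_def underlying_module_def restrict_scalars_def)
  interpret VM: module R V unfolding V_def by (rule F.module_underlying)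
  have nu: "q \<notin> Units R" using DV.generator_not_unit max qR by (simp add: q_def)
  interpret L: local_operator R V p T
  proof unfold_locales
    show "Factorial_Ring.prime p" by (rule p)
    show "[int p] \<cdot>\<^bsub>R\<^esub> \<one>\<^bsub>R\<^esub> \<notin> Units R" using nu q by simp
    show "[int p] \<cdot>\<^bsub>R\<^esub> \<one>\<^bsub>R\<^esub> \<noteq> \<zero>\<^bsub>R\<^esub>"
      using assms(2) prime_gt_0_nat[OF p] unfolding q q_def by blast
  next
    fix r assume "r \<in> carrier R"
    thus "r \<in> Units R \<or> (\<exists>s\<in>carrier R. r = [int p] \<cdot>\<^bsub>R\<^esub> \<one>\<^bsub>R\<^esub> \<otimes>\<^bsub>R\<^esub> s)"
      using DV.unit_or_multiple_of_generator[OF max] unfolding q q_def by simp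
  next
    fix x assume "x \<in> carrier V"
    thus "T x \<in> carrier V" by (simp add: T_def V F.GM.smult_closed)
  next
    fix x y assume "x \<in> carrier V" "y \<in> carrier V"
    thus "T (x \<oplus>\<^bsub>V\<^esub> y) = T x \<oplus>\<^bsub>V\<^esub> T y" by (simp add: T_def V F.GM.smult_r_distr)
  next
    fix r x assume "r \<in> carrier R" "x \<in> carrier V"
    thus "T (r \<odot>\<^bsub>V\<^esub> x) = r \<odot>\<^bsub>V\<^esub> T x" using g by (simp add: T_def V F.mon_mon_smult)
  qed
  have power: "L.act (\<xi> ^ l) x = gr_monom R G (g [^]\<^bsub>G\<^esub> l) \<one>\<^bsub>R\<^esub> \<odot>\<^bsub>M\<^esub> x" if "x \<in> carrier M" for l x
    using that
  proof (induction l)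
    case (Suc l)
    have "L.act (\<xi> ^ Suc l) x = T (L.act (\<xi> ^ l) x)" using Suc.prems L.act_indet_power_Suc V by simp
    also have "\<dots> = gr_monom R G g \<one>\<^bsub>R\<^esub> \<odot>\<^bsub>M\<^esub> (gr_monom R G (g [^]\<^bsub>G\<^esub> l) \<one>\<^bsub>R\<^esub> \<odot>\<^bsub>M\<^esub> x)"
      unfolding Suc.IH[OF Suc.prems] by (rule T_def)
    also have "\<dots> = gr_monom R G (g \<otimes>\<^bsub>G\<^esub> g [^]\<^bsub>G\<^esub> l) \<one>\<^bsub>R\<^esub> \<odot>\<^bsub>M\<^esub> x"
      using Suc.prems g by (simp add: F.mon_mon_smult)
    finally show ?case
      using g comm_monoid.m_comm[OF comm_group.axioms(1)[OF comm], of g "g [^]\<^bsub>G\<^esub> l"] by simp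
  qed (simp add: F.mon_one_smult V L.act_1)
  \<comment> \<open>hypothesis (i): coordinates on \<open>M\<close> permuted by the generator \<open>n\<close> of \<open>N\<close>\<close>
  define n where "n = g [^]\<^bsub>G\<^esub> (p ^ a)"
  have nN: "n \<in> N" unfolding Ng n_def by (rule range_eqI[of _ _ 1]) simp
  let ?H = "G\<lparr>carrier := N\<rparr>" and ?E = "res_module R G N M"
  have "group ?H" using N by (rule GG.subgroup_imp_group)
  moreover have "finite (carrier ?H)" using finG NG finite_subset by auto
  ultimately obtain \<Omega>\<^sub>0 :: "nat set" and \<phi>\<^sub>0 \<kappa>\<^sub>0 where 0: "permutation_coordinates R ?H ?E \<Omega>\<^sub>0 \<phi>\<^sub>0 \<kappa>\<^sub>0"
    using DV.permutation_module_coordinates[OF assms(11)] by blast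
  have E: "carrier ?E = carrier V" "x \<oplus>\<^bsub>?E\<^esub> y = x \<oplus>\<^bsub>V\<^esub> y" "\<zero>\<^bsub>?E\<^esub> = \<zero>\<^bsub>V\<^esub>" for x y
    by (simp_all add: res_module_def restrict_scalars_def V)
  have smE: "gr_monom R ?H y r \<odot>\<^bsub>?E\<^esub> x = gr_monom R G y r \<odot>\<^bsub>M\<^esub> x" if "y \<in> N" for y r x
    by (simp only: res_module_def restrict_scalars_def module.simps gr_monom_restrict_extend[OF NG that])
  have C0: "L.coordinates (\<xi> ^ (p ^ a)) (carrier V) \<Omega>\<^sub>0 (\<phi>\<^sub>0 n) \<kappa>\<^sub>0"
    unfolding L.coordinates_def L.linear_form_def E[symmetric]
  proof (intro conjI ballI impI)
    fix \<omega> x assume w: "\<omega> \<in> \<Omega>\<^sub>0" and x: "x \<in> carrier ?E"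
    show "\<kappa>\<^sub>0 (\<phi>\<^sub>0 n \<omega>) (L.act (\<xi> ^ (p ^ a)) x) = \<kappa>\<^sub>0 \<omega> x"
    proof -
      have "\<kappa>\<^sub>0 (\<phi>\<^sub>0 n \<omega>) (gr_monom R ?H n \<one>\<^bsub>R\<^esub> \<odot>\<^bsub>?E\<^esub> x) = \<kappa>\<^sub>0 \<omega> x"
        using 0 w x nN by (simp add: permutation_coordinates_def)
      thus ?thesis using x smE[OF nN] power[of x "p ^ a"] E V by (simp add: n_def)
    qed
  next
    fix \<omega> r x assume w: "\<omega> \<in> \<Omega>\<^sub>0" and r: "r \<in> carrier R" and x: "x \<in> carrier ?E"
    show "\<kappa>\<^sub>0 \<omega> (r \<odot>\<^bsub>V\<^esub> x) = r \<otimes>\<^bsub>R\<^esub> \<kappa>\<^sub>0 \<omega> x"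
    proof -
      have "\<kappa>\<^sub>0 \<omega> (gr_monom R ?H \<one>\<^bsub>?H\<^esub> r \<odot>\<^bsub>?E\<^esub> x) = r \<otimes>\<^bsub>R\<^esub> \<kappa>\<^sub>0 \<omega> x"
        using 0 w x r unfolding permutation_coordinates_def by blast
      thus ?thesis using smE[OF subgroup.one_closed[OF N]] V by simp
    qed
  qed (use 0 nN in \<open>auto simp: permutation_coordinates_def\<close>)
  have sepR: "b = \<zero>\<^bsub>R\<^esub>" if "B \<subseteq> carrier R" "\<And>a. a \<in> B \<Longrightarrow> \<exists>b\<in>B. a = L.\<iota> (int p) \<otimes>\<^bsub>R\<^esub> b" "b \<in> B" for B b
    using DV.infinitely_divisible_imp_zero[OF qR nu that(1) _ that(3)] that(2) by (simp add: L.\<iota>_def q)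
  interpret S: separated_operator R V p T by (rule L.separated_operatorI[OF C0 sepR])
  \<comment> \<open>hypothesis (ii): coordinates on the vectors fixed by \<open>n\<close>\<close>
  have inv: "carrier (invariants_module R G N M) = L.fixed (p ^ a) (carrier V)"
  proof (intro equalityI subsetI)
    fix x assume "x \<in> carrier (invariants_module R G N M)"
    thus "x \<in> L.fixed (p ^ a) (carrier V)" using nN
      by (auto simp: invariants_module_def L.fixed_def V power n_def)
  next
    fix x assume x: "x \<in> L.fixed (p ^ a) (carrier V)"
    hence xM: "x \<in> carrier M" by (simp add: L.fixed_def V)
    have "L.act (\<xi> ^ (p ^ a * l)) x = x" for l
      by (induction l) (use x in \<open>simp_all add: L.fixed_def power_add L.act_mult\<close>)
    thus "x \<in> carrier (invariants_module R G N M)"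
      using xM by (auto simp: invariants_module_def power Ng)
  qed
  let ?I = "invariants_module R G N M"
  have "group (G Mod N)" by (rule NN.factorgroup_is_group)
  moreover have "finite (carrier (G Mod N))" using finG by (simp add: FactGroup_def RCOSETS_def)
  ultimately obtain \<Omega> :: "nat set" and \<phi> \<kappa> where 1: "permutation_coordinates R (G Mod N) ?I \<Omega> \<phi> \<kappa>"
    using DV.permutation_module_coordinates[OF assms(12)] by blast
  note smI = F.invariants_smult_monom[OF N comm]
  have gI: "gr_monom R (G Mod N) (N #>\<^bsub>G\<^esub> g) \<one>\<^bsub>R\<^esub> \<odot>\<^bsub>?I\<^esub> x = T x" if "x \<in> carrier ?I" for x
    using smI[OF g DV.one_closed that] by (simp add: T_def)
  have "N #>\<^bsub>G\<^esub> \<one>\<^bsub>G\<^esub> = N" using GG.coset_mult_one[OF NG] .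
  hence rI: "gr_monom R (G Mod N) \<one>\<^bsub>G Mod N\<^esub> r \<odot>\<^bsub>?I\<^esub> x = r \<odot>\<^bsub>V\<^esub> x" if "r \<in> carrier R" "x \<in> carrier ?I" for r x
    using smI[OF GG.one_closed that] by (simp add: V)
  have cg: "N #>\<^bsub>G\<^esub> g \<in> carrier (G Mod N)" using g by (auto simp: FactGroup_def RCOSETS_def)
  have addI: "x \<oplus>\<^bsub>?I\<^esub> y = x \<oplus>\<^bsub>V\<^esub> y" "\<zero>\<^bsub>?I\<^esub> = \<zero>\<^bsub>V\<^esub>" for x y by (simp_all add: invariants_module_def V)
  have "L.coordinates \<xi> (carrier ?I) \<Omega> (\<phi> (N #>\<^bsub>G\<^esub> g)) \<kappa>"
    unfolding L.coordinates_def L.linear_form_def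
  proof (intro conjI ballI impI)
    fix \<omega> x assume w: "\<omega> \<in> \<Omega>" and x: "x \<in> carrier ?I"
    have "x \<in> carrier V" using x by (simp add: invariants_module_def V)
    moreover have "\<kappa> (\<phi> (N #>\<^bsub>G\<^esub> g) \<omega>) (gr_monom R (G Mod N) (N #>\<^bsub>G\<^esub> g) \<one>\<^bsub>R\<^esub> \<odot>\<^bsub>?I\<^esub> x) = \<kappa> \<omega> x"
      using 1 w cg x unfolding permutation_coordinates_def by blast
    ultimately show "\<kappa> (\<phi> (N #>\<^bsub>G\<^esub> g) \<omega>) (L.act \<xi> x) = \<kappa> \<omega> x"
      using gI[OF x] by (simp add: L.act_indet)
  next
    fix \<omega> r x assume w: "\<omega> \<in> \<Omega>" and r: "r \<in> carrier R" and x: "x \<in> carrier ?I"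
    have "\<kappa> \<omega> (gr_monom R (G Mod N) \<one>\<^bsub>G Mod N\<^esub> r \<odot>\<^bsub>?I\<^esub> x) = r \<otimes>\<^bsub>R\<^esub> \<kappa> \<omega> x"
      using 1 w r x unfolding permutation_coordinates_def by blast
    thus "\<kappa> \<omega> (r \<odot>\<^bsub>V\<^esub> x) = r \<otimes>\<^bsub>R\<^esub> \<kappa> \<omega> x" using rI[OF r x] by simp
  qed (use 1 cg addI in \<open>auto simp: permutation_coordinates_def\<close>)
  hence C: "L.coordinates \<xi> (L.fixed (p ^ a) (carrier V)) \<Omega> (\<phi> (N #>\<^bsub>G\<^esub> g)) \<kappa>" by (simp add: inv)
  have "L.fixed (p ^ (a + (k - a))) (carrier V) = carrier V"
    using ak gk by (auto simp: L.fixed_def V power F.mon_one_smult)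
  then obtain \<Omega>' :: "nat set" and \<tau> \<kappa>' where C': "L.coordinates \<xi> (carrier V) \<Omega>' \<tau> \<kappa>'"
    using S.coordinates_ascend[OF C0 C, of "k - a"] by auto
  show ?thesis
  proof (rule F.permutation_moduleI)
    show "\<one>\<^bsub>R\<^esub> \<noteq> \<zero>\<^bsub>R\<^esub>" by (rule DV.one_not_zero)
    show "finite \<Omega>'" using C' by (rule L.coordinates_finite)
  next
    fix \<omega> x assume "\<omega> \<in> \<Omega>'" "x \<in> carrier M"
    thus "\<kappa>' \<omega> x \<in> carrier R" using L.linear_form_closed[OF L.coordinates_linear[OF C']] V by simp
  next
    fix \<omega> x y assume "\<omega> \<in> \<Omega>'" "x \<in> carrier M" "y \<in> carrier M"
    thus "\<kappa>' \<omega> (x \<oplus>\<^bsub>M\<^esub> y) = \<kappa>' \<omega> x \<oplus>\<^bsub>R\<^esub> \<kappa>' \<omega> y"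
      using L.linear_form_vadd[OF L.coordinates_linear[OF C']] V by simp
  next
    fix \<omega> r x assume "\<omega> \<in> \<Omega>'" "r \<in> carrier R" "x \<in> carrier M"
    thus "\<kappa>' \<omega> (gr_monom R G \<one>\<^bsub>G\<^esub> r \<odot>\<^bsub>M\<^esub> x) = r \<otimes>\<^bsub>R\<^esub> \<kappa>' \<omega> x"
      using L.linear_form_scale[OF L.coordinates_linear[OF C']] V by simp
  next
    fix y \<omega> assume y: "y \<in> carrier G" and w: "\<omega> \<in> \<Omega>'"
    obtain l :: nat where l: "y = g [^]\<^bsub>G\<^esub> l" using y G by blast
    note Cl = L.coordinates_power[OF C' L.stable_carrier_set, of l]
    show "\<exists>\<omega>'\<in>\<Omega>'. \<forall>x\<in>carrier M. \<kappa>' \<omega>' (gr_monom R G y \<one>\<^bsub>R\<^esub> \<odot>\<^bsub>M\<^esub> x) = \<kappa>' \<omega> x"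
      using L.coordinates_mem[OF Cl w] L.coordinates_act[OF Cl w] V
      by (intro bexI[of _ "(\<tau> ^^ l) \<omega>"]) (simp_all add: l flip: power)
  next
    fix x y assume "x \<in> carrier M" "y \<in> carrier M" "\<And>\<omega>. \<omega> \<in> \<Omega>' \<Longrightarrow> \<kappa>' \<omega> x = \<kappa>' \<omega> y"
    thus "x = y" using L.coordinates_eqI[OF C' L.stable_carrier_set] V by simp
  next
    fix c assume "c \<in> \<Omega>' \<rightarrow> carrier R"
    thus "\<exists>x\<in>carrier M. \<forall>\<omega>\<in>\<Omega>'. \<kappa>' \<omega> x = c \<omega>" using C' V unfolding L.coordinates_def by auto
  qed
qed

end
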